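(* Let $R$ be an algebraically closed field of characteristic $0$, and let $G$ be a finitely generated abelian group. Then there exists an acyclic and coprime generalized seed $(\mathbf{x},\rho,B)$ over $R$ such that the generalized cluster algebra $\mathcal{A}=\mathcal{A}(\mathbf{x},\rho,B)$ is a Krull domain, its class group $\mathcal{C}(\mathcal{A})$ is isomorphic to $G$, and each class of $\mathcal{C}(\mathcal{A})$ contains exactly $|R|$ prime divisors (that is, height-1 prime ideals of $\mathcal{A}$).
   Context: Here $[a,b]$ denotes the set of integers $x$ with $a\le x\le b$; $[x]_+=\max(x,0)$; $\mathbf{q}(R)$ is the quotient field of $R$. Let $n,m\ge 0$ be integers with $n+m>0$, and let the ambient field $\mathcal{F}$ be the rational function field in $n+m$ independent variables over $\mathbf{q}(R)$. An exchange matrix is an $(n+m)\times n$ integer matrix $B=(b_{ij})$ whose submatrix on the first $n$ rows is skew-symmetrizable, i.e. becomes skew-symmetric after left multiplication by some diagonal matrix with positive integer diagonal entries. Fix positive integers $d_1,\dots,d_n$ such that $\beta_{ji}:=b_{ji}/d_i\in\mathbb{Z}$ for all $i\in[1,n]$, $j\in[1,n+m]$. A generalized seed of rank $n$ is a triple $(\mathbf{x},\rho,B)$ where $\mathbf{x}=\{x_1,\dots,x_{n+m}\}\subseteq\mathcal{F}$ is a cluster, i.e. a set of $n+m$ elements algebraically independent over $R$ ($x_1,\dots,x_n$ are the cluster variables and $x_{n+1},\dots,x_{n+m}$ the frozen variables); $B$ is an exchange matrix; and $\rho=\{\rho_i\mid i\in[1,n]\}$ with $\rho_i=\{\rho_{i,0},\dots,\rho_{i,d_i}\}$,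 $\rho_{i,0}=\rho_{i,d_i}=1$ and $\rho_{i,j}$ a monomial (with coefficient in $R$) in $R[x_{n+1},\dots,x_{n+m}]$ for $j\in[1,d_i-1]$. Its exchange polynomials are, for $i\in[1,n]$, $$f_i=\sum_{j=0}^{d_i}\rho_{i,j}\prod_{k=1}^{n+m}x_k^{\,j[\beta_{ki}]_++(d_i-j)[-\beta_{ki}]_+}\in R[\mathbf{x}].$$ The mutation of $(\mathbf{x},\rho,B)$ in direction $i\in[1,n]$ is the generalized seed $\mu_i(\mathbf{x},\rho,B)=(\mathbf{x}_i,\rho',B_i)$ (with the same $d_1,\dots,d_n$), where $\mathbf{x}_i=(\mathbf{x}\setminus\{x_i\})\cup\{x_i'\}$ with $x_i'=f_i/x_i$; $\rho'$ is obtained from $\rho$ by replacing $\rho_i$ by $\rho_i'$, $\rho'_{i,j}=\rho_{i,d_i-j}$; and $B_i=(b'_{kl})$ with $b'_{kl}=-b_{kl}$ if $k=i$ or $l=i$, and $b'_{kl}=b_{kl}+[b_{il}]_+b_{ki}+b_{il}[-b_{ki}]_+$ otherwise. Two generalized seeds are mutation-equivalent if one is obtained from the other by a finite sequence of mutations. The generalized cluster algebra $\mathcal{A}(\mathbf{x},\rho,B)$ is the $R$-subalgebra of $\mathcal{F}$ generated by $x_{n+1}^{\pm1},\dots,x_{n+m}^{\pm1}$ and all cluster variables of all generalized seeds mutation-equivalent to $(\mathbf{x},\rho,B)$. A generalized seed is coprime if $f_1,\dots,f_n$ are pairwise coprime in $R[\mathbf{x}]$. It is acyclic if the directed graph with vertex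 set $[1,n]$ and an edge $i\to j$ if and only if $b_{ij}>0$ has no directed cycles. An "acyclic and coprime generalized cluster algebra" is the generalized cluster algebra of an acyclic and coprime generalized seed. The class group $\mathcal{C}(A)$ of a Krull domain $A$ is the (divisor) class group: the free abelian group on the set of height-1 prime ideals of $A$ modulo the subgroup of principal (fractional) ideals. *)

theory Defs
  imports
    "HOL-Algebra.Free_Abelian_Groups"
    "HOL-Algebra.Ring_Divisibility"
    "HOL-Algebra.Generated_Rings"
    "HOL-Algebra.Algebraic_Closure_Type"
    "HOL-Library.Poly_Mapping"
    "HOL-Library.Extended_Nat"
    "HOL-Library.Equipollence"
    "HOL-Computational_Algebra.Fraction_Field"
begin

section \<open>Krull domains and divisor class groups\<close>

text \<open>
  Domains are handled as subsets of a surrounding field type \<open>'f\<close>, which makes their quotient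
  fields and localizations available as subsets of the same type. The ideal theory is the one of
  HOL-Algebra, applied to the following ring record.
\<close>

definition subring_on :: "'f::field set \<Rightarrow> 'f ring" where
  "subring_on A = ring_of_type_algebra\<lparr>carrier := A\<rparr>"

definition fractions :: "'f::field set \<Rightarrow> 'f set \<Rightarrow> 'f set" where
  "fractions N S = {a / s | a s. a \<in> N \<and> s \<in> S}"

definition quotient_field :: "'f::field set \<Rightarrow> 'f set" where
  "quotient_field A = fractions A (A - {0})"

definition localization :: "'f::field set \<Rightarrow> 'f set \<Rightarrow> 'f set" where
  "localization A P = fractions A (A - P)"

definition prime_height :: "('f, 'm) ring_scheme \<Rightarrow> 'f set \<Rightarrow> enat" where
  "prime_height R P =
     (SUP n \<in> {n. \<exists>Q. (\<forall>i\<le>n. primeideal (Q i) R) \<and> (\<forall>i<n. Q i \<subset> Q (Suc i)) \<and> Q n = P}. enat n)"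

definition height_one_primes :: "'f::field set \<Rightarrow> 'f set set" where
  "height_one_primes A =
     {P. primeideal P (subring_on A) \<and> prime_height (subring_on A) P = 1}"

text \<open>A discrete valuation ring is a principal ideal domain with exactly one nonzero prime ideal.\<close>

definition dvr :: "'f::field set \<Rightarrow> bool" where
  "dvr V \<longleftrightarrow> principal_domain (subring_on V) \<and>
     (\<exists>!M. primeideal M (subring_on V) \<and> M \<noteq> {0})"

definition krull_domain :: "'f::field set \<Rightarrow> bool" where
  "krull_domain A \<longleftrightarrow> domain (subring_on A) \<and>
     (\<forall>P \<in> height_one_primes A. dvr (localization A P)) \<and>
     A = {z \<in> quotient_field A. \<forall>P \<in> height_one_primes A. z \<in> localization A P} \<and>
     (\<forall>a \<in> A - {0}. finite {P \<in> height_one_primes A. a \<in> P})"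

text \<open>
  For a discrete valuation ring \<open>V = A\<^sub>P\<close> with maximal ideal \<open>M = P A\<^sub>P\<close>, the valuation of a nonzero
  \<open>z\<close> in the quotient field is the unique integer \<open>k\<close> with \<open>z V = M\<^sup>k\<close>, where \<open>M\<^sup>k = \<pi>\<^sup>k V\<close> for
  a generator \<open>\<pi>\<close> of \<open>M\<close>.
\<close>

definition prime_valuation :: "'f::field set \<Rightarrow> 'f set \<Rightarrow> 'f \<Rightarrow> int" where
  "prime_valuation A P z =
     (THE k. \<exists>\<pi>. fractions P (A - P) = (*) \<pi> ` localization A P \<and>
                  (*) z ` localization A P = (*) (\<pi> powi k) ` localization A P)"

text \<open>
  The principal fractional ideal \<open>z A\<close> is identified with the divisor \<open>\<Sum>\<^sub>P v\<^sub>P(z) P\<close> in the free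
  abelian group on the height-1 primes; in a Krull domain this is a finite sum.
\<close>

definition principal_divisors :: "'f::field set \<Rightarrow> ('f set \<Rightarrow>\<^sub>0 int) set" where
  "principal_divisors A =
     {D \<in> carrier (free_Abelian_group (height_one_primes A)).
        \<exists>z \<in> quotient_field A - {0}.
          \<forall>P \<in> height_one_primes A. Poly_Mapping.lookup D P = prime_valuation A P z}"

definition class_group :: "'f::field set \<Rightarrow> ('f set \<Rightarrow>\<^sub>0 int) set monoid" where
  "class_group A = free_Abelian_group (height_one_primes A) Mod principal_divisors A"

text \<open>An element of the class group is a coset, i.e. a set of divisors.\<close>

definition prime_divisors_in_class :: "'f::field set \<Rightarrow> ('f set \<Rightarrow>\<^sub>0 int) set \<Rightarrow> 'f set set" where
  "prime_divisors_in_class A c = {P \<in> height_one_primes A. frag_of P \<in> c}"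


section \<open>Rational functions\<close>

text \<open>
  Over a domain \<open>R\<close>, given as a type \<open>'a\<close>, polynomials in variables \<open>X\<^sub>1, X\<^sub>2, \<dots>\<close> are finitely
  supported maps from exponent vectors to coefficients. The field \<open>ratfun_field N\<close> of fractions of
  polynomials in \<open>X\<^sub>1, \<dots>, X\<^sub>N\<close> is the rational function field in \<open>N\<close> variables over the quotient
  field of \<open>R\<close>.
\<close>

type_synonym 'a mpoly = "(nat \<Rightarrow>\<^sub>0 nat) \<Rightarrow>\<^sub>0 'a"

type_synonym 'a ratfun = "'a mpoly fract"

definition mpolys :: "nat \<Rightarrow> 'a::zero mpoly set" where
  "mpolys N = {p. \<forall>t \<in> Poly_Mapping.keys p. Poly_Mapping.keys t \<subseteq> {1..N}}"

definition ratfun_field :: "nat \<Rightarrow> 'a::idom ratfun set" where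
  "ratfun_field N = {Fract p q | p q. p \<in> mpolys N \<and> q \<in> mpolys N \<and> q \<noteq> 0}"

definition const :: "'a::idom \<Rightarrow> 'a ratfun" where
  "const c = Fract (Poly_Mapping.single 0 c) 1"

definition eval_mpoly :: "(nat \<Rightarrow> 'a::idom ratfun) \<Rightarrow> 'a mpoly \<Rightarrow> 'a ratfun" where
  "eval_mpoly x p = (\<Sum>t \<in> Poly_Mapping.keys p.
     const (Poly_Mapping.lookup p t) *
     (\<Prod>k \<in> Poly_Mapping.keys t. x k ^ Poly_Mapping.lookup t k))"

definition alg_independent :: "nat \<Rightarrow> (nat \<Rightarrow> 'a::idom ratfun) \<Rightarrow> bool" where
  "alg_independent N x \<longleftrightarrow> (\<forall>p \<in> mpolys N. eval_mpoly x p = 0 \<longrightarrow> p = 0)"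

definition subalgebra_gen :: "'a::idom ratfun set \<Rightarrow> 'a ratfun set" where
  "subalgebra_gen H = generate_ring ring_of_type_algebra (range const \<union> H)"


section \<open>Generalized seeds and generalized cluster algebras\<close>

text \<open>
  All indices start at 1, and the values of \<open>cluster\<close>, \<open>coeffs\<close>, \<open>exch\<close> and \<open>d\<close> outside the
  relevant index ranges carry no meaning. \<open>coeffs S i j\<close> is \<open>\<rho>\<^sub>i\<^sub>,\<^sub>j\<close> and \<open>exch S k l\<close> is \<open>b\<^sub>k\<^sub>l\<close>.
  The numbers \<open>n\<close>, \<open>m\<close> and \<open>d\<^sub>1, \<dots>, d\<^sub>n\<close> do not change under mutation and are kept as parameters.
\<close>

record (overloaded) 'a gen_seed =
  cluster :: "nat \<Rightarrow> 'a ratfun"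
  coeffs :: "nat \<Rightarrow> nat \<Rightarrow> 'a ratfun"
  exch :: "nat \<Rightarrow> nat \<Rightarrow> int"

definition pos_part :: "int \<Rightarrow> int" where
  "pos_part z = max z 0"

definition skew_symmetrizable :: "nat \<Rightarrow> (nat \<Rightarrow> nat \<Rightarrow> int) \<Rightarrow> bool" where
  "skew_symmetrizable n B \<longleftrightarrow>
     (\<exists>s :: nat \<Rightarrow> int. (\<forall>i \<in> {1..n}. 0 < s i) \<and>
       (\<forall>i \<in> {1..n}. \<forall>j \<in> {1..n}. s i * B i j = - (s j * B j i)))"

definition is_gen_seed :: "nat \<Rightarrow> nat \<Rightarrow> (nat \<Rightarrow> nat) \<Rightarrow> 'a::idom gen_seed \<Rightarrow> bool" where
  "is_gen_seed n m d S \<longleftrightarrow>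
     0 < n + m \<and>
     (\<forall>k \<in> {1..n + m}. cluster S k \<in> ratfun_field (n + m)) \<and>
     alg_independent (n + m) (cluster S) \<and>
     skew_symmetrizable n (exch S) \<and>
     (\<forall>i \<in> {1..n}. 0 < d i) \<and>
     (\<forall>i \<in> {1..n}. \<forall>j \<in> {1..n + m}. int (d i) dvd exch S j i) \<and>
     (\<forall>i \<in> {1..n}. coeffs S i 0 = 1 \<and> coeffs S i (d i) = 1 \<and>
        (\<forall>j \<in> {1..<d i}. \<exists>(c :: 'a) (e :: nat \<Rightarrow> nat).
           coeffs S i j = const c * (\<Prod>k = n + 1..n + m. cluster S k ^ e k)))"

text \<open>The division below is exact in a generalized seed.\<close>

definition exch_poly ::
    "nat \<Rightarrow> nat \<Rightarrow> (nat \<Rightarrow> nat) \<Rightarrow> 'a::idom gen_seed \<Rightarrow> nat \<Rightarrow> 'a ratfun" where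
  "exch_poly n m d S i =
     (let \<beta> = (\<lambda>k. exch S k i div int (d i)) in
      \<Sum>j = 0..d i. coeffs S i j *
        (\<Prod>k = 1..n + m. cluster S k ^
           nat (int j * pos_part (\<beta> k) + (int (d i) - int j) * pos_part (- \<beta> k))))"

definition mutate_exch :: "nat \<Rightarrow> (nat \<Rightarrow> nat \<Rightarrow> int) \<Rightarrow> nat \<Rightarrow> nat \<Rightarrow> int" where
  "mutate_exch i B k l =
     (if k = i \<or> l = i then - B k l
      else B k l + pos_part (B i l) * B k i + B i l * pos_part (- B k i))"

definition mutate ::
    "nat \<Rightarrow> nat \<Rightarrow> (nat \<Rightarrow> nat) \<Rightarrow> nat \<Rightarrow> 'a::idom gen_seed \<Rightarrow> 'a gen_seed" where
  "mutate n m d i S =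
     \<lparr>cluster = (cluster S)(i := exch_poly n m d S i / cluster S i),
      coeffs = (coeffs S)(i := (\<lambda>j. coeffs S i (d i - j))),
      exch = mutate_exch i (exch S)\<rparr>"

inductive_set mutation_class ::
    "nat \<Rightarrow> nat \<Rightarrow> (nat \<Rightarrow> nat) \<Rightarrow> 'a::idom gen_seed \<Rightarrow> 'a gen_seed set"
  for n m d S where
  refl: "S \<in> mutation_class n m d S"
| step: "T \<in> mutation_class n m d S \<Longrightarrow> i \<in> {1..n} \<Longrightarrow>
           mutate n m d i T \<in> mutation_class n m d S"

definition gen_cluster_algebra ::
    "nat \<Rightarrow> nat \<Rightarrow> (nat \<Rightarrow> nat) \<Rightarrow> 'a::idom gen_seed \<Rightarrow> 'a ratfun set" where
  "gen_cluster_algebra n m d S = subalgebra_gen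
     ({cluster S k | k. k \<in> {n + 1..n + m}} \<union>
      {inverse (cluster S k) | k. k \<in> {n + 1..n + m}} \<union>
      {cluster T i | T i. T \<in> mutation_class n m d S \<and> i \<in> {1..n}})"

text \<open>The directed graph of a seed has only the vertices \<open>1, \<dots>, n\<close>; frozen indices are excluded.\<close>

definition acyclic_seed :: "nat \<Rightarrow> 'a gen_seed \<Rightarrow> bool" where
  "acyclic_seed n S \<longleftrightarrow> acyclic {(i, j). i \<in> {1..n} \<and> j \<in> {1..n} \<and> 0 < exch S i j}"

text \<open>
  Coprimality is tested in the polynomial ring \<open>R[x\<^sub>1, \<dots>, x\<^sub>n\<^sub>+\<^sub>m]\<close>, in which the frozen variables
  are not invertible.
\<close>

definition coprime_in :: "('f, 'm) monoid_scheme \<Rightarrow> 'f \<Rightarrow> 'f \<Rightarrow> bool" where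
  "coprime_in R f g \<longleftrightarrow>
     (\<forall>h \<in> carrier R. h divides\<^bsub>R\<^esub> f \<and> h divides\<^bsub>R\<^esub> g \<longrightarrow> h \<in> Units R)"

definition coprime_seed :: "nat \<Rightarrow> nat \<Rightarrow> (nat \<Rightarrow> nat) \<Rightarrow> 'a::idom gen_seed \<Rightarrow> bool" where
  "coprime_seed n m d S \<longleftrightarrow>
     (\<forall>i \<in> {1..n}. \<forall>j \<in> {1..n}. i \<noteq> j \<longrightarrow>
        coprime_in (subring_on (subalgebra_gen (cluster S ` {1..n + m})))
          (exch_poly n m d S i) (exch_poly n m d S j))"

end

theory Submission
  imports Defs
begin

text \<open>
  The group is written as a product of cyclic groups, and each factor contributes one cluster
  variable \<open>x\<close> to an exchange matrix with zero quiver, so that the seed is trivially acyclic and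
  mutations in different directions do not interact. Its exchange polynomial is \<open>s^m\<close> for a factor
  \<open>\<int>/m\<close> and \<open>s r\<close> for a factor \<open>\<int>\<close>, where \<open>s\<close> and \<open>r\<close> are linear forms in two frozen variables;
  in both cases the extreme coefficients are 1, for \<open>s r\<close> because the linear forms are built from
  a root of \<open>\<phi> (\<phi> + 1) = 1\<close>.

  The cluster algebra \<open>\<A>\<close> consists of the elements of the factorial ring \<open>\<A>[x\<^sub>1\<^sup>-\<^sup>1, \<dots>, x\<^sub>n\<^sup>-\<^sup>1]\<close>, a
  localized polynomial ring, that are nonnegative at finitely many monomial valuations, one for each
  prime factor of an exchange polynomial. Hence \<open>\<A>\<close> is a Krull domain, and as in Nagata's theorem
  its class group is generated by the corresponding primes, the only relations being
  \<open>div x\<^sub>i = 0\<close>, i.e. \<open>m [P] = 0\<close> or \<open>[P] + [P'] = 0\<close>. A frozen variable \<open>t\<close> that occurs in no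
  exchange polynomial yields, for every class, a family of primes in it that are linear in \<open>t\<close> and
  are indexed by the nonzero scalars; there cannot be more primes because \<open>\<A>\<close> has the cardinality of
  the ground field.
\<close>

subsection \<open>Factorization in subrings of a field\<close>

text \<open>The roots are taken as \<open>\<alpha>\<close> and \<open>\<alpha> + 1\<close> because a
  difference of 1 gives a coordinate change of determinant -1, invertible without division; for two
  simple roots the end coefficients 1 then force \<open>\<alpha> * (\<alpha> + 1) = 1\<close>.

  A free factor cannot come from a power of one prime: if \<open>x\<close> has divisor
  \<open>e P\<close>, the class of \<open>P\<close> is torsion. Two primes with
  \<open>div x = P + P'\<close> leave \<open>P\<close> free and make \<open>P'\<close> its inverse.

  In these coordinates each prime lost by inverting the cluster variables has a place defined by
  weights: 1 on the linear form, and on \<open>x\<close> the exponent of that form. Then the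
  exchange polynomial and \<open>x\<close> have equal value, and integrality can be read off from
  single monomials.

  Since quotient fields and localizations are subsets of one field type, divisibility of
  \<open>a\<close> by \<open>p\<close> is expressed as \<open>a / p \<in> P\<close>, and Gauss's
  lemma is proved for subrings in this form.\<close>

definition is_subring :: "'f::field set \<Rightarrow> bool" where
  "is_subring P \<longleftrightarrow> 1 \<in> P \<and> (\<forall>x\<in>P. \<forall>y\<in>P. x - y \<in> P \<and> x * y \<in> P)"

lemma is_subring_closed:
  assumes "is_subring P"
  shows "1 \<in> P" "0 \<in> P" "x \<in> P \<Longrightarrow> y \<in> P \<Longrightarrow> x - y \<in> P" "x \<in> P \<Longrightarrow> y \<in> P \<Longrightarrow> x * y \<in> P"
    "x \<in> P \<Longrightarrow> - x \<in> P" "x \<in> P \<Longrightarrow> y \<in> P \<Longrightarrow> x + y \<in> P" "x \<in> P \<Longrightarrow> x ^ n \<in> P"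
proof -
  note a = assms[unfolded is_subring_def]
  show 1: "1 \<in> P" and d: "\<And>x y. x \<in> P \<Longrightarrow> y \<in> P \<Longrightarrow> x - y \<in> P"
    and m: "\<And>x y. x \<in> P \<Longrightarrow> y \<in> P \<Longrightarrow> x * y \<in> P" using a by auto
  show z: "0 \<in> P" using d[OF 1 1] by simp
  show u: "\<And>x. x \<in> P \<Longrightarrow> - x \<in> P" using d[OF z] by simp
  show "x \<in> P \<Longrightarrow> y \<in> P \<Longrightarrow> x + y \<in> P" using d[of x "-y"] u[of y] by simp
  show "x \<in> P \<Longrightarrow> x ^ n \<in> P" by (induction n) (auto intro: 1 m)
qed

lemma is_subring_sum: "is_subring P \<Longrightarrow> (\<And>i. i \<in> I \<Longrightarrow> f i \<in> P) \<Longrightarrow> sum f I \<in> P"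
  by (induction I rule: infinite_finite_induct) (auto intro: is_subring_closed)

lemma is_subring_prod: "is_subring P \<Longrightarrow> (\<And>i. i \<in> I \<Longrightarrow> f i \<in> P) \<Longrightarrow> prod f I \<in> P"
  by (induction I rule: infinite_finite_induct) (auto intro: is_subring_closed)

lemma is_subring_prod_list: "is_subring P \<Longrightarrow> set ps \<subseteq> P \<Longrightarrow> prod_list ps \<in> P"
  by (induction ps) (auto intro: is_subring_closed)

definition unit_on :: "'f::field set \<Rightarrow> 'f \<Rightarrow> bool" where
  "unit_on P u \<longleftrightarrow> u \<in> P \<and> inverse u \<in> P \<and> u \<noteq> 0"

text \<open>Inside a field, \<open>p\<close> divides \<open>a\<close> in the subring \<open>P\<close> iff \<open>a / p \<in> P\<close>.\<close>

definition prime_on :: "'f::field set \<Rightarrow> 'f \<Rightarrow> bool" where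
  "prime_on P p \<longleftrightarrow> p \<in> P \<and> p \<noteq> 0 \<and> inverse p \<notin> P \<and>
     (\<forall>a\<in>P. \<forall>b\<in>P. a * b / p \<in> P \<longrightarrow> a / p \<in> P \<or> b / p \<in> P)"

definition irreducible_on :: "'f::field set \<Rightarrow> 'f \<Rightarrow> bool" where
  "irreducible_on P h \<longleftrightarrow> h \<in> P \<and> h \<noteq> 0 \<and> inverse h \<notin> P \<and>
     (\<forall>a\<in>P. \<forall>b\<in>P. h = a * b \<longrightarrow> inverse a \<in> P \<or> inverse b \<in> P)"

definition has_factorization :: "'f::field set \<Rightarrow> 'f \<Rightarrow> bool" where
  "has_factorization P a \<longleftrightarrow> (\<exists>u ps. unit_on P u \<and> (\<forall>p\<in>set ps. prime_on P p) \<and> a = u * prod_list ps)"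

text \<open>Factorizations into primes, not merely irreducibles, are unique up to units, so
  existence alone characterizes unique factorization domains.\<close>

definition factorial_on :: "'f::field set \<Rightarrow> bool" where
  "factorial_on P \<longleftrightarrow> is_subring P \<and> (\<forall>a\<in>P. a \<noteq> 0 \<longrightarrow> has_factorization P a)"

lemma prime_onD:
  assumes "prime_on P p"
  shows "p \<in> P" "p \<noteq> 0" "inverse p \<notin> P"
    "a \<in> P \<Longrightarrow> b \<in> P \<Longrightarrow> a * b / p \<in> P \<Longrightarrow> a / p \<in> P \<or> b / p \<in> P"
  using assms by (auto simp: prime_on_def)

lemma unit_onD:
  assumes "unit_on P p"
  shows "p \<in> P" "p \<noteq> 0" "inverse p \<in> P"
  using assms by (auto simp: unit_on_def)

lemma factorial_onD: "factorial_on P \<Longrightarrow> is_subring P"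
  "factorial_on P \<Longrightarrow> a \<in> P \<Longrightarrow> a \<noteq> 0 \<Longrightarrow> has_factorization P a"
  by (auto simp: factorial_on_def)

lemma unit_on_mult:
  assumes "is_subring P" "unit_on P u" "unit_on P v"
  shows "unit_on P (u * v)"
  using assms by (auto simp: unit_on_def intro: is_subring_closed)

lemma unit_on_inverse: "unit_on P u \<Longrightarrow> unit_on P (inverse u)"
  by (auto simp: unit_on_def)

lemma unit_on_1: "is_subring P \<Longrightarrow> unit_on P 1"
  by (auto simp: unit_on_def is_subring_closed)

lemma prime_not_dvd_unit:
  assumes "is_subring P" "prime_on P p" "unit_on P u"
  shows "u / p \<notin> P"
proof
  assume "u / p \<in> P"
  then have "inverse u * (u / p) \<in> P" using is_subring_closed(4)[OF assms(1) unit_onD(3)[OF assms(3)]] by blast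
  also have "inverse u * (u / p) = inverse p" using assms by (auto simp: unit_on_def field_simps)
  finally show False using prime_onD(3)[OF assms(2)] by simp
qed

lemma prime_on_dvd_prod_list:
  assumes P: "is_subring P" and q: "prime_on P q" and "set ps \<subseteq> P" "prod_list ps / q \<in> P"
  shows "\<exists>p\<in>set ps. p / q \<in> P"
  using assms(3,4)
proof (induction ps)
  case Nil
  then show ?case using prime_onD[OF q] by (simp add: inverse_eq_divide)
next
  case (Cons p ps)
  have "p / q \<in> P \<or> prod_list ps / q \<in> P"
    by (rule prime_onD(4)[OF q]) (use Cons.prems P in \<open>auto intro: is_subring_prod_list\<close>)
  then show ?case using Cons by auto
qed

lemma prime_on_dvd_power:
  assumes P: "is_subring P" and q: "prime_on P q" and "a \<in> P" "a ^ n / q \<in> P"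
  shows "a / q \<in> P"
  using assms(4)
proof (induction n)
  case 0
  then show ?case using prime_onD[OF q] by (simp add: inverse_eq_divide)
next
  case (Suc n)
  have "a / q \<in> P \<or> a ^ n / q \<in> P"
    by (rule prime_onD(4)[OF q]) (use Suc.prems assms in \<open>auto intro: is_subring_closed\<close>)
  then show ?case using Suc by auto
qed

lemma prime_on_dvd_prod:
  assumes P: "is_subring P" and q: "prime_on P q" and "finite I" "\<And>i. i \<in> I \<Longrightarrow> f i \<in> P" "prod f I / q \<in> P"
  shows "\<exists>i\<in>I. f i / q \<in> P"
  using assms(3-)
proof (induction I)
  case empty
  then show ?case using prime_onD[OF q] by (simp add: inverse_eq_divide)
next
  case (insert i I)
  have "f i / q \<in> P \<or> prod f I / q \<in> P"
    by (rule prime_onD(4)[OF q]) (use insert P in \<open>auto intro: is_subring_prod\<close>)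
  then show ?case using insert by auto
qed

text \<open>\<open>p\<close> divides the product of \<open>q\<close> and \<open>p / q\<close>; it
  cannot divide \<open>p / q\<close>, since then \<open>1 / q\<close> would lie in
  \<open>P\<close>.\<close>

lemma prime_dvd_prime:
  assumes P: "is_subring P" and p: "prime_on P p" and q: "prime_on P q" and "p / q \<in> P"
  shows "unit_on P (p / q)"
proof -
  note pD = prime_onD[OF p] and qD = prime_onD[OF q]
  have "q / p \<in> P \<or> (p / q) / p \<in> P"
    by (rule pD(4)) (use assms pD qD in \<open>auto intro: is_subring_closed\<close>)
  then show ?thesis using assms pD qD by (auto simp: unit_on_def field_simps)
qed

text \<open>Serves as induction on the number of prime factors without mentioning a list of
  them.\<close>

lemma factorial_induct [consumes 3, case_names unit prime]:
  assumes "factorial_on P" "a \<in> P" "a \<noteq> 0"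
    and u: "\<And>u. unit_on P u \<Longrightarrow> Q u"
    and p: "\<And>p a. prime_on P p \<Longrightarrow> a \<in> P \<Longrightarrow> a \<noteq> 0 \<Longrightarrow> Q a \<Longrightarrow> Q (p * a)"
  shows "Q a"
proof -
  have P: "is_subring P" using assms factorial_onD by auto
  obtain u ps where *: "unit_on P u" "\<forall>p\<in>set ps. prime_on P p" "a = u * prod_list ps"
    using factorial_onD(2)[OF assms(1-3)] by (auto simp: has_factorization_def)
  have "Q (u * prod_list ps) \<and> u * prod_list ps \<in> P \<and> u * prod_list ps \<noteq> 0" using *(2)
  proof (induction ps)
    case Nil
    then show ?case using u[OF *(1)] *(1) by (simp add: unit_on_def)
  next
    case (Cons q ps)
    then have q: "prime_on P q" and IH: "Q (u * prod_list ps)" "u * prod_list ps \<in> P" "u * prod_list ps \<noteq> 0"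
      by auto
    have "Q (q * (u * prod_list ps))" by (rule p[OF q IH(2,3,1)])
    moreover have "q * (u * prod_list ps) \<in> P" using P IH prime_onD[OF q] by (auto intro: is_subring_closed)
    moreover have "q * (u * prod_list ps) \<noteq> 0" using IH prime_onD[OF q] by auto
    ultimately show ?case by (simp add: mult_ac)
  qed
  then show ?thesis using *(3) by simp
qed

lemma has_factorization_mult:
  assumes "is_subring P" "has_factorization P a" "has_factorization P b"
  shows "has_factorization P (a * b)"
proof -
  obtain u ps where 1: "unit_on P u" "\<forall>p\<in>set ps. prime_on P p" "a = u * prod_list ps"
    using assms(2) by (auto simp: has_factorization_def)
  obtain v qs where 2: "unit_on P v" "\<forall>p\<in>set qs. prime_on P p" "b = v * prod_list qs"
    using assms(3) by (auto simp: has_factorization_def)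
  show ?thesis unfolding has_factorization_def
    by (rule exI[of _ "u * v"], rule exI[of _ "ps @ qs"])
       (use 1 2 assms(1) in \<open>auto intro: unit_on_mult simp: mult_ac\<close>)
qed

lemma nonunit_prime_divisor:
  assumes "factorial_on P" "a \<in> P" "a \<noteq> 0" "inverse a \<notin> P"
  shows "\<exists>p. prime_on P p \<and> a / p \<in> P"
  using assms(1-3) assms(4)
proof (induction rule: factorial_induct)
  case (unit u)
  then show ?case by (auto simp: unit_on_def)
next
  case (prime p a)
  then show ?case using prime_onD[OF prime(1)] by (auto intro!: exI[of _ p])
qed

text \<open>The number of prime factors drops by one, which is the measure for the induction in
  \<open>adjoin_factorization\<close>. The unit between the listed prime \<open>p\<close> and the
  given \<open>q\<close> is absorbed into \<open>u\<close>.\<close>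

lemma factorization_div_prime:
  assumes P: "is_subring P" and q: "prime_on P q" and u: "unit_on P u"
    and "\<forall>p\<in>set ps. prime_on P p" and "u * prod_list ps / q \<in> P"
  shows "\<exists>v rs. unit_on P v \<and> (\<forall>p\<in>set rs. prime_on P p) \<and> length ps = Suc (length rs) \<and>
     u * prod_list ps / q = v * prod_list rs"
proof -
  have pP: "prod_list ps \<in> P" using assms(4) prime_onD(1) by (intro is_subring_prod_list[OF P]) auto
  have "u / q \<in> P \<or> prod_list ps / q \<in> P"
    by (rule prime_onD(4)[OF q]) (use assms unit_onD[OF u] pP in auto)
  then have "prod_list ps / q \<in> P" using prime_not_dvd_unit[OF P q u] by auto
  then obtain p where p: "p \<in> set ps" "p / q \<in> P"
    using prime_on_dvd_prod_list[OF P q, of ps] assms(4) prime_onD(1) by auto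
  then have un: "unit_on P (p / q)" using prime_dvd_prime[OF P _ q] assms(4) by auto
  have un': "unit_on P (u * (p / q))" by (rule unit_on_mult[OF P u un])
  obtain as bs where ps: "ps = as @ p # bs" using p(1) by (auto simp: in_set_conv_decomp)
  show ?thesis
    by (rule exI[of _ "u * (p / q)"], rule exI[of _ "as @ bs"])
       (use un' ps assms(4) in auto)
qed

subsection \<open>Gauss's lemma\<close>

definition polys_on :: "'f::field set \<Rightarrow> 'f poly set" where
  "polys_on P = {f. \<forall>i. coeff f i \<in> P}"

text \<open>The ring \<open>P[z]\<close> as a subset of the same field. For \<open>z\<close>
  transcendental over \<open>P\<close> it is a copy of the polynomial ring, so a tower of polynomial
  rings needs no tower of types.\<close>

definition adjoin :: "'f::field set \<Rightarrow> 'f \<Rightarrow> 'f set" where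
  "adjoin P z = (\<lambda>f. poly f z) ` polys_on P"

definition transcendental_on :: "'f::field set \<Rightarrow> 'f \<Rightarrow> bool" where
  "transcendental_on P z \<longleftrightarrow> (\<forall>f\<in>polys_on P. poly f z = 0 \<longrightarrow> f = 0)"

lemma polys_on_coeff: "f \<in> polys_on P \<Longrightarrow> coeff f i \<in> P"
  by (auto simp: polys_on_def)

lemma polys_on_closed:
  assumes "is_subring P"
  shows "0 \<in> polys_on P" "1 \<in> polys_on P" "f \<in> polys_on P \<Longrightarrow> g \<in> polys_on P \<Longrightarrow> f + g \<in> polys_on P"
    "f \<in> polys_on P \<Longrightarrow> g \<in> polys_on P \<Longrightarrow> f - g \<in> polys_on P"
    "f \<in> polys_on P \<Longrightarrow> g \<in> polys_on P \<Longrightarrow> f * g \<in> polys_on P"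
    "c \<in> P \<Longrightarrow> f \<in> polys_on P \<Longrightarrow> smult c f \<in> polys_on P"
    "c \<in> P \<Longrightarrow> monom c n \<in> polys_on P"
    "c \<in> P \<Longrightarrow> f \<in> polys_on P \<Longrightarrow> pCons c f \<in> polys_on P"
  using assms
  by (auto simp: polys_on_def coeff_mult coeff_1 coeff_pCons intro!: is_subring_closed is_subring_sum split: nat.split)

lemma adjoin_subring: "is_subring P \<Longrightarrow> is_subring (adjoin P z)"
  unfolding is_subring_def[of "adjoin P z"]
proof safe
  assume P: "is_subring P"
  show "1 \<in> adjoin P z" unfolding adjoin_def using polys_on_closed(2)[OF P] by (rule rev_image_eqI) simp
  fix x y assume "x \<in> adjoin P z" "y \<in> adjoin P z"
  then obtain f g where *: "f \<in> polys_on P" "g \<in> polys_on P" "x = poly f z" "y = poly g z" by (auto simp: adjoin_def)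
  show "x - y \<in> adjoin P z" unfolding adjoin_def using polys_on_closed(4)[OF P *(1,2)] by (rule rev_image_eqI) (simp add: *)
  show "x * y \<in> adjoin P z" unfolding adjoin_def using polys_on_closed(5)[OF P *(1,2)] by (rule rev_image_eqI) (simp add: *)
qed

lemma adjoinI: "f \<in> polys_on P \<Longrightarrow> poly f z \<in> adjoin P z"
  by (auto simp: adjoin_def)

lemma subset_adjoin: assumes "is_subring P" shows "P \<subseteq> adjoin P z"
proof
  fix c assume "c \<in> P"
  then have "poly [:c:] z \<in> adjoin P z" using assms by (intro adjoinI polys_on_closed)
  then show "c \<in> adjoin P z" by simp
qed

lemma adjoin_self: assumes "is_subring P" shows "z \<in> adjoin P z"
proof -
  have "poly [:0, 1:] z \<in> adjoin P z" using assms by (intro adjoinI polys_on_closed is_subring_closed)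
  then show ?thesis by simp
qed

context
  fixes P :: "'f::field set" and z :: 'f and Q
  assumes fac: "factorial_on P" and tr: "transcendental_on P z"
  defines "Q \<equiv> adjoin P z"
begin

lemma P: "is_subring P" using fac factorial_onD by auto

lemma Q: "is_subring Q" unfolding Q_def by (rule adjoin_subring[OF P])

lemma PQ: "P \<subseteq> Q" unfolding Q_def by (rule subset_adjoin[OF P])

lemma poly_eqD: "f \<in> polys_on P \<Longrightarrow> g \<in> polys_on P \<Longrightarrow> poly f z = poly g z \<Longrightarrow> f = g"
proof -
  assume *: "f \<in> polys_on P" "g \<in> polys_on P" "poly f z = poly g z"
  then have "f - g \<in> polys_on P" "poly (f - g) z = 0" using P by (auto intro: polys_on_closed)
  then have "f - g = 0" using tr unfolding transcendental_on_def by blast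
  then show "f = g" by simp
qed

lemma QE: assumes "x \<in> Q" obtains f where "f \<in> polys_on P" "x = poly f z"
  using assms by (auto simp: Q_def adjoin_def)

text \<open>By transcendence the polynomial representing \<open>poly f z / c\<close> is unique, so
  divisibility by a constant can be tested on coefficients.\<close>

lemma const_div_adjoin:
  assumes "c \<in> P" "c \<noteq> 0" "f \<in> polys_on P" "poly f z / c \<in> Q"
  shows "coeff f i / c \<in> P"
proof -
  obtain k where k: "k \<in> polys_on P" "poly f z / c = poly k z" using QE[OF assms(4)] by metis
  have "f = smult c k" by (rule poly_eqD) (use assms k P in \<open>auto intro: polys_on_closed simp: field_simps\<close>)
  then show ?thesis using k assms by (simp add: polys_on_coeff)
qed

lemma div_const_adjoin:
  assumes "c \<in> P" "c \<noteq> 0" "f \<in> polys_on P" "\<And>i. coeff f i / c \<in> P"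
  shows "poly f z / c \<in> Q"
proof -
  have "smult (inverse c) f \<in> polys_on P" using assms by (auto simp: polys_on_def field_simps)
  then have "poly (smult (inverse c) f) z \<in> Q" unfolding Q_def by (rule adjoinI)
  then show ?thesis by (simp add: field_simps)
qed

lemma unit_adjoin:
  assumes "f \<in> polys_on P" "unit_on Q (poly f z)"
  shows "degree f = 0" "unit_on P (coeff f 0)"
proof -
  obtain g where g: "g \<in> polys_on P" "inverse (poly f z) = poly g z"
    using QE[OF unit_onD(3)[OF assms(2)]] by metis
  have fg: "f * g = 1" by (rule poly_eqD) (use assms g P unit_onD[OF assms(2)] in \<open>auto intro: polys_on_closed simp flip: g(2)\<close>)
  then show d: "degree f = 0"
    by (metis add_is_0 degree_1 degree_mult_eq mult_zero_left mult_zero_right zero_neq_one)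
  have dg: "degree g = 0" using fg by (metis add_is_0 degree_1 degree_mult_eq mult_zero_left mult_zero_right zero_neq_one)
  have "coeff f 0 * coeff g 0 = 1" using arg_cong[OF fg, of "\<lambda>p. coeff p 0"] by (simp add: coeff_mult)
  then show "unit_on P (coeff f 0)" using assms(1) g(1) polys_on_coeff
    unfolding unit_on_def by (metis inverse_unique mult_zero_left zero_neq_one)
qed

lemma unit_on_PQ: "unit_on P u \<Longrightarrow> unit_on Q u"
  using PQ by (auto simp: unit_on_def)

text \<open>If \<open>p\<close> divides neither factor, pick in each the lowest coefficient not
  divisible by \<open>p\<close>; in the coefficient of degree \<open>i + j\<close> of the product
  every term but \<open>coeff f i * coeff g j\<close> is divisible by \<open>p\<close>.\<close>

lemma prime_on_adjoin:
  assumes p: "prime_on P p" shows "prime_on Q p"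
  unfolding prime_on_def
proof (intro conjI ballI impI)
  note pD = prime_onD[OF p]
  show "p \<in> Q" using pD PQ by auto
  show "p \<noteq> 0" by fact
  show "inverse p \<notin> Q"
  proof
    assume "inverse p \<in> Q"
    then have "poly 1 z / p \<in> Q" by (simp add: inverse_eq_divide)
    from const_div_adjoin[OF pD(1,2) polys_on_closed(2)[OF P] this, of 0] pD(3) show False
      by (simp add: inverse_eq_divide)
  qed
  fix a b assume ab: "a \<in> Q" "b \<in> Q" "a * b / p \<in> Q"
  obtain f where f: "f \<in> polys_on P" "a = poly f z" using QE[OF ab(1)] by metis
  obtain g where g: "g \<in> polys_on P" "b = poly g z" using QE[OF ab(2)] by metis
  show "a / p \<in> Q \<or> b / p \<in> Q"
  proof (rule ccontr)
    assume n: "\<not> ?thesis"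
    have "\<exists>i. coeff f i / p \<notin> P" "\<exists>i. coeff g i / p \<notin> P"
      using n div_const_adjoin[OF pD(1,2)] f g by blast+
    define i where "i = (LEAST i. coeff f i / p \<notin> P)"
    define j where "j = (LEAST j. coeff g j / p \<notin> P)"
    have i: "coeff f i / p \<notin> P" "\<And>k. k < i \<Longrightarrow> coeff f k / p \<in> P"
      unfolding i_def using LeastI_ex[OF \<open>\<exists>i. coeff f i / p \<notin> P\<close>] by (auto dest: not_less_Least)
    have j: "coeff g j / p \<notin> P" "\<And>k. k < j \<Longrightarrow> coeff g k / p \<in> P"
      unfolding j_def using LeastI_ex[OF \<open>\<exists>i. coeff g i / p \<notin> P\<close>] by (auto dest: not_less_Least)
    have "poly (f * g) z / p \<in> Q" using ab f g by simp
    then have "coeff (f * g) (i + j) / p \<in> P"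
      using const_div_adjoin[OF pD(1,2) polys_on_closed(5)[OF P f(1) g(1)]] by auto
    moreover have "coeff (f * g) (i + j) = coeff f i * coeff g j + (\<Sum>k\<in>{..i+j}-{i}. coeff f k * coeff g (i + j - k))"
      unfolding coeff_mult by (subst sum.remove[of _ i]) auto
    moreover have "(\<Sum>k\<in>{..i+j}-{i}. coeff f k * coeff g (i + j - k)) / p \<in> P"
      unfolding sum_divide_distrib
    proof (rule is_subring_sum[OF P])
      fix k assume k: "k \<in> {..i+j}-{i}"
      show "coeff f k * coeff g (i + j - k) / p \<in> P"
      proof (cases "k < i")
        case True
        then have "coeff f k / p * coeff g (i + j - k) \<in> P" using is_subring_closed(4)[OF P i(2)[OF True] polys_on_coeff[OF g(1)]] by blast
        then show ?thesis by simp
      next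
        case False
        then have "coeff f k * (coeff g (i + j - k) / p) \<in> P" using is_subring_closed(4)[OF P polys_on_coeff[OF f(1)] j(2)[of "i + j - k"]] k by auto
        then show ?thesis by simp
      qed
    qed
    ultimately have "coeff f i * coeff g j / p \<in> P"
      using is_subring_closed(3)[OF P] by (fastforce simp: add_divide_distrib)
    then show False using pD(4)[of "coeff f i" "coeff g j"] i j f g polys_on_coeff by blast
  qed
qed

text \<open>Each prime factor of the constant divides the product of \<open>h\<close> and the
  quotient; being no divisor of the primitive \<open>h\<close>, it divides the quotient and can be
  cancelled.\<close>

lemma primitive_cancel:
  assumes "c \<in> P" "c \<noteq> 0" "h \<in> Q" "h \<noteq> 0" "F \<in> Q" and prim: "\<And>p. prime_on P p \<Longrightarrow> h / p \<notin> Q"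
    and "c * F / h \<in> Q"
  shows "F / h \<in> Q"
  using fac assms(1,2) assms(7)
proof (induction rule: factorial_induct)
  case (unit u)
  then have "inverse u * (u * F / h) \<in> Q" using is_subring_closed(4)[OF Q unit_onD(3)[OF unit_on_PQ]] by blast
  moreover have "inverse u * (u * F / h) = F / h" using unit by (simp add: unit_on_def field_simps)
  ultimately show ?case by metis
next
  case (prime p c)
  note pD = prime_onD[OF prime(1)]
  have "h / p \<in> Q \<or> (p * c * F / h) / p \<in> Q"
    by (rule prime_onD(4)[OF prime_on_adjoin[OF prime(1)]])
       (use assms prime pD PQ Q in \<open>auto intro!: is_subring_closed\<close>)
  then have "c * F / h \<in> Q" using prim prime pD by auto
  then show ?case using prime by simp
qed

text \<open>The primes of \<open>c\<close> are distributed over \<open>G\<close> and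
  \<open>q\<close>. This turns a factorization of \<open>h\<close> over the quotient field of
  \<open>P\<close> into one over \<open>P\<close>, changing \<open>G\<close> only by the constant
  \<open>d\<close>.\<close>

lemma split_off_const:
  assumes "c \<in> P" "c \<noteq> 0" "h \<in> Q" "h \<noteq> 0" "G \<in> Q" "q \<in> Q" "c * h = G * q"
  shows "\<exists>G1\<in>Q. \<exists>q1\<in>Q. \<exists>d\<in>P. d \<noteq> 0 \<and> h = G1 * q1 \<and> G = d * G1"
  using fac assms(1,2) assms(5-)
proof (induction arbitrary: G q rule: factorial_induct)
  case (unit u)
  have "h = G * (inverse u * q)" using unit unit_onD(2)[OF unit(1)] by (simp add: field_simps)
  moreover have "inverse u * q \<in> Q"
    using is_subring_closed(4)[OF Q unit_onD(3)[OF unit_on_PQ[OF unit(1)]]] unit by blast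
  moreover have "1 \<in> P" "(1 :: 'f) \<noteq> 0" "G = 1 * G" using is_subring_closed(1)[OF P] by auto
  ultimately show ?case using unit(2) by blast
next
  case (prime p c)
  note pD = prime_onD[OF prime(1)]
  have Gq: "c * h = G * q / p" using prime pD by (simp add: field_simps)
  moreover have "c * h \<in> Q" using PQ prime(2) assms(3) is_subring_closed(4)[OF Q] by blast
  ultimately have "G * q / p \<in> Q" by simp
  then have "G / p \<in> Q \<or> q / p \<in> Q" using prime_onD(4)[OF prime_on_adjoin[OF prime(1)]] prime by blast
  then show ?case
  proof
    assume "G / p \<in> Q"
    then obtain G1 q1 d where "G1 \<in> Q" "q1 \<in> Q" "d \<in> P" "d \<noteq> 0" "h = G1 * q1" "G / p = d * G1"
      using prime.IH[of "G / p" q] prime.prems(2) pD(2) Gq by auto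
    moreover from this have "p * d \<in> P" "p * d \<noteq> 0" "G = p * d * G1"
      using pD is_subring_closed(4)[OF P] by (auto simp: field_simps)
    ultimately show ?thesis by blast
  next
    assume "q / p \<in> Q"
    then show ?thesis
      using prime.IH[of G "q / p"] prime.prems(1) Gq by auto
  qed
qed

text \<open>Multiplying by the leading coefficient of \<open>g\<close> before each cancellation
  avoids fractions; this takes the place of Euclidean division over the quotient field of
  \<open>P\<close>.\<close>

lemma pseudo_division:
  assumes g: "g \<in> polys_on P" "g \<noteq> 0" and f: "f \<in> polys_on P"
  shows "\<exists>c\<in>P. \<exists>q\<in>polys_on P. \<exists>r\<in>polys_on P. c \<noteq> 0 \<and> smult c f = g * q + r \<and> (r = 0 \<or> degree r < degree g)"
  using f
proof (induction "degree f" arbitrary: f rule: less_induct)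
  case less
  note cl = polys_on_closed[OF P] is_subring_closed[OF P] polys_on_coeff
  show ?case
  proof (cases "f = 0 \<or> degree f < degree g")
    case True
    then show ?thesis using less.prems cl
      by (intro bexI[of _ 1] bexI[of _ 0] bexI[of _ f]) auto
  next
    case False
    define n where "n = degree f - degree g"
    define f' where "f' = smult (lead_coeff g) f - monom (lead_coeff f) n * g"
    have f': "f' \<in> polys_on P" unfolding f'_def using g less.prems by (intro cl)
    \<comment> \<open>The alternative \<open>f' = 0\<close> is needed because a constant dividend
      has degree \<open>0\<close>, which cannot drop.\<close>
    have deg: "f' = 0 \<or> degree f' < degree f"
    proof (cases "degree f = 0")
      case True
      then have "degree g = 0" using False by auto
      with True have "f' = 0" unfolding f'_def n_def
        by (auto elim!: degree_eq_zeroE simp: monom_0)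
      then show ?thesis ..
    next
      case nz: False
      have 1: "degree (smult (lead_coeff g) f) \<le> degree f" by (rule degree_smult_le)
      have 2: "degree (monom (lead_coeff f) n * g) \<le> degree f"
        using degree_mult_le[of "monom (lead_coeff f) n" g] degree_monom_le[of "lead_coeff f" n] False
        unfolding n_def by auto
      have 3: "coeff f' (degree f) = 0"
        unfolding f'_def using False by (simp add: n_def coeff_monom_mult)
      have "degree f' \<le> degree f" unfolding f'_def using 1 2 by (rule degree_diff_le)
      then show ?thesis using 3 nz by (metis eq_zero_or_degree_less le_neq_implies_less leading_coeff_0_iff)
    qed
    then obtain c q r where IH: "c \<in> P" "q \<in> polys_on P" "r \<in> polys_on P" "c \<noteq> 0" "smult c f' = g * q + r" "r = 0 \<or> degree r < degree g"
    proof
      assume "f' = 0"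
      then show ?thesis using that[of 1 0 0] cl by auto
    next
      assume "degree f' < degree f"
      then show ?thesis using less.hyps[OF _ f'] that by blast
    qed
    have "smult (c * lead_coeff g) f = g * (q + smult c (monom (lead_coeff f) n)) + r"
      using IH(5) unfolding f'_def by (simp add: smult_diff_right algebra_simps)
    moreover have "c * lead_coeff g \<in> P" "c * lead_coeff g \<noteq> 0"
      using IH(1,4) g is_subring_closed(4)[OF P] polys_on_coeff[OF g(1)] by auto
    moreover have "q + smult c (monom (lead_coeff f) n) \<in> polys_on P"
      using polys_on_closed(3,6,7)[OF P] IH(1,2) polys_on_coeff[OF less.prems] by blast
    ultimately show ?thesis using IH(3,6) by blast
  qed
qed

text \<open>This is the proof that irreducible elements of a principal ideal domain are prime, meant
  for polynomials over the quotient field of \<open>P\<close> but carried out in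
  \<open>P[z]\<close>: an element \<open>g\<close> of least degree in the ideal generated by
  \<open>h\<close> and \<open>a\<close> plays the gcd, pseudo-division replaces division, and
  constants are cancelled at the end because \<open>h\<close> is primitive.\<close>

lemma irreducible_pos_degree_prime:
  assumes h: "hp \<in> polys_on P" "degree hp > 0" and irr: "irreducible_on Q (poly hp z)"
  shows "prime_on Q (poly hp z)"
proof -
  define h where "h = poly hp z"
  have hQ: "h \<in> Q" "h \<noteq> 0" "inverse h \<notin> Q" and hirr: "\<And>a b. a \<in> Q \<Longrightarrow> b \<in> Q \<Longrightarrow> h = a * b \<Longrightarrow> inverse a \<in> Q \<or> inverse b \<in> Q"
    using irr by (auto simp: irreducible_on_def h_def)
  \<comment> \<open>A prime constant dividing the irreducible \<open>h\<close> would be associated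
    to it, contrary to the positive degree.\<close>
  have prim: "h / p \<notin> Q" if "prime_on P p" for p
  proof
    assume "h / p \<in> Q"
    note pD = prime_onD[OF prime_on_adjoin[OF that]]
    have "unit_on Q (h / p)" using hirr[OF pD(1) \<open>h / p \<in> Q\<close>] pD hQ \<open>h / p \<in> Q\<close> by (auto simp: unit_on_def)
    moreover obtain k where k: "k \<in> polys_on P" "h / p = poly k z" using QE[OF \<open>h / p \<in> Q\<close>] by metis
    ultimately have "degree k = 0" using unit_adjoin by auto
    moreover have "hp = smult p k"
      by (rule poly_eqD) (use h k pD prime_onD[OF that] P in \<open>auto simp: h_def field_simps intro: polys_on_closed\<close>)
    ultimately show False using h by (auto split: if_splits)
  qed
  have "b / h \<in> Q \<or> a / h \<in> Q" if a: "a \<in> Q" and b: "b \<in> Q" and ab: "a * b / h \<in> Q" for a b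
  proof (rule disjCI)
    assume nah: "a / h \<notin> Q"
    then have a0: "a \<noteq> 0" using is_subring_closed(2)[OF Q] by auto
    define I where "I = {f \<in> polys_on P. f \<noteq> 0 \<and> (\<exists>u\<in>Q. \<exists>v\<in>Q. poly f z = u * h + v * a)}"
    obtain ap where ap: "ap \<in> polys_on P" "a = poly ap z" using QE[OF a] by metis
    note Qc = is_subring_closed[OF Q]
    have "hp \<noteq> 0" "poly hp z = 1 * h + 0 * a" using h by (auto simp: h_def)
    then have hpI: "hp \<in> I" unfolding I_def using h(1) Qc(1,2) by blast
    obtain g where g: "g \<in> I" "\<And>f. f \<in> I \<Longrightarrow> degree g \<le> degree f"
      using hpI exists_least_iff[of "\<lambda>n. \<exists>g\<in>I. degree g = n"] by (metis linorder_not_less)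
    have gP: "g \<in> polys_on P" "g \<noteq> 0" using g by (auto simp: I_def)
    obtain u v where uv: "u \<in> Q" "v \<in> Q" "poly g z = u * h + v * a" using g by (auto simp: I_def)
    define G where "G = poly g z"
    have GQ: "G \<in> Q" "G \<noteq> 0" using gP poly_eqD[OF gP(1) polys_on_closed(1)[OF P]] by (auto simp: G_def Q_def intro: adjoinI)
    \<comment> \<open>The remainder lies in the ideal again, so it vanishes by minimality of
      \<open>degree g\<close>: up to constants, \<open>G\<close> divides every element of the
      ideal.\<close>
    have div: "\<exists>c\<in>P. \<exists>q\<in>Q. c \<noteq> 0 \<and> c * poly f z = G * q" if ff: "f \<in> polys_on P" "u' \<in> Q" "v' \<in> Q" "poly f z = u' * h + v' * a" for f u' v'
    proof -
      obtain c q r where c: "c \<in> P" "q \<in> polys_on P" "r \<in> polys_on P" "c \<noteq> 0" "smult c f = g * q + r" "r = 0 \<or> degree r < degree g"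
        using pseudo_division[OF gP ff(1)] by metis
      have e: "c * poly f z = G * poly q z + poly r z" using arg_cong[OF c(5), of "\<lambda>p. poly p z"] by (simp add: G_def)
      have qQ: "poly q z \<in> Q" "c \<in> Q" using c PQ by (auto simp: Q_def intro: adjoinI)
      have "r = 0"
      proof (rule ccontr)
        assume "r \<noteq> 0"
        have "poly r z = (c * u' - poly q z * u) * h + (c * v' - poly q z * v) * a"
          using e ff(4) uv(3) by (simp add: G_def algebra_simps)
        moreover have "c * u' - poly q z * u \<in> Q" "c * v' - poly q z * v \<in> Q"
          using ff(2,3) uv(1,2) qQ Qc(3,4) by blast+
        ultimately have "r \<in> I" unfolding I_def using \<open>r \<noteq> 0\<close> c(3) by blast
        then show False using g(2) c(6) \<open>r \<noteq> 0\<close> by force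
      qed
      then show ?thesis using c e qQ by auto
    qed
    show "b / h \<in> Q"
    proof (cases "degree g = 0")
      case True
      then have "G = coeff g 0" by (auto simp: G_def elim: degree_eq_zeroE)
      then have GP: "G \<in> P" using gP polys_on_coeff by auto
      \<comment> \<open>With a constant gcd, \<open>h\<close> divides \<open>G * b\<close>, and the
        constant \<open>G\<close> cancels.\<close>
      have "G * b / h = u * b + v * (a * b / h)" using uv hQ by (simp add: G_def field_simps)
      moreover have "u * b + v * (a * b / h) \<in> Q" using uv(1,2) b ab Qc(4,6) by blast
      ultimately have "G * b / h \<in> Q" by simp
      then show ?thesis using primitive_cancel[OF GP GQ(2) hQ(1,2) b prim] by auto
    next
      case False
      obtain c q where c: "c \<in> P" "q \<in> Q" "c \<noteq> 0" "c * h = G * q"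
        using div[of hp 1 0] h Qc by (auto simp: h_def)
      obtain c' q' where c': "c' \<in> P" "q' \<in> Q" "c' \<noteq> 0" "c' * a = G * q'"
        using div[of ap 0 1] ap Qc by auto
      obtain G1 q1 d where s: "G1 \<in> Q" "q1 \<in> Q" "d \<in> P" "d \<noteq> 0" "h = G1 * q1" "G = d * G1"
        using split_off_const[OF c(1,3) hQ(1,2) GQ(1) c(2,4)] by blast
      \<comment> \<open>If \<open>G1\<close> is a unit, \<open>g\<close> is constant, a
        contradiction. If \<open>q1\<close> is a unit, \<open>h\<close> is associated to
        \<open>G1\<close>, hence divides \<open>a\<close> up to a constant, contrary to the choice
        of \<open>a\<close>.\<close>
      have "inverse G1 \<in> Q \<or> inverse q1 \<in> Q" using hirr s by auto
      then show ?thesis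
      proof
        assume "inverse G1 \<in> Q"
        then have un: "unit_on Q G1" using s hQ by (auto simp: unit_on_def)
        obtain k where k: "k \<in> polys_on P" "G1 = poly k z" using QE[OF s(1)] by metis
        have "g = smult d k" by (rule poly_eqD) (use gP k s P in \<open>auto simp: G_def intro: polys_on_closed\<close>)
        then have False using unit_adjoin[OF k(1)] un k False by (auto split: if_splits)
        then show ?thesis ..
      next
        assume q1: "inverse q1 \<in> Q"
        have "c' * a / h = d * q' * inverse q1" using c'(4) s hQ by (auto simp: field_simps)
        moreover have "d * q' * inverse q1 \<in> Q" using q1 s(3) c'(2) PQ Qc(4) by blast
        ultimately have "c' * a / h \<in> Q" by simp
        then show ?thesis using primitive_cancel[OF c'(1,3) hQ(1,2) a prim] nah by auto
      qed
    qed
  qed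
  then show ?thesis unfolding prime_on_def using hQ unfolding h_def by blast
qed

text \<open>Factors of a primitive polynomial are primitive, and a non-unit constant never is,
  having a prime divisor; so both factors of a proper factorization have smaller degree.\<close>

lemma primitive_factorization:
  assumes "f \<in> polys_on P" "degree f > 0" "\<And>p. prime_on P p \<Longrightarrow> poly f z / p \<notin> Q"
  shows "has_factorization Q (poly f z)"
  using assms
proof (induction "degree f" arbitrary: f rule: less_induct)
  case less
  have f0: "poly f z \<noteq> 0" using less.prems poly_eqD[OF _ polys_on_closed(1)[OF P]] by force
  have fQ: "poly f z \<in> Q" using less.prems by (auto simp: Q_def intro: adjoinI)
  have fu: "inverse (poly f z) \<notin> Q" using unit_adjoin(1)[of f] less.prems f0 fQ by (auto simp: unit_on_def)
  show ?case
  proof (cases "irreducible_on Q (poly f z)")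
    case True
    then show ?thesis using irreducible_pos_degree_prime[OF less.prems(1,2) True] unit_on_1[OF Q]
      unfolding has_factorization_def by (intro exI[of _ 1] exI[of _ "[poly f z]"]) auto
  next
    case False
    then obtain a b where ab: "a \<in> Q" "b \<in> Q" "poly f z = a * b" "inverse a \<notin> Q" "inverse b \<notin> Q"
      using f0 fQ fu by (auto simp: irreducible_on_def)
    have prim: "a / p \<notin> Q" "b / p \<notin> Q" if "prime_on P p" for p
    proof -
      have "a / p * b \<notin> Q" "a * (b / p) \<notin> Q" using less.prems(3)[OF that] ab by auto
      then show "a / p \<notin> Q" "b / p \<notin> Q" using ab Q is_subring_closed(4) by metis+
    qed
    have pos: "degree g > 0" if g: "g \<in> polys_on P" "c = poly g z" "c \<noteq> 0" "inverse c \<notin> Q" "\<And>p. prime_on P p \<Longrightarrow> c / p \<notin> Q" for g c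
    proof (rule ccontr)
      assume "\<not> degree g > 0"
      then have "c = coeff g 0" using g by (auto elim: degree_eq_zeroE)
      then have "c \<in> P" using g polys_on_coeff by auto
      then show False using nonunit_prime_divisor[OF fac, of c] g PQ by blast
    qed
    obtain g k where gk: "g \<in> polys_on P" "a = poly g z" "k \<in> polys_on P" "b = poly k z"
      using QE[OF ab(1)] QE[OF ab(2)] by metis
    have nz: "a \<noteq> 0" "b \<noteq> 0" using ab f0 by auto
    have pg: "degree g > 0" "degree k > 0" using pos gk prim ab nz by blast+
    have "f = g * k" by (rule poly_eqD) (use less.prems gk ab P in \<open>auto intro: polys_on_closed\<close>)
    then have "degree f = degree g + degree k" using pg by (metis degree_0 degree_mult_eq less_irrefl)
    then have "has_factorization Q a" "has_factorization Q b"
      using less.hyps[of g] less.hyps[of k] pg gk prim by auto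
    then show ?thesis using has_factorization_mult[OF Q] ab by simp
  qed
qed

text \<open>Induction on the number of prime factors of the leading coefficient: a prime constant
  dividing \<open>f\<close> divides that coefficient as well, and if none divides \<open>f\<close>,
  the polynomial is primitive.\<close>

lemma adjoin_factorization:
  assumes "f \<in> polys_on P" "f \<noteq> 0"
  shows "has_factorization Q (poly f z)"
proof -
  have const: "has_factorization Q c" if "c \<in> P" "c \<noteq> 0" for c
    using factorial_onD(2)[OF fac that] unit_on_PQ prime_on_adjoin unfolding has_factorization_def by blast
  have "lead_coeff f \<in> P" "lead_coeff f \<noteq> 0" using assms polys_on_coeff by auto
  then obtain u ps where "unit_on P u" "\<forall>p\<in>set ps. prime_on P p" "lead_coeff f = u * prod_list ps"
    using factorial_onD(2)[OF fac] unfolding has_factorization_def by metis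
  then show ?thesis using assms
  proof (induction "length ps" arbitrary: f ps u)
    case 0
    show ?case
    proof (cases "degree f = 0")
      case True
      then have "poly f z = coeff f 0" by (auto elim: degree_eq_zeroE)
      moreover have "coeff f 0 \<noteq> 0" using True 0 leading_coeff_0_iff[of f] by metis
      ultimately show ?thesis using const 0 polys_on_coeff by auto
    next
      case False
      have "poly f z / p \<notin> Q" if "prime_on P p" for p
        using const_div_adjoin[of p f "degree f"] prime_not_dvd_unit[OF P that] 0 prime_onD[OF that] by auto
      then show ?thesis using primitive_factorization 0 False by auto
    qed
  next
    case (Suc n)
    show ?case
    proof (cases "degree f = 0")
      case True
      then have "poly f z = coeff f 0" by (auto elim: degree_eq_zeroE)
      moreover have "coeff f 0 \<noteq> 0" using True Suc leading_coeff_0_iff[of f] by metis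
      ultimately show ?thesis using const[of "coeff f 0"] Suc.prems polys_on_coeff by auto
    next
      case False
      show ?thesis
      proof (cases "\<exists>p. prime_on P p \<and> poly f z / p \<in> Q")
        case True
        then obtain p where p: "prime_on P p" "poly f z / p \<in> Q" by auto
        note pD = prime_onD[OF p(1)]
        obtain k where k: "k \<in> polys_on P" "poly f z / p = poly k z" using QE[OF p(2)] by metis
        have fk: "f = smult p k" by (rule poly_eqD) (use Suc.prems k P pD in \<open>auto simp: field_simps intro: polys_on_closed\<close>)
        have "lead_coeff k = u * prod_list ps / p" using fk Suc.prems(3) pD by (simp add: field_simps)
        moreover then have "u * prod_list ps / p \<in> P" using k polys_on_coeff by metis
        ultimately obtain v rs where "unit_on P v" "\<forall>p\<in>set rs. prime_on P p" "length ps = Suc (length rs)" "lead_coeff k = v * prod_list rs"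
          using factorization_div_prime[OF P p(1) Suc.prems(1,2)] by auto
        then have "has_factorization Q (poly k z)" using Suc.hyps k fk Suc.prems(5) by auto
        moreover have "has_factorization Q p" using const pD by auto
        ultimately show ?thesis using has_factorization_mult[OF Q] fk by auto
      next
        case n: False
        then show ?thesis using primitive_factorization Suc.prems False by auto
      qed
    qed
  qed
qed

theorem factorial_adjoin: "factorial_on (adjoin P z)"
  unfolding factorial_on_def
proof (intro conjI ballI impI)
  show "is_subring (adjoin P z)" using Q by (simp add: Q_def)
  fix a assume "a \<in> adjoin P z" "a \<noteq> 0"
  then obtain f where "f \<in> polys_on P" "a = poly f z" by (auto simp: adjoin_def)
  then show "has_factorization (adjoin P z) a" using adjoin_factorization[of f] \<open>a \<noteq> 0\<close> unfolding Q_def by (metis poly_0)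
qed

text \<open>In degree one a factorization has a constant factor, and coprimality of \<open>a\<close>
  and \<open>b\<close> makes this constant a unit. It yields the primality of variables and of the
  primes exhibited later in each class.\<close>

lemma prime_on_linear:
  assumes ab: "a \<in> P" "b \<in> P" "b \<noteq> 0" and cop: "\<And>p. prime_on P p \<Longrightarrow> a / p \<in> P \<Longrightarrow> b / p \<in> P \<Longrightarrow> False"
  shows "prime_on (adjoin P z) (a + b * z)"
proof -
  have f: "[:a, b:] \<in> polys_on P" using ab P by (intro polys_on_closed)
  have d: "degree [:a, b:] = 1" using ab by simp
  have e: "poly [:a, b:] z = a + b * z" by (simp add: mult.commute)
  have eQ: "a + b * z \<in> Q" using adjoinI[OF f, of z] unfolding e Q_def .
  have nz: "a + b * z \<noteq> 0" using poly_eqD[OF f polys_on_closed(1)[OF P], unfolded e] ab by auto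
  have "irreducible_on Q (a + b * z)" unfolding irreducible_on_def
  proof (intro conjI ballI impI)
    show "inverse (a + b * z) \<notin> Q" using unit_adjoin(1)[OF f, unfolded e d] eQ nz by (auto simp: unit_on_def)
    fix x y assume xy: "x \<in> Q" "y \<in> Q" "a + b * z = x * y"
    obtain k l where kl: "k \<in> polys_on P" "x = poly k z" "l \<in> polys_on P" "y = poly l z"
      using QE[OF xy(1)] QE[OF xy(2)] by metis
    have kl': "[:a, b:] = k * l" by (rule poly_eqD) (use f kl xy e P in \<open>auto intro: polys_on_closed\<close>)
    then have "degree k + degree l = 1" using d ab by (metis degree_mult_eq mult_zero_left mult_zero_right pCons_eq_0_iff)
    then have dg: "degree k = 0 \<or> degree l = 0" by auto
    have *: "inverse c \<in> Q" if c: "c \<in> P" "[:a, b:] = smult c m" "m \<in> polys_on P" for c m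
    proof (rule ccontr)
      assume "inverse c \<notin> Q"
      then have "inverse c \<notin> P" using PQ by auto
      moreover have "c \<noteq> 0" using c(2) ab by auto
      ultimately obtain p where p: "prime_on P p" "c / p \<in> P" using nonunit_prime_divisor[OF fac] c by blast
      have "a = c * coeff m 0" "b = c * coeff m 1" using arg_cong[OF c(2), of "\<lambda>f. coeff f 0"] arg_cong[OF c(2), of "\<lambda>f. coeff f 1"] by auto
      then have "a / p = (c / p) * coeff m 0" "b / p = (c / p) * coeff m 1" by auto
      then show False using cop[OF p(1)] p(2) polys_on_coeff[OF c(3)] P is_subring_closed(4) by metis
    qed
    from dg show "inverse x \<in> Q \<or> inverse y \<in> Q"
    proof
      assume "degree k = 0"
      then obtain c where "k = [:c:]" by (elim degree_eq_zeroE)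
      then show ?thesis using *[of c l] kl kl' polys_on_coeff[OF kl(1), of 0] by auto
    next
      assume "degree l = 0"
      then obtain c where "l = [:c:]" by (elim degree_eq_zeroE)
      then show ?thesis using *[of c k] kl kl' polys_on_coeff[OF kl(3), of 0] by (auto simp: mult.commute)
    qed
  qed (use eQ nz in auto)
  then show ?thesis using irreducible_pos_degree_prime[OF f, unfolded e d] unfolding Q_def by simp
qed

text \<open>By degrees, the cofactor of \<open>a + b * z\<close> in \<open>z\<close> would be
  constant, which \<open>a \<noteq> 0\<close> excludes. Both facts later separate the constructed
  primes from \<open>\<mu>\<close> and from each other.\<close>

lemma linear_not_dvd:
  assumes ab: "a \<in> P" "b \<in> P" "a \<noteq> 0" "b \<noteq> 0" and c: "c \<in> P" "c \<noteq> 0"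
  shows "c / (a + b * z) \<notin> adjoin P z" "z / (a + b * z) \<notin> adjoin P z"
proof -
  have f: "[:a, b:] \<in> polys_on P" using ab P by (intro polys_on_closed)
  have e: "poly [:a, b:] z = a + b * z" by (simp add: mult.commute)
  have nz: "a + b * z \<noteq> 0" using poly_eqD[OF f polys_on_closed(1)[OF P], unfolded e] ab by auto
  show "c / (a + b * z) \<notin> adjoin P z"
  proof
    assume "c / (a + b * z) \<in> adjoin P z"
    then obtain k where k: "k \<in> polys_on P" "c / (a + b * z) = poly k z" by (auto simp: adjoin_def)
    have kc: "[:c:] = [:a, b:] * k" by (rule poly_eqD) (use k f c nz P ab in \<open>auto intro!: polys_on_closed is_subring_closed simp: field_simps\<close>)
    then have "k \<noteq> 0" using c by auto
    then have "degree [:c:] = 1 + degree k" unfolding kc using ab by (subst degree_mult_eq) auto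
    then show False by simp
  qed
  show "z / (a + b * z) \<notin> adjoin P z"
  proof
    assume "z / (a + b * z) \<in> adjoin P z"
    then obtain k where k: "k \<in> polys_on P" "z / (a + b * z) = poly k z" by (auto simp: adjoin_def)
    have kc: "[:0, 1:] = [:a, b:] * k" by (rule poly_eqD) (use k f c nz P ab in \<open>auto intro!: polys_on_closed is_subring_closed simp: field_simps\<close>)
    then have "k \<noteq> 0" by auto
    then have "degree [:0, 1 :: 'f:] = 1 + degree k" unfolding kc using ab by (subst degree_mult_eq) auto
    then have "degree k = 0" by simp
    then obtain d where "k = [:d:]" by (elim degree_eq_zeroE)
    then show False using kc ab by auto
  qed
qed

end

lemma factorial_on_field:
  assumes "is_subring P" "\<And>x. x \<in> P \<Longrightarrow> inverse x \<in> P"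
  shows "factorial_on P"
  unfolding factorial_on_def has_factorization_def unit_on_def
  using assms by (auto intro!: exI[of _ "[]"])

lemma fractionsI: "a \<in> N \<Longrightarrow> s \<in> S \<Longrightarrow> z = a / s \<Longrightarrow> z \<in> fractions N S"
  by (auto simp: fractions_def)

subsection \<open>Subrings of a field as ring records\<close>

lemma subring_on_simps [simp]:
  "carrier (subring_on A) = A" "x \<otimes>\<^bsub>subring_on A\<^esub> y = x * y" "x \<oplus>\<^bsub>subring_on A\<^esub> y = x + y"
  "\<one>\<^bsub>subring_on A\<^esub> = 1" "\<zero>\<^bsub>subring_on A\<^esub> = 0"
  by (auto simp: subring_on_def ring_of_type_algebra_def)

lemma domain_subring_on:
  assumes "is_subring A"
  shows "domain (subring_on A)"
proof -
  note c = is_subring_closed[OF assms]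
  have "cring (subring_on A)"
  proof (rule cringI)
    show "abelian_group (subring_on A)"
      using c by (intro abelian_groupI) (auto simp: algebra_simps intro!: bexI[of _ "- _"])
    show "comm_monoid (subring_on A)"
      using c by (intro comm_monoidI) (auto simp: algebra_simps)
  qed (auto simp: algebra_simps)
  then show ?thesis by (intro domainI) auto
qed

lemma ideal_subring_on_iff:
  assumes "is_subring A"
  shows "ideal I (subring_on A) \<longleftrightarrow>
    I \<subseteq> A \<and> 0 \<in> I \<and> (\<forall>x\<in>I. \<forall>y\<in>I. x + y \<in> I) \<and> (\<forall>x\<in>I. \<forall>a\<in>A. a * x \<in> I)"
proof -
  note c = is_subring_closed[OF assms]
  interpret domain "subring_on A" by (rule domain_subring_on[OF assms])
  show ?thesis
  proof
    assume "ideal I (subring_on A)"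
    then interpret I: ideal I "subring_on A" .
    show "I \<subseteq> A \<and> 0 \<in> I \<and> (\<forall>x\<in>I. \<forall>y\<in>I. x + y \<in> I) \<and> (\<forall>x\<in>I. \<forall>a\<in>A. a * x \<in> I)"
      using I.a_subset I.zero_closed I.a_closed I.I_l_closed by auto
  next
    assume I: "I \<subseteq> A \<and> 0 \<in> I \<and> (\<forall>x\<in>I. \<forall>y\<in>I. x + y \<in> I) \<and> (\<forall>x\<in>I. \<forall>a\<in>A. a * x \<in> I)"
    have m: "- x \<in> I" if "x \<in> I" for x
    proof -
      have "(- 1) * x \<in> I" using I that c by blast
      then show ?thesis by simp
    qed
    have inv: "\<ominus>\<^bsub>subring_on A\<^esub> x = - x" if "x \<in> A" for x
      using that c by (intro minus_equality) auto
    show "ideal I (subring_on A)"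
    proof (rule idealI)
      show "ring (subring_on A)" by (rule ring_axioms)
      show "subgroup I (add_monoid (subring_on A))"
      proof (rule group.subgroupI[OF a_group])
        fix x assume "x \<in> I"
        then show "inv\<^bsub>add_monoid (subring_on A)\<^esub> x \<in> I"
          using I m inv[of x] unfolding a_inv_def by auto
      qed (use I in auto)
    qed (use I in \<open>auto simp: mult.commute\<close>)
  qed
qed

lemma primeideal_subring_on_iff:
  assumes "is_subring A"
  shows "primeideal I (subring_on A) \<longleftrightarrow>
    ideal I (subring_on A) \<and> I \<noteq> A \<and> (\<forall>x\<in>A. \<forall>y\<in>A. x * y \<in> I \<longrightarrow> x \<in> I \<or> y \<in> I)"
proof -
  interpret domain "subring_on A" by (rule domain_subring_on[OF assms])
  show ?thesis
  proof
    assume "primeideal I (subring_on A)"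
    then interpret I: primeideal I "subring_on A" .
    show "ideal I (subring_on A) \<and> I \<noteq> A \<and> (\<forall>x\<in>A. \<forall>y\<in>A. x * y \<in> I \<longrightarrow> x \<in> I \<or> y \<in> I)"
      using I.is_ideal I.I_notcarr I.I_prime by auto
  next
    assume "ideal I (subring_on A) \<and> I \<noteq> A \<and> (\<forall>x\<in>A. \<forall>y\<in>A. x * y \<in> I \<longrightarrow> x \<in> I \<or> y \<in> I)"
    then show "primeideal I (subring_on A)" by (intro primeidealI) (auto intro: is_cring)
  qed
qed

lemma primeideal_subring_onD:
  assumes "is_subring A" "primeideal I (subring_on A)"
  shows "I \<subseteq> A" "0 \<in> I" "x \<in> I \<Longrightarrow> y \<in> I \<Longrightarrow> x + y \<in> I" "x \<in> I \<Longrightarrow> a \<in> A \<Longrightarrow> a * x \<in> I"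
    "x \<in> A \<Longrightarrow> y \<in> A \<Longrightarrow> x * y \<in> I \<Longrightarrow> x \<in> I \<or> y \<in> I" "1 \<notin> I"
proof -
  note * = assms(2)[unfolded primeideal_subring_on_iff[OF assms(1)] ideal_subring_on_iff[OF assms(1)]]
  show "I \<subseteq> A" "0 \<in> I" "x \<in> I \<Longrightarrow> y \<in> I \<Longrightarrow> x + y \<in> I" and m: "\<And>x a. x \<in> I \<Longrightarrow> a \<in> A \<Longrightarrow> a * x \<in> I"
    and "x \<in> A \<Longrightarrow> y \<in> A \<Longrightarrow> x * y \<in> I \<Longrightarrow> x \<in> I \<or> y \<in> I" using * by blast+
  show "1 \<notin> I" using m[of 1] * by auto
qed

text \<open>The zero ideal is prime in a domain, so height one means that
  \<open>{0} \<subset> P\<close> is a longest chain of primes ending in \<open>P\<close>.\<close>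

lemma prime_height_eq_1_iff:
  assumes A: "is_subring A" and P: "primeideal P (subring_on A)"
  shows "prime_height (subring_on A) P = 1 \<longleftrightarrow>
    P \<noteq> {0} \<and> (\<forall>Q. primeideal Q (subring_on A) \<and> Q \<subset> P \<longrightarrow> Q = {0})"
proof -
  define N where "N = {n. \<exists>Q. (\<forall>i\<le>n. primeideal (Q i) (subring_on A)) \<and> (\<forall>i<n. Q i \<subset> Q (Suc i)) \<and> Q n = P}"
  have ph: "prime_height (subring_on A) P = (SUP n\<in>N. enat n)" by (simp add: prime_height_def N_def)
  have z: "primeideal {0} (subring_on A)"
    using domain.zeroprimeideal[OF domain_subring_on[OF A]] by simp
  have zero_in: "0 \<in> Q" if "primeideal Q (subring_on A)" for Q
    using primeideal_subring_onD(2)[OF A that] .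
  show ?thesis
  proof
    assume 1: "prime_height (subring_on A) P = 1"
    have le: "n \<le> 1" if nN: "n \<in> N" for n
    proof -
      have "enat n \<le> (SUP n\<in>N. enat n)" using nN by (rule SUP_upper)
      then show ?thesis using 1 ph by (simp add: one_enat_def)
    qed
    show "P \<noteq> {0} \<and> (\<forall>Q. primeideal Q (subring_on A) \<and> Q \<subset> P \<longrightarrow> Q = {0})"
    proof (intro conjI allI impI)
      show "P \<noteq> {0}"
      proof
        assume P0: "P = {0}"
        have "n = 0" if nN: "n \<in> N" for n
        proof (rule ccontr)
          assume n: "n \<noteq> 0"
          obtain Q where Q: "\<forall>i\<le>n. primeideal (Q i) (subring_on A)" "\<forall>i<n. Q i \<subset> Q (Suc i)" "Q n = P"
            using nN unfolding N_def by blast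
          then have "Q (n - 1) \<subset> {0}" "0 \<in> Q (n - 1)" using n P0 Q(2)[rule_format, of "n - 1"] zero_in by auto
          then show False by auto
        qed
        then have "(SUP n\<in>N. enat n) \<le> 0" by (intro SUP_least) (auto simp: zero_enat_def)
        then show False using 1 ph by simp
      qed
      fix Q assume Q: "primeideal Q (subring_on A) \<and> Q \<subset> P"
      show "Q = {0}"
      proof (rule ccontr)
        assume "Q \<noteq> {0}"
        then have "{0} \<subset> Q" using Q zero_in by auto
        \<comment> \<open>The chain is \<open>{0} \<subset> Q \<subset> P\<close>.\<close>
        then have "2 \<in> N" unfolding N_def using Q P z
          by (auto intro!: exI[of _ "\<lambda>i. if i = 0 then {0} else if i = 1 then Q else P"] simp: less_2_cases_iff)
        then show False using le by force
      qed
    qed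
  next
    assume *: "P \<noteq> {0} \<and> (\<forall>Q. primeideal Q (subring_on A) \<and> Q \<subset> P \<longrightarrow> Q = {0})"
    then have "{0} \<subset> P" using zero_in[OF P] by auto
    then have "1 \<in> N" unfolding N_def using P z
      by (auto intro!: exI[of _ "\<lambda>i. if i = 0 then {0} else P"])
    then have "enat 1 \<le> (SUP n\<in>N. enat n)" by (rule SUP_upper)
    moreover have "(SUP n\<in>N. enat n) \<le> enat 1"
    proof (rule SUP_least)
      fix n assume "n \<in> N"
      then obtain Q where Q: "\<forall>i\<le>n. primeideal (Q i) (subring_on A)" "\<forall>i<n. Q i \<subset> Q (Suc i)" "Q n = P"
        by (auto simp: N_def)
      have "n \<le> 1"
      proof (rule ccontr)
        assume n: "\<not> n \<le> 1"
        have "Q (n - 1) \<subset> P" using Q n Q(2)[rule_format, of "n - 1"] by auto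
        then have "Q (n - 1) = {0}" using * Q n by auto
        moreover have "Suc (n - 2) = n - 1" using n by simp
        then have "Q (n - 2) \<subset> Q (n - 1)" using Q(2)[rule_format, of "n - 2"] n by simp
        moreover have "0 \<in> Q (n - 2)" using Q zero_in by auto
        ultimately show False by auto
      qed
      then show "enat n \<le> enat 1" by simp
    qed
    ultimately show "prime_height (subring_on A) P = 1" using ph by (simp add: one_enat_def)
  qed
qed

subsection \<open>Rings cut out by a family of valuations\<close>

text \<open>The values are integers and the value at \<open>0\<close> carries no meaning; this is
  why valuation rings and ideals below admit \<open>0\<close> explicitly.\<close>

definition valuation_on :: "'f::field set \<Rightarrow> ('f \<Rightarrow> int) \<Rightarrow> bool" where
  "valuation_on K v \<longleftrightarrow> (\<forall>x\<in>K - {0}. \<forall>y\<in>K - {0}.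
     v (x * y) = v x + v y \<and> (x + y \<noteq> 0 \<longrightarrow> min (v x) (v y) \<le> v (x + y)))"

locale valued_field =
  fixes K :: "'f::field set" and v :: "'f \<Rightarrow> int"
  assumes K: "is_subring K" and K_inverse: "x \<in> K \<Longrightarrow> inverse x \<in> K"
    and val: "valuation_on K v"
begin

lemma K_closed: "1 \<in> K" "0 \<in> K" "x \<in> K \<Longrightarrow> y \<in> K \<Longrightarrow> x * y \<in> K" "x \<in> K \<Longrightarrow> y \<in> K \<Longrightarrow> x + y \<in> K"
  "x \<in> K \<Longrightarrow> y \<in> K \<Longrightarrow> x - y \<in> K" "x \<in> K \<Longrightarrow> - x \<in> K" "x \<in> K \<Longrightarrow> y \<in> K \<Longrightarrow> x / y \<in> K" "x \<in> K \<Longrightarrow> x ^ n \<in> K"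
proof -
  show "1 \<in> K" "0 \<in> K" using is_subring_closed(1,2)[OF K] .
  show "x \<in> K \<Longrightarrow> y \<in> K \<Longrightarrow> x * y \<in> K" by (rule is_subring_closed(4)[OF K])
  show "x \<in> K \<Longrightarrow> y \<in> K \<Longrightarrow> x + y \<in> K" by (rule is_subring_closed(6)[OF K])
  show "x \<in> K \<Longrightarrow> y \<in> K \<Longrightarrow> x - y \<in> K" by (rule is_subring_closed(3)[OF K])
  show "x \<in> K \<Longrightarrow> - x \<in> K" by (rule is_subring_closed(5)[OF K])
  show "x \<in> K \<Longrightarrow> y \<in> K \<Longrightarrow> x / y \<in> K"
    unfolding divide_inverse by (rule is_subring_closed(4)[OF K _ K_inverse])
  show "x \<in> K \<Longrightarrow> x ^ n \<in> K" by (rule is_subring_closed(7)[OF K])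
qed

lemma val_mult: "x \<in> K \<Longrightarrow> y \<in> K \<Longrightarrow> x \<noteq> 0 \<Longrightarrow> y \<noteq> 0 \<Longrightarrow> v (x * y) = v x + v y"
  using val by (auto simp: valuation_on_def)

lemma val_add: "x \<in> K \<Longrightarrow> y \<in> K \<Longrightarrow> x \<noteq> 0 \<Longrightarrow> y \<noteq> 0 \<Longrightarrow> x + y \<noteq> 0 \<Longrightarrow> min (v x) (v y) \<le> v (x + y)"
  using val by (auto simp: valuation_on_def)

lemma val_1: "v 1 = 0" using val_mult[of 1 1] K_closed by auto

lemma val_minus_1: "v (- 1) = 0" using val_mult[of "-1" "-1"] K_closed val_1 by auto

lemma val_minus: "x \<in> K \<Longrightarrow> v (- x) = v x"
  using val_mult[of "-1" x] K_closed val_minus_1 by (cases "x = 0") auto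

lemma val_inverse: "x \<in> K \<Longrightarrow> x \<noteq> 0 \<Longrightarrow> v (inverse x) = - v x"
  using val_mult[of x "inverse x"] K_inverse val_1 by auto

lemma val_divide: "x \<in> K \<Longrightarrow> y \<in> K \<Longrightarrow> x \<noteq> 0 \<Longrightarrow> y \<noteq> 0 \<Longrightarrow> v (x / y) = v x - v y"
  using val_mult[of x "inverse y"] K_inverse val_inverse by (auto simp: divide_inverse)

lemma val_power: "x \<in> K \<Longrightarrow> x \<noteq> 0 \<Longrightarrow> v (x ^ n) = int n * v x"
  by (induction n) (auto simp: val_1 val_mult K_closed algebra_simps)

lemma K_powi: "x \<in> K \<Longrightarrow> x powi k \<in> K"
  by (auto simp: power_int_def K_closed intro: K_inverse K_closed)

lemma val_powi: "x \<in> K \<Longrightarrow> x \<noteq> 0 \<Longrightarrow> v (x powi k) = k * v x"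
  by (auto simp: power_int_def val_power K_inverse val_inverse)

lemma val_add_eq:
  assumes "x \<in> K" "y \<in> K" "x \<noteq> 0" "y \<noteq> 0" "v x < v y"
  shows "x + y \<noteq> 0" "v (x + y) = v x"
proof -
  show n: "x + y \<noteq> 0" using assms val_minus[of y] by (metis add.inverse_inverse add_eq_0_iff less_irrefl)
  have "min (v (x + y)) (v (- y)) \<le> v (x + y - y)"
    using val_add[of "x + y" "- y"] n assms K_closed by auto
  then have "v (x + y) \<le> v x" using val_minus assms by auto
  moreover have "min (v x) (v y) \<le> v (x + y)" using val_add[of x y] n assms by auto
  ultimately show "v (x + y) = v x" using assms by auto
qed

lemma val_mult_cases: "x \<in> K \<Longrightarrow> y \<in> K \<Longrightarrow> x = 0 \<or> y = 0 \<or> v (x * y) = v x + v y"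
  using val_mult by blast

lemma val_divide_cases: "x \<in> K \<Longrightarrow> y \<in> K \<Longrightarrow> x = 0 \<or> y = 0 \<or> v (x / y) = v x - v y"
  using val_divide by blast

definition valring :: "'f set" where "valring = {z \<in> K. z = 0 \<or> 0 \<le> v z}"

definition valideal :: "'f set" where "valideal = {z \<in> K. z = 0 \<or> 0 < v z}"

lemma valring_subring: "is_subring valring"
  unfolding is_subring_def
proof (intro conjI ballI)
  show "1 \<in> valring" by (simp add: valring_def val_1 K_closed)
  fix x y assume xy: "x \<in> valring" "y \<in> valring"
  show "x * y \<in> valring" using xy val_mult_cases[of x y] K_closed(2) K_closed(3)[of x y] by (auto simp: valring_def)
  show "x - y \<in> valring"
  proof (cases "x = y \<or> x = 0 \<or> y = 0")
    case True
    then show ?thesis using xy val_minus[of y] K_closed(2) K_closed(6)[of y] by (auto simp: valring_def)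
  next
    case False
    then have "min (v x) (v (- y)) \<le> v (x - y)" "x - y \<in> K"
      using val_add[of x "- y"] xy K_closed(5)[of x y] K_closed(6)[of y] by (auto simp: valring_def)
    then show ?thesis using False xy val_minus[of y] by (auto simp: valring_def)
  qed
qed

lemma principal_iff:
  assumes "x \<in> K" "x \<noteq> 0"
  shows "(*) x ` valring = {z \<in> K. z = 0 \<or> v x \<le> v z}"
proof (intro subset_antisym subsetI)
  fix z assume "z \<in> (*) x ` valring"
  then obtain y where y: "y \<in> valring" "z = x * y" by auto
  then show "z \<in> {z \<in> K. z = 0 \<or> v x \<le> v z}"
    using assms K_closed(3)[of x y] val_mult_cases[of x y] by (auto simp: valring_def)
next
  fix z assume z: "z \<in> {z \<in> K. z = 0 \<or> v x \<le> v z}"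
  have "z / x \<in> valring" using z assms K_closed(2) K_closed(7)[of z x] val_divide_cases[of z x] by (auto simp: valring_def)
  then have "x * (z / x) \<in> (*) x ` valring" by blast
  then show "z \<in> (*) x ` valring" using assms by simp
qed

text \<open>A nonzero ideal is generated by an element of least value. A nonzero prime contains an
  associate of a power of \<open>t\<close>, hence \<open>t\<close>, and with it all of
  \<open>valideal\<close>.\<close>

lemma dvr_valring:
  assumes t: "t \<in> K" "t \<noteq> 0" "v t = 1"
  shows "dvr valring"
  unfolding dvr_def
proof
  note S = valring_subring
  interpret D: domain "subring_on valring" by (rule domain_subring_on[OF S])
  have tV: "t \<in> valring" using t by (simp add: valring_def)
  show "principal_domain (subring_on valring)"
  proof (intro principal_domain.intro principal_domain_axioms.intro D.domain_axioms)
    fix I assume "ideal I (subring_on valring)"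
    then have I: "I \<subseteq> valring" "0 \<in> I" "\<And>x a. x \<in> I \<Longrightarrow> a \<in> valring \<Longrightarrow> a * x \<in> I"
      unfolding ideal_subring_on_iff[OF S] by auto
    have pid: "PIdl\<^bsub>subring_on valring\<^esub> a = (*) a ` valring" for a
      by (auto simp: cgenideal_def mult.commute)
    show "\<exists>a\<in>carrier (subring_on valring). I = PIdl\<^bsub>subring_on valring\<^esub> a"
    proof (cases "I = {0}")
      case True
      then show ?thesis unfolding pid using is_subring_closed[OF S] by (intro bexI[of _ 0]) auto
    next
      case False
      then have "\<exists>n a. a \<in> I \<and> a \<noteq> 0 \<and> nat (v a) = n" using I by auto
      then obtain a where a: "a \<in> I" "a \<noteq> 0" "\<And>b. b \<in> I \<Longrightarrow> b \<noteq> 0 \<Longrightarrow> nat (v a) \<le> nat (v b)"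
        using exists_least_iff[of "\<lambda>n. \<exists>a. a \<in> I \<and> a \<noteq> 0 \<and> nat (v a) = n"] by (metis linorder_not_less)
      have aV: "a \<in> valring" using a I by auto
      have "I = (*) a ` valring"
      proof
        show "(*) a ` valring \<subseteq> I" using I(3)[OF a(1)] by (auto simp: mult.commute)
        show "I \<subseteq> (*) a ` valring"
        proof
          fix b assume b: "b \<in> I"
          then have "b \<in> K" "a \<in> K" "b = 0 \<or> 0 \<le> v b" "0 \<le> v a" using I aV a(2) by (auto simp: valring_def)
          then show "b \<in> (*) a ` valring" using a(3)[OF b] a(2) principal_iff[of a] by auto
        qed
      qed
      then show ?thesis unfolding pid using aV by auto
    qed
  qed
  have M: "primeideal valideal (subring_on valring)"
    unfolding primeideal_subring_on_iff[OF S] ideal_subring_on_iff[OF S]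
  proof (intro conjI ballI impI)
    show "valideal \<subseteq> valring" "0 \<in> valideal" using K_closed by (auto simp: valideal_def valring_def)
    have "1 \<in> valring" "1 \<notin> valideal" using K_closed val_1 by (auto simp: valideal_def valring_def)
    then show "valideal \<noteq> valring" by metis
  next
    fix x y assume "x \<in> valideal" "y \<in> valideal"
    then show "x + y \<in> valideal" using val_add[of x y] K_closed(2) K_closed(4)[of x y]
      by (cases "x = 0 \<or> y = 0 \<or> x + y = 0") (auto simp: valideal_def)
  next
    fix x a assume "x \<in> valideal" "a \<in> valring"
    then show "a * x \<in> valideal" using val_mult_cases[of a x] K_closed(2) K_closed(3)[of a x] by (auto simp: valideal_def valring_def)
  next
    fix x y assume "x \<in> valring" "y \<in> valring" "x * y \<in> valideal"
    then show "x \<in> valideal \<or> y \<in> valideal" using val_mult_cases[of x y] by (auto simp: valideal_def valring_def)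
  qed
  show "\<exists>!M. primeideal M (subring_on valring) \<and> M \<noteq> {0}"
  proof (rule ex1I)
    show "primeideal valideal (subring_on valring) \<and> valideal \<noteq> {0}"
    proof
      have "t \<in> valideal" using t by (simp add: valideal_def)
      then show "valideal \<noteq> {0}" using t(2) by blast
    qed (rule M)
    fix Q assume Q: "primeideal Q (subring_on valring) \<and> Q \<noteq> {0}"
    note QD = primeideal_subring_onD[OF S conjunct1[OF Q]]
    have "Q \<subseteq> valideal"
    proof
      fix x assume x: "x \<in> Q"
      then have xV: "x \<in> valring" using QD(1) by blast
      show "x \<in> valideal"
      proof (rule ccontr)
        assume "x \<notin> valideal"
        then have 0: "v x = 0" "x \<noteq> 0" "x \<in> K" using xV by (auto simp: valideal_def valring_def)
        then have "inverse x \<in> valring" using val_inverse[of x] K_inverse by (auto simp: valring_def)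
        then have "inverse x * x \<in> Q" using QD(4) x by blast
        then show False using QD(6) 0 by simp
      qed
    qed
    moreover have "valideal \<subseteq> Q"
    proof -
      obtain a where a: "a \<in> Q" "a \<noteq> 0" using conjunct2[OF Q] QD(2) by blast
      then have aK: "a \<in> K" "0 < v a" using \<open>Q \<subseteq> valideal\<close> unfolding valideal_def by blast+
      have "t ^ nat (v a) / a \<in> K" "v (t ^ nat (v a) / a) = 0"
        using aK a t val_divide[of "t ^ nat (v a)" a] K_closed(7,8) val_power by auto
      then have "t ^ nat (v a) / a \<in> valring" unfolding valring_def mem_Collect_eq by (metis order_refl)
      then have "(t ^ nat (v a) / a) * a \<in> Q" using QD(4) a by blast
      then have tn: "t ^ nat (v a) \<in> Q" using a by simp
      have tQ: "t \<in> Q" if "t ^ n \<in> Q" for n using that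
      proof (induction n)
        case 0 then show ?case using QD(6) by simp
      next
        case (Suc n)
        then show ?case using QD(5)[of t "t ^ n"] tV is_subring_closed(7)[OF S] by auto
      qed
      show ?thesis
      proof
        fix x assume x: "x \<in> valideal"
        then have "x / t \<in> valring" using t K_closed(2) K_closed(7)[of x t] val_divide_cases[of x t]
          by (auto simp: valring_def valideal_def)
        then have "(x / t) * t \<in> Q" using QD(4) tQ[OF tn] by blast
        then show "x \<in> Q" using t by simp
      qed
    qed
    ultimately show "Q = valideal" by blast
  qed
qed

end

text \<open>\<open>fin\<close> is finiteness of character. \<open>approx\<close> is the
  approximation property of Krull domains: it provides uniformizers, makes the centers pairwise
  incomparable and identifies \<open>K\<close> with the quotient field of \<open>A\<close>.\<close>

locale krull_family =
  fixes A K :: "'f::field set" and W :: "('f \<Rightarrow> int) set"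
  assumes K: "is_subring K" and K_inverse: "x \<in> K \<Longrightarrow> inverse x \<in> K"
    and val: "v \<in> W \<Longrightarrow> valuation_on K v"
    and fin: "z \<in> K \<Longrightarrow> z \<noteq> 0 \<Longrightarrow> finite {v \<in> W. v z \<noteq> 0}"
    and A_eq: "A = {z \<in> K. z = 0 \<or> (\<forall>v\<in>W. 0 \<le> v z)}"
    and approx: "v \<in> W \<Longrightarrow> finite T \<Longrightarrow> T \<subseteq> W - {v} \<Longrightarrow>
       \<exists>z\<in>K - {0}. v z = k \<and> (\<forall>u\<in>T. N \<le> u z) \<and> (\<forall>u\<in>W - {v} - T. 0 \<le> u z)"
begin

lemma valued: "v \<in> W \<Longrightarrow> valued_field K v"
  using K K_inverse val by unfold_locales

definition center :: "('f \<Rightarrow> int) \<Rightarrow> 'f set" where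
  "center v = {a \<in> A. a = 0 \<or> 0 < v a}"

lemmas K_closed = is_subring_closed[OF K]

lemma K_divide: "x \<in> K \<Longrightarrow> y \<in> K \<Longrightarrow> x / y \<in> K"
  unfolding divide_inverse by (rule K_closed(4)[OF _ K_inverse])

lemma A_iff: "z \<in> A \<longleftrightarrow> z \<in> K \<and> (z = 0 \<or> (\<forall>v\<in>W. 0 \<le> v z))"
  by (subst A_eq) auto

lemma A_sub: "is_subring A"
proof -
  have "A = (if W = {} then K else (\<Inter>v\<in>W. valued_field.valring K v))"
    by (subst A_eq) (auto simp: valued_field.valring_def[OF valued])
  then show ?thesis using K valued_field.valring_subring[OF valued]
    by (auto simp: is_subring_def)
qed

lemmas A_closed = is_subring_closed[OF A_sub]

lemma AK: "A \<subseteq> K" by (auto simp: A_iff)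

text \<open>The value of \<open>s\<close> at \<open>v\<close> is kept as small as possible. If
  \<open>0 \<le> v z\<close>, then \<open>s\<close> lies outside the center of \<open>v\<close>,
  which is what localization requires.\<close>

lemma clear_denominator:
  assumes v: "v \<in> W" and z: "z \<in> K" "z \<noteq> 0"
  shows "\<exists>s\<in>A. s \<noteq> 0 \<and> s * z \<in> A \<and> v s = max 0 (- v z)"
proof -
  define T where "T = {u \<in> W - {v}. u z < 0}"
  have "T \<subseteq> {u \<in> W. u z \<noteq> 0}" by (auto simp: T_def)
  then have T: "finite T" "T \<subseteq> W - {v}" using fin[OF z] finite_subset by (auto simp: T_def)
  \<comment> \<open>The sum of the pole orders bounds each of them, so one \<open>N\<close> serves
    all of \<open>T\<close>.\<close>
  define N where "N = (\<Sum>u\<in>T. - u z)"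
  have N: "- u z \<le> N" "0 \<le> N" if "u \<in> T" for u
  proof -
    show "- u z \<le> N" unfolding N_def using T that by (intro member_le_sum) (auto simp: T_def)
    then show "0 \<le> N" using that by (auto simp: T_def)
  qed
  obtain s where s: "s \<in> K" "s \<noteq> 0" "v s = max 0 (- v z)" "\<forall>u\<in>T. N \<le> u s" "\<forall>u\<in>W - {v} - T. 0 \<le> u s"
    using approx[OF v T, of "max 0 (- v z)" N] by auto
  have "0 \<le> u s" "0 \<le> u (s * z)" if "u \<in> W" for u
  proof -
    have m: "u (s * z) = u s + u z" using valued_field.val_mult[OF valued[OF that]] s z by auto
    consider "u = v" | "u \<in> T" | "u \<in> W - {v} - T" using \<open>u \<in> W\<close> by auto
    then have "0 \<le> u s \<and> 0 \<le> u s + u z"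
    proof cases
      case 1 then show ?thesis using s by auto
    next
      case 2 then show ?thesis using s(4) N[OF 2] by fastforce
    next
      case 3
      then have "0 \<le> u z" by (auto simp: T_def)
      then show ?thesis using s(5) 3 by auto
    qed
    then show "0 \<le> u s" "0 \<le> u (s * z)" using m by auto
  qed
  then show ?thesis using s z K_closed by (intro bexI[of _ s]) (auto simp: A_iff)
qed

lemma quotient_field_A: "quotient_field A = K"
proof
  show "quotient_field A \<subseteq> K" using AK K_divide by (auto simp: quotient_field_def fractions_def)
  show "K \<subseteq> quotient_field A"
  proof
    fix z assume z: "z \<in> K"
    show "z \<in> quotient_field A"
    proof (cases "z \<in> A")
      case True
      then show ?thesis using A_closed
        unfolding quotient_field_def by (intro fractionsI[of z _ 1]) auto
    next
      case False
      then obtain v where "v \<in> W" "z \<noteq> 0" using z by (auto simp: A_iff)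
      then obtain s where "s \<in> A" "s \<noteq> 0" "s * z \<in> A" using clear_denominator z by blast
      then show ?thesis
        unfolding quotient_field_def by (intro fractionsI[of "s * z" _ s]) auto
    qed
  qed
qed

lemma uniformizer: "v \<in> W \<Longrightarrow> \<exists>t\<in>A. t \<noteq> 0 \<and> v t = 1"
  using approx[of v "{}" 1 0] by (force simp: A_iff)

lemma fractions_center:
  assumes v: "v \<in> W"
  shows "fractions A (A - center v) = {z \<in> K. z = 0 \<or> 0 \<le> v z}"
    "fractions (center v) (A - center v) = {z \<in> K. z = 0 \<or> 0 < v z}"
proof -
  interpret valued_field K v by (rule valued[OF v])
  have nc: "s \<in> A - center v \<longleftrightarrow> s \<in> A \<and> s \<noteq> 0 \<and> v s = 0" for s
    using v by (force simp: center_def A_iff)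
  \<comment> \<open>A denominator of \<open>v\<close>-value \<open>0\<close> moves \<open>z\<close>
    into \<open>A\<close> without changing its value at \<open>v\<close>.\<close>
  have *: "\<exists>s. s \<in> A - center v \<and> s \<noteq> 0 \<and> s * z \<in> A \<and> v (s * z) = v z" if zz: "z \<in> K" "z \<noteq> 0" "0 \<le> v z" for z
  proof -
    obtain s where "s \<in> A" "s \<noteq> 0" "s * z \<in> A" "v s = 0" using clear_denominator[OF v zz(1,2)] zz by auto
    then show ?thesis using zz nc val_mult AK by (intro exI[of _ s]) auto
  qed
  have 0: "0 \<in> fractions A (A - center v)" "0 \<in> fractions (center v) (A - center v)"
    using nc[of 1] A_closed val_1 by (auto simp: center_def intro!: fractionsI[of 0 _ 1])
  show "fractions A (A - center v) = {z \<in> K. z = 0 \<or> 0 \<le> v z}"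
  proof safe
    fix z assume "z \<in> fractions A (A - center v)"
    then obtain a s where as: "z = a / s" "a \<in> A" "s \<in> A - center v" unfolding fractions_def by blast
    show "z \<in> K" using as AK K_divide by auto
    assume "\<not> 0 \<le> v z"
    then show "z = 0" using as nc[of s] val_divide_cases[of a s] AK v by (auto simp: A_iff)
  next
    fix z assume z: "z \<in> K" "0 \<le> v z"
    show "z \<in> fractions A (A - center v)"
    proof (cases "z = 0")
      case False
      obtain s where "s \<in> A - center v" "s \<noteq> 0" "s * z \<in> A" using * z False by blast
      then show ?thesis by (intro fractionsI[of "s * z" _ s]) auto
    qed (use 0 in auto)
  qed (use 0 in auto)
  show "fractions (center v) (A - center v) = {z \<in> K. z = 0 \<or> 0 < v z}"
  proof safe
    fix z assume "z \<in> fractions (center v) (A - center v)"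
    then obtain a s where as: "z = a / s" "a \<in> center v" "s \<in> A - center v" unfolding fractions_def by blast
    show "z \<in> K" using as AK K_divide by (auto simp: center_def)
    assume "\<not> 0 < v z"
    then show "z = 0" using as nc[of s] val_divide_cases[of a s] AK v by (auto simp: center_def A_iff)
  next
    fix z assume z: "z \<in> K" "0 < v z"
    show "z \<in> fractions (center v) (A - center v)"
    proof (cases "z = 0")
      case False
      obtain s where s: "s \<in> A - center v" "s \<noteq> 0" "s * z \<in> A" "v (s * z) = v z" using * z False by force
      then have "s * z \<in> center v" using z by (auto simp: center_def)
      then show ?thesis using s by (intro fractionsI[of "s * z" _ s]) auto
    qed (use 0 in auto)
  qed (use 0 in auto)
qed

lemma localization_center: "v \<in> W \<Longrightarrow> localization A (center v) = valued_field.valring K v"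
  unfolding localization_def using fractions_center(1) valued_field.valring_def[OF valued] by auto

lemma primeideal_center:
  assumes v: "v \<in> W"
  shows "primeideal (center v) (subring_on A)"
proof -
  interpret valued_field K v by (rule valued[OF v])
  show ?thesis
    unfolding primeideal_subring_on_iff[OF A_sub] ideal_subring_on_iff[OF A_sub]
  proof (intro conjI ballI impI)
    show "center v \<subseteq> A" "0 \<in> center v" using A_closed by (auto simp: center_def)
    have "1 \<notin> center v" using val_1 by (auto simp: center_def)
    then show "center v \<noteq> A" using A_closed(1) by metis
  next
    fix x y assume "x \<in> center v" "y \<in> center v"
    then show "x + y \<in> center v" using val_add[of x y] A_closed(2) A_closed(6)[of x y] AK
      by (cases "x = 0 \<or> y = 0 \<or> x + y = 0") (auto simp: center_def subset_iff)
  next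
    fix x a assume "x \<in> center v" "a \<in> A"
    then have "a * x \<in> A" "a \<in> K" "x \<in> K" "a = 0 \<or> 0 \<le> v a" "x = 0 \<or> 0 < v x"
      using A_closed(4)[of a x] AK v by (auto simp: center_def A_iff)
    then show "a * x \<in> center v" using val_mult_cases[of a x] by (auto simp: center_def)
  next
    fix x y assume "x \<in> A" "y \<in> A" "x * y \<in> center v"
    then show "x \<in> center v \<or> y \<in> center v" using val_mult_cases[of x y] AK v by (auto simp: center_def A_iff)
  qed
qed

lemma center_subset:
  assumes "v \<in> W" "u \<in> W" "center v \<subseteq> center u"
  shows "v = u"
proof (rule ccontr)
  assume "v \<noteq> u"
  then obtain z where z: "z \<in> K" "z \<noteq> 0" "u z = 0" "1 \<le> v z" "\<forall>w\<in>W - {u} - {v}. 0 \<le> w z"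
    using approx[of u "{v}" 0 1] assms by auto
  have "\<forall>w\<in>W. 0 \<le> w z" using z by (metis DiffI empty_iff insertE order_refl zero_le_one order_trans)
  then have "z \<in> center v" "z \<notin> center u" using z by (auto simp: center_def A_iff)
  then show False using assms by auto
qed

text \<open>Only finitely many \<open>v\<close> are positive at a nonzero \<open>a\<close> in
  \<open>Q\<close>. If \<open>Q\<close> contained no center, pick in each of these centers an
  element outside \<open>Q\<close>; the product of suitable powers has at least the value of
  \<open>a\<close> everywhere, so it is a multiple of \<open>a\<close> in \<open>A\<close> and lies
  in \<open>Q\<close>, against primality.\<close>

lemma nonzero_prime_contains_center:
  assumes Q: "primeideal Q (subring_on A)" "Q \<noteq> {0}"
  shows "\<exists>v\<in>W. center v \<subseteq> Q"
proof (rule ccontr)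
  assume n: "\<not> ?thesis"
  note QD = primeideal_subring_onD[OF A_sub Q(1)]
  obtain a where a: "a \<in> Q" "a \<noteq> 0" using Q(2) QD(2) by auto
  have aA: "a \<in> A" using a QD by auto
  define J where "J = {v \<in> W. v a \<noteq> 0}"
  have J: "finite J" "J \<subseteq> W" using fin[of a] a aA AK by (auto simp: J_def)
  have "\<forall>v\<in>J. \<exists>b. b \<in> center v \<and> b \<notin> Q" using n J by auto
  then obtain b where b: "\<And>v. v \<in> J \<Longrightarrow> b v \<in> center v \<and> b v \<notin> Q" by metis
  have bA: "b v \<in> A" "b v \<noteq> 0" "0 < v (b v)" "b v \<in> K" if "v \<in> J" for v
    using b[OF that] QD(2) AK by (auto simp: center_def)
  have prod: "(\<Prod>v\<in>I. b v ^ nat (v a)) \<in> A \<and> (\<Prod>v\<in>I. b v ^ nat (v a)) \<noteq> 0 \<and> (\<Prod>v\<in>I. b v ^ nat (v a)) \<notin> Q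
      \<and> (\<forall>v\<in>I. v a \<le> v (\<Prod>v\<in>I. b v ^ nat (v a)))" if "finite I" "I \<subseteq> J" for I
    using that
  proof (induction I)
    case empty
    then show ?case using A_closed QD(6) by simp
  next
    case (insert w I)
    let ?p = "\<Prod>v\<in>I. b v ^ nat (v a)"
    have IH: "?p \<in> A" "?p \<noteq> 0" "?p \<notin> Q" "\<forall>v\<in>I. v a \<le> v ?p" using insert by auto
    have w: "w \<in> J" using insert by auto
    have bw: "b w ^ n \<in> A" "b w ^ n \<notin> Q" for n
    proof -
      show A: "b w ^ n \<in> A" for n using bA[OF w] A_closed by auto
      show "b w ^ n \<notin> Q"
      proof (induction n)
        case 0 then show ?case using QD(6) by simp
      next
        case (Suc n) then show ?case using QD(5)[of "b w" "b w ^ n"] A bA[OF w] b[OF w] by auto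
      qed
    qed
    have "v a \<le> v (b w ^ nat (w a) * ?p)" if v: "v \<in> insert w I" for v
    proof -
      have vW: "v \<in> W" using v w insert J by auto
      interpret valued_field K v by (rule valued[OF vW])
      have e: "v (b w ^ nat (w a) * ?p) = v (b w ^ nat (w a)) + v ?p"
        using bw(1) IH bA[OF w] AK by (intro val_mult) auto
      have nn: "0 \<le> v (b w ^ nat (w a))" "0 \<le> v ?p" using bw(1)[of "nat (w a)"] IH bA[OF w] vW unfolding A_iff by auto
      show ?thesis
      proof (cases "v = w")
        case True
        have "v (b w ^ nat (w a)) = int (nat (v a)) * v (b v)" using True bA[OF w] val_power by auto
        moreover have "0 \<le> v a" using aA a vW by (auto simp: A_iff)
        ultimately have "v a \<le> v (b w ^ nat (w a))" using bA(3)[OF w] True by (simp add: mult_le_cancel_left1)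
        then show ?thesis using e nn by auto
      next
        case False
        then show ?thesis using IH(4) v e nn by auto
      qed
    qed
    moreover have "b w ^ nat (w a) * ?p \<in> A" using bw(1) IH(1) A_closed(4) by blast
    moreover have "b w ^ nat (w a) * ?p \<noteq> 0" using bA(2)[OF w] IH(2) by simp
    moreover have "b w ^ nat (w a) * ?p \<notin> Q" using QD(5)[OF bw(1) IH(1)] bw(2) IH(3) by blast
    ultimately show ?case unfolding prod.insert[OF insert(1,2)] by blast
  qed
  define p where "p = (\<Prod>v\<in>J. b v ^ nat (v a))"
  have p: "p \<in> A" "p \<noteq> 0" "p \<notin> Q" "\<forall>v\<in>J. v a \<le> v p" using prod[OF J(1) order_refl] by (auto simp: p_def)
  have "0 \<le> v (p / a)" if v: "v \<in> W" for v
  proof -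
    interpret valued_field K v by (rule valued[OF v])
    have "v (p / a) = v p - v a" using p a aA AK by (intro val_divide) auto
    moreover have "v a \<le> v p" using p v by (cases "v \<in> J") (auto simp: J_def A_iff)
    ultimately show ?thesis by auto
  qed
  then have "p / a \<in> A" using p a aA AK K_divide by (auto simp: A_iff)
  then have "(p / a) * a \<in> Q" using QD(4) a by blast
  then show False using p a by simp
qed

text \<open>Every nonzero prime contains a center and distinct centers are incomparable, so the
  centers are exactly the minimal nonzero primes.\<close>

lemma height_one_primes_A: "height_one_primes A = center ` W"
proof
  show "height_one_primes A \<subseteq> center ` W"
  proof
    fix P assume "P \<in> height_one_primes A"
    then have P: "primeideal P (subring_on A)" "P \<noteq> {0}"
      "\<And>Q. primeideal Q (subring_on A) \<Longrightarrow> Q \<subset> P \<Longrightarrow> Q = {0}"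
      using prime_height_eq_1_iff[OF A_sub] by (auto simp: height_one_primes_def)
    obtain v where v: "v \<in> W" "center v \<subseteq> P" using nonzero_prime_contains_center[OF P(1,2)] by auto
    have "center v \<noteq> {0}" using uniformizer[OF v(1)] by (force simp: center_def)
    then have "center v = P" using P(3)[OF primeideal_center[OF v(1)]] v by auto
    then show "P \<in> center ` W" using v by auto
  qed
  show "center ` W \<subseteq> height_one_primes A"
  proof safe
    fix v assume v: "v \<in> W"
    have "center v \<noteq> {0}" using uniformizer[OF v] by (force simp: center_def)
    moreover have "Q = {0}" if Q: "primeideal Q (subring_on A)" "Q \<subset> center v" for Q
    proof (rule ccontr)
      assume "Q \<noteq> {0}"
      then obtain u where u: "u \<in> W" "center u \<subseteq> Q" using nonzero_prime_contains_center[OF Q(1)] by metis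
      then have "u = v" using center_subset[of u v] v Q by auto
      then show False using u Q by auto
    qed
    ultimately show "center v \<in> height_one_primes A"
      using primeideal_center[OF v] prime_height_eq_1_iff[OF A_sub] by (auto simp: height_one_primes_def)
  qed
qed

lemma inj_on_center: "inj_on center W"
  using center_subset by (auto simp: inj_on_def)

theorem krull_domain_A: "krull_domain A"
  unfolding krull_domain_def height_one_primes_A quotient_field_A
proof (intro conjI ballI)
  show "domain (subring_on A)" by (rule domain_subring_on[OF A_sub])
next
  fix P assume "P \<in> center ` W"
  then obtain v where v: "v \<in> W" "P = center v" by auto
  obtain t where "t \<in> A" "t \<noteq> 0" "v t = 1" using uniformizer[OF v(1)] by auto
  then show "dvr (localization A P)"
    using localization_center[OF v(1)] valued_field.dvr_valring[OF valued[OF v(1)], of t] v AK by auto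
next
  have "localization A (center v) = {z \<in> K. z = 0 \<or> 0 \<le> v z}" if "v \<in> W" for v
    using localization_center[OF that] valued_field.valring_def[OF valued[OF that]] by auto
  then show "A = {z \<in> K. \<forall>P\<in>center ` W. z \<in> localization A P}"
    by (auto simp: A_iff)
next
  fix a assume a: "a \<in> A - {0}"
  have "{P \<in> center ` W. a \<in> P} \<subseteq> center ` {v \<in> W. v a \<noteq> 0}"
    using a by (auto simp: center_def)
  moreover have "finite {v \<in> W. v a \<noteq> 0}" using fin[of a] a AK by auto
  ultimately show "finite {P \<in> center ` W. a \<in> P}" using finite_subset by blast
qed

text \<open>All generators of the maximal ideal have value \<open>1\<close>, so the exponent does
  not depend on the generator.\<close>

lemma prime_valuation_center:
  assumes v: "v \<in> W" and z: "z \<in> K" "z \<noteq> 0"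
  shows "prime_valuation A (center v) z = v z"
proof -
  interpret valued_field K v by (rule valued[OF v])
  obtain t where t: "t \<in> K" "t \<noteq> 0" "v t = 1" using uniformizer[OF v] AK by auto
  have M: "fractions (center v) (A - center v) = (*) t ` valring"
    using fractions_center(2)[OF v] principal_iff[OF t(1,2)] t(3) by auto
  have L: "localization A (center v) = valring" by (rule localization_center[OF v])
  have cancel: "v x = v y" if "x \<in> K" "y \<in> K" "x \<noteq> 0" "y \<noteq> 0" "(*) x ` valring = (*) y ` valring" for x y
  proof -
    have "x * 1 \<in> (*) y ` valring" "y * 1 \<in> (*) x ` valring"
      using that(5) is_subring_closed(1)[OF valring_subring] by blast+
    then show ?thesis using principal_iff that(1-4) by auto
  qed
  show ?thesis unfolding prime_valuation_def M L
  proof (rule the_equality)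
    show "\<exists>\<pi>. (*) t ` valring = (*) \<pi> ` valring \<and> (*) z ` valring = (*) (\<pi> powi v z) ` valring"
    proof (intro exI[of _ t] conjI)
      show "(*) t ` valring = (*) t ` valring" by (rule HOL.refl)
      have "v (t powi v z) = v z" using val_powi t by auto
      then show "(*) z ` valring = (*) (t powi v z) ` valring"
        using principal_iff z t K_powi by (simp add: power_int_eq_0_iff)
    qed
    fix k assume "\<exists>\<pi>. (*) t ` valring = (*) \<pi> ` valring \<and> (*) z ` valring = (*) (\<pi> powi k) ` valring"
    then obtain \<pi> where \<pi>: "(*) t ` valring = (*) \<pi> ` valring" "(*) z ` valring = (*) (\<pi> powi k) ` valring" by auto
    have "\<pi> * 1 \<in> (*) t ` valring" unfolding \<pi>(1) using is_subring_closed(1)[OF valring_subring] by blast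
    then have pK: "\<pi> \<in> K" using principal_iff[OF t(1,2)] by auto
    have "t * 1 \<in> (*) \<pi> ` valring" unfolding \<pi>(1)[symmetric] using is_subring_closed(1)[OF valring_subring] by blast
    then have p0: "\<pi> \<noteq> 0" using t by auto
    have "v \<pi> = 1" using cancel[OF t(1) pK t(2) p0 \<pi>(1)] t by simp
    moreover have "v z = v (\<pi> powi k)" using cancel[OF z(1) _ z(2) _ \<pi>(2)] K_powi[OF pK] p0 by auto
    ultimately show "k = v z" using val_powi[OF pK p0] by simp
  qed
qed

end

subsection \<open>The class group of a ring cut out by valuations\<close>

text \<open>
  Approximation holds automatically here: a prescribed finite divisor becomes principal after adding
  one prime of the inverse class away from the prescribed places, and there are infinitely many of these.
\<close>

locale krull_class = comm_group G for G :: "('g, 'h) monoid_scheme" (structure) +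
  fixes A K :: "'f::field set" and W :: "('f \<Rightarrow> int) set" and h :: "(('f \<Rightarrow> int) \<Rightarrow>\<^sub>0 int) \<Rightarrow> 'g"
  assumes K: "is_subring K" and K_inverse: "x \<in> K \<Longrightarrow> inverse x \<in> K"
    and val: "v \<in> W \<Longrightarrow> valuation_on K v"
    and fin: "z \<in> K \<Longrightarrow> z \<noteq> 0 \<Longrightarrow> finite {v \<in> W. v z \<noteq> 0}"
    and A_eq: "A = {z \<in> K. z = 0 \<or> (\<forall>v\<in>W. 0 \<le> v z)}"
    and h: "h \<in> hom (free_Abelian_group W) G"
    and h_eq_one_iff: "Poly_Mapping.keys D \<subseteq> W \<Longrightarrow>
       h D = \<one> \<longleftrightarrow> (\<exists>z\<in>K - {0}. \<forall>v\<in>W. Poly_Mapping.lookup D v = v z)"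
    and fibres: "g \<in> carrier G \<Longrightarrow> infinite {v \<in> W. h (frag_of v) = g}"
begin

lemma h_closed: "Poly_Mapping.keys D \<subseteq> W \<Longrightarrow> h D \<in> carrier G"
  using h by (auto simp: hom_def)

lemma h_add: "Poly_Mapping.keys D \<subseteq> W \<Longrightarrow> Poly_Mapping.keys E \<subseteq> W \<Longrightarrow> h (D + E) = h D \<otimes> h E"
  using hom_mult[OF h, of D E] by simp

sublocale krull_family A K W
proof
  fix v T k N assume v: "v \<in> W" and T: "finite T" "T \<subseteq> W - {v}"
  define D where "D = frag_cmul k (frag_of v) + (\<Sum>u\<in>T. frag_cmul N (frag_of u))"
  have lD: "Poly_Mapping.lookup D w = (if w = v then k else 0) + (if w \<in> T then N else 0)" for w
  proof -
    have "(\<Sum>u\<in>T. Poly_Mapping.lookup (frag_cmul N (frag_of u)) w) = (\<Sum>u\<in>T. if u = w then N else 0)"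
      by (intro sum.cong) auto
    then show ?thesis using T by (simp add: D_def lookup_add lookup_sum sum.delta)
  qed
  have D: "Poly_Mapping.keys D \<subseteq> W"
  proof
    fix w assume "w \<in> Poly_Mapping.keys D"
    then have "w = v \<or> w \<in> T" using lD[of w] by (metis add.right_neutral in_keys_iff)
    then show "w \<in> W" using v T(2) by blast
  qed
  have "infinite ({u \<in> W. h (frag_of u) = inv (h D)} - insert v T)"
    using fibres[of "inv (h D)"] h_closed[OF D] T by auto
  then obtain u0 where u0: "u0 \<in> W" "h (frag_of u0) = inv (h D)" "u0 \<noteq> v" "u0 \<notin> T"
    using infinite_imp_nonempty by blast
  have D': "Poly_Mapping.keys (D + frag_of u0) \<subseteq> W"
    using D u0(1) keys_add[of D "frag_of u0"] by auto
  have "h (D + frag_of u0) = \<one>" using h_add[OF D, of "frag_of u0"] u0 h_closed[OF D] by simp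
  then obtain z where z: "z \<in> K - {0}" "\<forall>v\<in>W. Poly_Mapping.lookup (D + frag_of u0) v = v z"
    using h_eq_one_iff[OF D'] by auto
  have e: "w z = (if w = v then k else 0) + (if w \<in> T then N else 0) + (if w = u0 then 1 else 0)" if "w \<in> W" for w
    using z(2)[rule_format, OF that] lD[of w] by (auto simp: lookup_add)
  show "\<exists>z\<in>K - {0}. v z = k \<and> (\<forall>u\<in>T. N \<le> u z) \<and> (\<forall>u\<in>W - {v} - T. 0 \<le> u z)"
  proof (intro bexI[OF _ z(1)] conjI ballI)
    show "v z = k" using e[OF v] T u0(3) by auto
    show "N \<le> u z" if "u \<in> T" for u
    proof -
      have "u \<in> W" "u \<noteq> v" "u \<noteq> u0" using that T(2) u0(4) by auto
      then show ?thesis using e[of u] that by simp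
    qed
    show "0 \<le> u z" if "u \<in> W - {v} - T" for u
    proof -
      have "u \<in> W" "u \<noteq> v" "u \<notin> T" using that by auto
      then show ?thesis using e[of u] by simp
    qed
  qed
qed (use K K_inverse val fin A_eq in auto)

definition val_of :: "'f set \<Rightarrow> 'f \<Rightarrow> int" where "val_of = inv_into W center"

lemma val_of_center [simp]: "v \<in> W \<Longrightarrow> val_of (center v) = v"
  unfolding val_of_def by (rule inv_into_f_f[OF inj_on_center])

text \<open>The class group is formed with divisors on height-one primes, whereas \<open>h\<close>
  is defined on divisors on valuations; this renames along the bijection
  \<open>center\<close>.\<close>

definition relabel :: "('f set \<Rightarrow>\<^sub>0 int) \<Rightarrow> ('f \<Rightarrow> int) \<Rightarrow>\<^sub>0 int" where
  "relabel = frag_extend (frag_of \<circ> val_of)"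

lemma relabel_diff: "relabel (D - E) = relabel D - relabel E"
  unfolding relabel_def by (rule frag_extend_diff)

lemma relabel_add: "relabel (D + E) = relabel D + relabel E"
  unfolding relabel_def by (rule frag_extend_add)

lemma relabel_keys: "Poly_Mapping.keys D \<subseteq> center ` W \<Longrightarrow> Poly_Mapping.keys (relabel D) \<subseteq> W"
  using keys_frag_extend[of "frag_of \<circ> val_of" D] by (fastforce simp: relabel_def)

lemma lookup_relabel:
  assumes "Poly_Mapping.keys D \<subseteq> center ` W" "v \<in> W"
  shows "Poly_Mapping.lookup (relabel D) v = Poly_Mapping.lookup D (center v)"
proof (rule free_Abelian_group_induct[OF assms(1)])
  show "Poly_Mapping.lookup (relabel 0) v = Poly_Mapping.lookup 0 (center v)" by (simp add: relabel_def)
next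
  fix P assume "P \<in> center ` W"
  then obtain u where u: "u \<in> W" "P = center u" by auto
  then show "Poly_Mapping.lookup (relabel (frag_of P)) v = Poly_Mapping.lookup (frag_of P) (center v)"
    using assms(2) inj_onD[OF inj_on_center, of u v] by (auto simp: relabel_def)
qed (simp add: relabel_diff lookup_minus)

abbreviation "cl \<equiv> \<lambda>D. h (relabel D)"

lemma cl_hom: "cl \<in> hom (free_Abelian_group (center ` W)) G"
  by (intro homI) (auto simp: h_closed relabel_keys relabel_add h_add)

lemma group_hom_cl: "group_hom (free_Abelian_group (center ` W)) G cl"
  using cl_hom by (intro group_hom.intro group_hom_axioms.intro) auto

lemma kernel_cl: "kernel (free_Abelian_group (center ` W)) G cl = principal_divisors A"
proof -
  have "cl D = \<one> \<longleftrightarrow> (\<exists>z\<in>K - {0}. \<forall>P\<in>center ` W. Poly_Mapping.lookup D P = prime_valuation A P z)"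
    if D: "Poly_Mapping.keys D \<subseteq> center ` W" for D
  proof -
    have "cl D = \<one> \<longleftrightarrow> (\<exists>z\<in>K - {0}. \<forall>v\<in>W. Poly_Mapping.lookup (relabel D) v = v z)"
      by (rule h_eq_one_iff[OF relabel_keys[OF D]])
    also have "\<dots> \<longleftrightarrow> (\<exists>z\<in>K - {0}. \<forall>v\<in>W. Poly_Mapping.lookup D (center v) = prime_valuation A (center v) z)"
      by (intro bex_cong ball_cong HOL.refl) (simp add: lookup_relabel[OF D] prime_valuation_center)
    finally show ?thesis by simp
  qed
  then show ?thesis
    unfolding kernel_def principal_divisors_def height_one_primes_A quotient_field_A
    by (intro Collect_cong conj_cong HOL.refl) simp
qed

lemma cl_surj: "cl ` carrier (free_Abelian_group (center ` W)) = carrier G"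
proof
  show "cl ` carrier (free_Abelian_group (center ` W)) \<subseteq> carrier G"
    using cl_hom by (auto simp: hom_def)
  show "carrier G \<subseteq> cl ` carrier (free_Abelian_group (center ` W))"
  proof
    fix g assume "g \<in> carrier G"
    then obtain v where v: "v \<in> W" "h (frag_of v) = g"
      using infinite_imp_nonempty[OF fibres] by blast
    then have "cl (frag_of (center v)) = g" by (simp add: relabel_def)
    then show "g \<in> cl ` carrier (free_Abelian_group (center ` W))"
      using v by (intro image_eqI[of _ _ "frag_of (center v)"]) auto
  qed
qed

theorem class_group_iso: "class_group A \<cong> G"
proof -
  have "free_Abelian_group (center ` W) Mod kernel (free_Abelian_group (center ` W)) G cl \<cong> G"
    by (rule group_hom.FactGroup_iso[OF group_hom_cl cl_surj])
  then show ?thesis unfolding kernel_cl class_group_def height_one_primes_A .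
qed

text \<open>A class is a coset of the kernel of \<open>cl\<close>, hence a fibre of
  \<open>cl\<close>; on single primes this is a fibre of \<open>h\<close>.\<close>

theorem prime_divisors_in_class_eq:
  assumes "c \<in> carrier (class_group A)"
  shows "\<exists>g\<in>carrier G. prime_divisors_in_class A c = center ` {v \<in> W. h (frag_of v) = g}"
proof -
  let ?F = "free_Abelian_group (center ` W)"
  interpret cl: group_hom ?F G cl by (rule group_hom_cl)
  obtain D where D: "D \<in> carrier ?F" "c = principal_divisors A #>\<^bsub>?F\<^esub> D"
    using assms by (auto simp: class_group_def carrier_FactGroup height_one_primes_A)
  have "frag_of (center v) \<in> c \<longleftrightarrow> h (frag_of v) = cl D" if v: "v \<in> W" for v
  proof -
    have vc: "frag_of (center v) \<in> carrier ?F" using v by simp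
    have e: "cl (frag_of (center v)) = h (frag_of v)" using v by (simp add: relabel_def)
    have "frag_of (center v) \<in> c \<longleftrightarrow> (\<exists>E\<in>principal_divisors A. frag_of (center v) = E + D)"
      unfolding D(2) r_coset_def by auto
    also have "\<dots> \<longleftrightarrow> frag_of (center v) - D \<in> principal_divisors A"
      by (auto simp: algebra_simps intro!: bexI[of _ "frag_of (center v) - D"])
    also have "\<dots> \<longleftrightarrow> cl (frag_of (center v) - D) = \<one>"
      using keys_diff[of "frag_of (center v)" D] D(1) v
      unfolding kernel_cl[symmetric] kernel_def by auto
    also have "cl (frag_of (center v) - D) = cl (frag_of (center v)) \<otimes> inv (cl D)"
      using cl.hom_mult[OF vc cl.G.inv_closed[OF D(1)]] cl.hom_inv[OF D(1)] D(1) by simp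
    also have "\<dots> = \<one> \<longleftrightarrow> h (frag_of v) = cl D"
    proof -
      have "h (frag_of v) \<in> carrier G" using v by (intro h_closed) simp
      then show ?thesis unfolding e using cl.hom_closed[OF D(1)] by (metis inv_equality inv_inv r_inv inv_closed)
    qed
    finally show ?thesis .
  qed
  then have "prime_divisors_in_class A c = center ` {v \<in> W. h (frag_of v) = cl D}"
    unfolding prime_divisors_in_class_def height_one_primes_A by blast
  then show ?thesis using cl.hom_closed[OF D(1)] by blast
qed

theorem prime_divisors_in_class_eqpoll:
  assumes "c \<in> carrier (class_group A)" "\<And>g. g \<in> carrier G \<Longrightarrow> {v \<in> W. h (frag_of v) = g} \<approx> U"
  shows "prime_divisors_in_class A c \<approx> U"
proof -
  obtain g where g: "g \<in> carrier G" "prime_divisors_in_class A c = center ` {v \<in> W. h (frag_of v) = g}"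
    using prime_divisors_in_class_eq[OF assms(1)] by auto
  have "inj_on center {v \<in> W. h (frag_of v) = g}" by (rule inj_on_subset[OF inj_on_center]) auto
  then show ?thesis unfolding g(2) by (rule eqpoll_trans[OF inj_on_image_eqpoll_self assms(2)[OF g(1)]])
qed

end

subsection \<open>The valuation of a prime element\<close>

text \<open>The \<open>p\<close>-adic valuation: \<open>a / p \<notin> P\<close> says that
  \<open>p\<close> does not divide \<open>a\<close>. The description determines a value only for
  nonzero \<open>z\<close>.\<close>

definition pval :: "'f::field set \<Rightarrow> 'f \<Rightarrow> 'f \<Rightarrow> int" where
  "pval P p z = (THE k. \<exists>a\<in>P. \<exists>b\<in>P. a / p \<notin> P \<and> b / p \<notin> P \<and> z = p powi k * a / b)"

lemma pval_eqI:
  assumes P: "is_subring P" and p: "prime_on P p" and ab: "a \<in> P" "b \<in> P" "a / p \<notin> P" "b / p \<notin> P"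
    and z: "z = p powi k * a / b"
  shows "pval P p z = k"
  unfolding pval_def
proof (rule the_equality)
  show "\<exists>a\<in>P. \<exists>b\<in>P. a / p \<notin> P \<and> b / p \<notin> P \<and> z = p powi k * a / b" using ab z by blast
  have nz: "x \<noteq> 0" if "x / p \<notin> P" for x using that is_subring_closed(2)[OF P] by auto
  \<comment> \<open>By symmetry one inequality is enough: if \<open>k > l\<close>, cancelling
    \<open>p powi l\<close> leaves \<open>p\<close> dividing \<open>a' * b\<close>.\<close>
  have le: "k \<le> l" if "a \<in> P" "b \<in> P" "a / p \<notin> P" "b / p \<notin> P" "a' \<in> P" "b' \<in> P" "a' / p \<notin> P" "b' / p \<notin> P"
    "p powi k * a / b = p powi l * a' / b'" for a b a' b' k l
  proof (rule ccontr)
    assume "\<not> k \<le> l"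
    define n where "n = nat (k - l - 1)"
    have kn: "k = l + 1 + int n" using \<open>\<not> k \<le> l\<close> by (simp add: n_def)
    have pl: "p powi l \<noteq> 0" using prime_onD(2)[OF p] by simp
    have e: "p powi k = p powi l * (p * p ^ n)"
      using prime_onD(2)[OF p] unfolding kn by (simp add: power_int_add)
    have "p powi l * (p * p ^ n) * a * b' = p powi l * a' * b"
      using that(9) nz[OF that(4)] nz[OF that(8)] unfolding e by (simp add: field_simps)
    then have "p powi l * (p * p ^ n * a * b') = p powi l * (a' * b)" by (simp add: mult.assoc)
    then have "p * p ^ n * a * b' = a' * b" using mult_left_cancel[OF pl] by blast
    then have "a' * b / p = p ^ n * a * b'" using prime_onD(2)[OF p] by (simp add: field_simps)
    moreover have "p ^ n * a * b' \<in> P"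
      by (intro is_subring_closed(4)[OF P] is_subring_closed(7)[OF P] prime_onD(1)[OF p] that)
    ultimately show False using prime_onD(4)[OF p, of a' b] that by auto
  qed
  fix l assume "\<exists>a\<in>P. \<exists>b\<in>P. a / p \<notin> P \<and> b / p \<notin> P \<and> z = p powi l * a / b"
  then obtain a' b' where 1: "a' \<in> P" "b' \<in> P" "a' / p \<notin> P" "b' / p \<notin> P" "z = p powi l * a' / b'" by blast
  have kl: "p powi k * a / b = p powi l * a' / b'" using z 1(5) by metis
  show "l = k" using le[OF ab 1(1-4) kl] le[OF 1(1-4) ab kl[symmetric]] by simp
qed

text \<open>A prime factor divisible by \<open>p\<close> is associated to \<open>p\<close> and
  raises the exponent by one; any other factor is absorbed into \<open>a\<close>.\<close>

lemma split_prime_power: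
  assumes F: "factorial_on P" and p: "prime_on P p" and x: "x \<in> P" "x \<noteq> 0"
  shows "\<exists>n a. a \<in> P \<and> a / p \<notin> P \<and> x = p ^ n * a"
proof -
  have P: "is_subring P" using F factorial_onD by auto
  note pD = prime_onD[OF p]
  show ?thesis using F x
  proof (induction x rule: factorial_induct)
    case (unit u)
    then show ?case using prime_not_dvd_unit[OF P p unit] unit_onD[OF unit] by (intro exI[of _ 0] exI[of _ u]) auto
  next
    case (prime q x)
    note qD = prime_onD[OF prime(1)]
    obtain n a where a: "a \<in> P" "a / p \<notin> P" "x = p ^ n * a" using prime by auto
    show ?case
    proof (cases "q / p \<in> P")
      case True
      have w: "unit_on P (q / p)" by (rule prime_dvd_prime[OF P prime(1) p True])
      have "a * (q / p) \<in> P" using True a is_subring_closed(4)[OF P] by blast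
      moreover have "a * (q / p) / p \<notin> P"
        using pD(4)[OF a(1) True] a(2) prime_not_dvd_unit[OF P p w] by auto
      moreover have "q * x = p ^ Suc n * (a * (q / p))" using pD(2) a(3) by simp
      ultimately show ?thesis by blast
    next
      case False
      have "q * a \<in> P" using qD(1) a is_subring_closed(4)[OF P] by blast
      moreover have "q * a / p \<notin> P" using pD(4)[OF qD(1) a(1)] a(2) False by auto
      moreover have "q * x = p ^ n * (q * a)" using a(3) by simp
      ultimately show ?thesis by blast
    qed
  qed
qed

locale factorial_subring =
  fixes P :: "'f::field set"
  assumes fact: "factorial_on P"
begin

lemma P: "is_subring P" using fact factorial_onD by auto

lemmas P_closed = is_subring_closed[OF P]

abbreviation "Q \<equiv> quotient_field P"

lemma Q_iff: "z \<in> Q \<longleftrightarrow> (\<exists>a\<in>P. \<exists>b\<in>P - {0}. z = a / b)"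
  by (auto simp: quotient_field_def fractions_def)

lemma PQ: "P \<subseteq> Q"
proof
  fix x assume "x \<in> P"
  then show "x \<in> Q" using P_closed(1) unfolding Q_iff by (intro bexI[of _ x] bexI[of _ 1]) auto
qed

lemma Q_inverse: "x \<in> Q \<Longrightarrow> inverse x \<in> Q"
proof (cases "x = 0")
  case True
  then show ?thesis using PQ P_closed(2) by auto
next
  case False
  assume "x \<in> Q"
  then obtain a b where ab: "a \<in> P" "b \<in> P" "b \<noteq> 0" "x = a / b" by (auto simp: Q_iff)
  then have "a \<noteq> 0" "inverse x = b / a" using False by auto
  then show ?thesis using ab unfolding Q_iff by blast
qed

lemma Q: "is_subring Q"
  unfolding is_subring_def
proof (intro conjI ballI)
  show "1 \<in> Q" using PQ P_closed(1) by auto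
  fix x y assume "x \<in> Q" "y \<in> Q"
  then obtain a b c d where *: "a \<in> P" "b \<in> P" "b \<noteq> 0" "x = a / b" "c \<in> P" "d \<in> P" "d \<noteq> 0" "y = c / d"
    by (auto simp: Q_iff)
  have bd: "b * d \<in> P - {0}" "a * d \<in> P" "b * c \<in> P" "a * c \<in> P" using * P_closed(4) by auto
  have "x - y = (a * d - b * c) / (b * d)" using * by (simp add: field_simps)
  moreover have "a * d - b * c \<in> P" using bd P_closed(3) by blast
  ultimately show "x - y \<in> Q" using bd(1) unfolding Q_iff by blast
  have "x * y = (a * c) / (b * d)" using * by simp
  then show "x * y \<in> Q" using bd unfolding Q_iff by blast
qed

lemma pval_exists:
  assumes p: "prime_on P p" and z: "z \<in> Q" "z \<noteq> 0"
  shows "\<exists>a\<in>P. \<exists>b\<in>P. a / p \<notin> P \<and> b / p \<notin> P \<and> z = p powi pval P p z * a / b"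
proof -
  obtain x y where xy: "x \<in> P" "y \<in> P" "y \<noteq> 0" "z = x / y" using z by (auto simp: Q_iff)
  then have "x \<noteq> 0" using z by auto
  obtain n a where a: "a \<in> P" "a / p \<notin> P" "x = p ^ n * a"
    using split_prime_power[OF fact p xy(1) \<open>x \<noteq> 0\<close>] by auto
  obtain m b where b: "b \<in> P" "b / p \<notin> P" "y = p ^ m * b"
    using split_prime_power[OF fact p xy(2,3)] by auto
  have "p powi (int n - int m) = p ^ n / p ^ m"
    using prime_onD(2)[OF p] by (simp add: power_int_diff)
  then have e: "z = p powi (int n - int m) * a / b" using xy a b by simp
  then have "pval P p z = int n - int m" by (rule pval_eqI[OF P p a(1) b(1) a(2) b(2)])
  then show ?thesis using a b e by metis
qed

lemma pval_nonneg:
  assumes p: "prime_on P p" and z: "z \<in> P" "z \<noteq> 0"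
  shows "0 \<le> pval P p z"
proof -
  obtain n a where a: "a \<in> P" "a / p \<notin> P" "z = p ^ n * a"
    using split_prime_power[OF fact p z] by auto
  have "1 / p \<notin> P" using prime_onD(3)[OF p] by (simp add: inverse_eq_divide)
  then have "pval P p z = int n" using a P_closed(1) by (intro pval_eqI[OF P p, of a 1]) auto
  then show ?thesis by simp
qed

lemma not_dvd_nonzero: "a / p \<notin> P \<Longrightarrow> a \<noteq> 0"
  using P_closed(2) by auto

lemma pval_zero:
  assumes p: "prime_on P p" and z: "z \<in> P" "z / p \<notin> P"
  shows "pval P p z = 0"
proof (rule pval_eqI[OF P p z(1) P_closed(1) z(2)])
  show "1 / p \<notin> P" using prime_onD(3)[OF p] by (simp add: inverse_eq_divide)
qed simp

lemma pval_self:
  assumes p: "prime_on P p"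
  shows "pval P p p = 1"
proof (rule pval_eqI[OF P p P_closed(1) P_closed(1)])
  show "1 / p \<notin> P" "1 / p \<notin> P" using prime_onD(3)[OF p] by (simp_all add: inverse_eq_divide)
qed simp

lemma pval_mult:
  assumes p: "prime_on P p" and x: "x \<in> Q" "x \<noteq> 0" and y: "y \<in> Q" "y \<noteq> 0"
  shows "pval P p (x * y) = pval P p x + pval P p y"
proof -
  obtain a b where ab: "a \<in> P" "b \<in> P" "a / p \<notin> P" "b / p \<notin> P" "x = p powi pval P p x * a / b"
    using pval_exists[OF p x] by blast
  obtain c d where cd: "c \<in> P" "d \<in> P" "c / p \<notin> P" "d / p \<notin> P" "y = p powi pval P p y * c / d"
    using pval_exists[OF p y] by blast
  have "x * y = (p powi pval P p x * a / b) * (p powi pval P p y * c / d)"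
    by (rule arg_cong2[where f = "(*)", OF ab(5) cd(5)])
  also have "\<dots> = p powi (pval P p x + pval P p y) * (a * c) / (b * d)"
    using prime_onD(2)[OF p] by (simp add: power_int_add field_simps)
  finally show ?thesis
    using ab cd P_closed(4) prime_onD(4)[OF p]
    by (intro pval_eqI[OF P p, of "a * c" "b * d"]) blast+
qed

lemma pval_valuation:
  assumes p: "prime_on P p"
  shows "valuation_on Q (pval P p)"
  unfolding valuation_on_def
proof (intro ballI conjI impI)
  fix x y assume xy: "x \<in> Q - {0}" "y \<in> Q - {0}"
  then show "pval P p (x * y) = pval P p x + pval P p y" using pval_mult[OF p] by auto
  have *: "pval P p x \<le> pval P p (x + y)" if xy: "x \<in> Q" "x \<noteq> 0" "y \<in> Q" "y \<noteq> 0" "x + y \<noteq> 0" "pval P p x \<le> pval P p y" for x y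
  proof -
    obtain a b where ab: "a \<in> P" "b \<in> P" "a / p \<notin> P" "b / p \<notin> P" "x = p powi pval P p x * a / b"
      using pval_exists[OF p xy(1,2)] by blast
    obtain c d where cd: "c \<in> P" "d \<in> P" "c / p \<notin> P" "d / p \<notin> P" "y = p powi pval P p y * c / d"
      using pval_exists[OF p xy(3,4)] by blast
    define n where "n = nat (pval P p y - pval P p x)"
    have n: "pval P p y = pval P p x + int n" using xy by (simp add: n_def)
    note p0 = prime_onD(2)[OF p]
    have bd: "b \<noteq> 0" "d \<noteq> 0" using ab cd not_dvd_nonzero by blast+
    define k where "k = pval P p x"
    \<comment> \<open>After extracting \<open>p powi k\<close> the numerator lies in
      \<open>P\<close> and the denominator \<open>b * d\<close> is prime to \<open>p\<close>, so the
      remaining value is nonnegative.\<close>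
    define s where "s = a * d + p ^ n * (c * b)"
    have s: "s \<in> P" unfolding s_def
      by (intro P_closed(6) P_closed(4) P_closed(7) ab cd prime_onD(1)[OF p])
    have bdP: "b * d \<in> P" using ab cd P_closed(4) by blast
    have "x + y = p powi k * a / b + p powi (k + int n) * c / d"
      using ab(5) cd(5) n k_def by metis
    also have "\<dots> = p powi k * (s / (b * d))"
      using p0 bd by (simp add: power_int_add s_def field_simps)
    finally have e: "x + y = p powi k * (s / (b * d))" .
    have sQ: "s / (b * d) \<in> Q" "s / (b * d) \<noteq> 0"
    proof -
      show "s / (b * d) \<in> Q" using s bdP bd unfolding Q_iff
        by (intro bexI[of _ s] bexI[of _ "b * d"]) auto
      show "s / (b * d) \<noteq> 0" using xy(5) e by auto
    qed
    have "p powi k * (1 / 1) \<in> Q"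
    proof -
      have "p powi k \<in> Q" using PQ prime_onD(1)[OF p] is_subring_closed(7)[OF Q] Q_inverse
        by (auto simp: power_int_def)
      then show ?thesis by simp
    qed
    then have pk: "p powi k \<in> Q" "p powi k \<noteq> 0" using p0 by auto
    have "pval P p (x + y) = pval P p (p powi k) + pval P p (s / (b * d))"
      unfolding e by (rule pval_mult[OF p pk sQ])
    moreover have "pval P p (p powi k) = k"
      using prime_onD(3)[OF p] P_closed(1) by (intro pval_eqI[OF P p, of 1 1]) (auto simp: inverse_eq_divide)
    moreover have "0 \<le> pval P p (s / (b * d))"
    proof -
      have "pval P p (b * d) = 0" using pval_zero[OF p bdP] prime_onD(4)[OF p] ab cd by blast
      moreover have "pval P p s = pval P p (s / (b * d)) + pval P p (b * d)"
        using pval_mult[OF p sQ, of "b * d"] bdP PQ bd by auto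
      ultimately show ?thesis using pval_nonneg[OF p s] sQ by auto
    qed
    ultimately show ?thesis using k_def by simp
  qed
  assume "x + y \<noteq> 0"
  then show "min (pval P p x) (pval P p y) \<le> pval P p (x + y)"
    using *[of x y] *[of y x] xy by (cases "pval P p x \<le> pval P p y") (auto simp: add.commute)
qed

lemma pval_pos_iff:
  assumes p: "prime_on P p" and z: "z \<in> P" "z \<noteq> 0"
  shows "0 < pval P p z \<longleftrightarrow> z / p \<in> P"
proof
  show "0 < pval P p z \<Longrightarrow> z / p \<in> P" using pval_zero[OF p z(1)] by fastforce
  assume zp: "z / p \<in> P"
  note pD = prime_onD[OF p]
  have "pval P p (p * (z / p)) = pval P p p + pval P p (z / p)"
    using zp PQ pD z by (intro pval_mult[OF p]) auto
  then show "0 < pval P p z" using pval_self[OF p] pval_nonneg[OF p zp] pD z by simp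
qed

text \<open>The places of the cluster algebra will be these functions rather than prime elements, so
  associated primes have to give one and the same place.\<close>

lemma pval_associated:
  assumes p: "prime_on P p" and q: "prime_on P q" and pq: "p / q \<in> P"
  shows "pval P p = pval P q"
proof
  fix z
  have u: "unit_on P (p / q)" by (rule prime_dvd_prime[OF P p q pq])
  define w where "w = p / q"
  have w: "unit_on P w" "p = w * q" using u prime_onD(2)[OF q] by (auto simp: w_def)
  note wD = unit_onD[OF w(1)]
  have dvd: "a / p \<in> P \<longleftrightarrow> a / q \<in> P" for a
  proof
    assume "a / p \<in> P"
    then have "w * (a / p) \<in> P" using wD(1) P_closed(4) by blast
    then show "a / q \<in> P" using w wD(2) by simp
  next
    assume "a / q \<in> P"
    then have "inverse w * (a / q) \<in> P" using wD(3) P_closed(4) by blast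
    then show "a / p \<in> P" using w by (simp add: divide_inverse mult_ac)
  qed
  have wk: "w powi k \<in> P \<and> inverse w powi k \<in> P" for k
    using wD P_closed(7) by (auto simp: power_int_def)
  have move: "\<exists>a'\<in>P. \<exists>b'\<in>P. a' / q' \<notin> P \<and> b' / q' \<notin> P \<and> z = q' powi k * a' / b'"
    if hyp: "\<exists>a\<in>P. \<exists>b\<in>P. a / p' \<notin> P \<and> b / p' \<notin> P \<and> z = p' powi k * a / b"
      "p' = w' * q'" "unit_on P w'" "\<And>k. w' powi k \<in> P" "\<And>a. a / p' \<in> P \<longleftrightarrow> a / q' \<in> P" "prime_on P q'" for p' q' w' k
  proof -
    obtain a b where ab: "a \<in> P" "b \<in> P" "a / p' \<notin> P" "b / p' \<notin> P" "z = p' powi k * a / b" using hyp(1) by blast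
    have "unit_on P (w' powi k)" using hyp(4)[of k] hyp(4)[of "-k"] unit_onD(2)[OF hyp(3)]
      by (auto simp: unit_on_def power_int_minus)
    then have "w' powi k / q' \<notin> P" by (rule prime_not_dvd_unit[OF P hyp(6)])
    moreover have "a / q' \<notin> P" "b / q' \<notin> P" using ab hyp(5) by auto
    ultimately have "w' powi k * a / q' \<notin> P" using prime_onD(4)[OF hyp(6) hyp(4)[of k] ab(1)] by blast
    moreover have "w' powi k * a \<in> P" using hyp(4) ab(1) P_closed(4) by blast
    moreover have "z = q' powi k * (w' powi k * a) / b"
      unfolding ab(5) hyp(2) by (simp add: power_int_mult_distrib mult_ac)
    ultimately show ?thesis using ab(2) \<open>b / q' \<notin> P\<close> by blast
  qed
  have qw: "q = inverse w * p" using w wD(2) by simp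
  have "(\<exists>a\<in>P. \<exists>b\<in>P. a / p \<notin> P \<and> b / p \<notin> P \<and> z = p powi k * a / b) \<longleftrightarrow>
     (\<exists>a\<in>P. \<exists>b\<in>P. a / q \<notin> P \<and> b / q \<notin> P \<and> z = q powi k * a / b)" for k
    using move[OF _ w(2,1) _ dvd q, of k] move[OF _ qw unit_on_inverse[OF w(1)] _ dvd[symmetric] p, of k] wk by blast
  then show "pval P p z = pval P q z" unfolding pval_def by simp
qed

lemma pval_finite:
  assumes z: "z \<in> Q" "z \<noteq> 0"
  shows "finite {v \<in> pval P ` {p. prime_on P p}. v z \<noteq> 0}"
proof -
  have fin: "finite {v \<in> pval P ` {p. prime_on P p}. v a \<noteq> 0}" if a: "a \<in> P" "a \<noteq> 0" for a
  proof -
    obtain u ps where *: "unit_on P u" "\<forall>p\<in>set ps. prime_on P p" "a = u * prod_list ps"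
      using factorial_onD(2)[OF fact a] unfolding has_factorization_def by blast
    have "{v \<in> pval P ` {p. prime_on P p}. v a \<noteq> 0} \<subseteq> pval P ` set ps"
    proof safe
      fix q assume q: "prime_on P q" "pval P q a \<noteq> 0"
      then have "a / q \<in> P" using pval_zero[OF q(1) a(1)] by blast
      moreover have psP: "set ps \<subseteq> P" using *(2) prime_onD(1) by auto
      ultimately have "u / q \<in> P \<or> prod_list ps / q \<in> P"
        using prime_onD(4)[OF q(1) unit_onD(1)[OF *(1)] is_subring_prod_list[OF P psP]] *(3) by blast
      then have "prod_list ps / q \<in> P" using prime_not_dvd_unit[OF P q(1) *(1)] by blast
      then obtain p where p: "p \<in> set ps" "p / q \<in> P" using prime_on_dvd_prod_list[OF P q(1) psP] by blast
      then show "pval P q \<in> pval P ` set ps" using pval_associated[of p q] *(2) q(1) by (metis image_eqI)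
    qed
    then show ?thesis using finite_subset by blast
  qed
  obtain a b where ab: "a \<in> P" "b \<in> P" "b \<noteq> 0" "z = a / b" using z by (auto simp: Q_iff)
  then have a0: "a \<noteq> 0" using z by auto
  have "{v \<in> pval P ` {p. prime_on P p}. v z \<noteq> 0} \<subseteq>
    {v \<in> pval P ` {p. prime_on P p}. v a \<noteq> 0} \<union> {v \<in> pval P ` {p. prime_on P p}. v b \<noteq> 0}"
  proof safe
    fix p assume p: "prime_on P p" "pval P p z \<noteq> 0" "pval P p b = 0" "pval P p a = 0"
    have "pval P p (z * b) = pval P p z + pval P p b" using z ab PQ by (intro pval_mult[OF p(1)]) auto
    then show False using p ab by auto
  qed auto
  then show ?thesis using fin[OF ab(1) a0] fin[OF ab(2,3)] by (meson finite_UnI finite_subset)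
qed

text \<open>This describes the localization at \<open>\<mu>\<close>: each prime factor of the
  denominator either cancels against the numerator or divides \<open>\<mu>\<close>, and then one
  more power of \<open>\<mu>\<close> removes it.\<close>

lemma clear_denominators:
  assumes \<mu>: "\<mu> \<in> P" "\<mu> \<noteq> 0" and z: "z \<in> Q"
    and nn: "\<And>p. prime_on P p \<Longrightarrow> \<mu> / p \<notin> P \<Longrightarrow> z \<noteq> 0 \<Longrightarrow> 0 \<le> pval P p z"
  shows "\<exists>k. z * \<mu> ^ k \<in> P"
proof -
  obtain a b where ab: "a \<in> P" "b \<in> P" "b \<noteq> 0" "z = a / b" using z by (auto simp: Q_iff)
  have "\<exists>k. a / b * \<mu> ^ k \<in> P" using fact ab(2,3) ab(1) nn[unfolded ab(4)]
  proof (induction b arbitrary: a rule: factorial_induct)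
    case (unit u)
    then have "a * inverse u \<in> P" using P_closed(4) unit_onD(3) by blast
    then show ?case by (intro exI[of _ 0]) (simp add: divide_inverse)
  next
    case (prime p b)
    note pD = prime_onD[OF prime(1)]
    show ?case
    proof (cases "a = 0")
      case True
      then show ?thesis using P_closed(2) by auto
    next
      case a0: False
      have abQ: "a / (p * b) \<in> Q" using prime pD P_closed(4) unfolding Q_iff by (metis DiffI mult_eq_0_iff singletonD)
      show ?thesis
      proof (cases "a / p \<in> P")
        case True
        have "\<exists>k. (a / p) / b * \<mu> ^ k \<in> P"
          using prime.prems(2) by (intro prime.IH[OF True]) (auto simp: mult.commute)
        then show ?thesis by (simp add: mult.commute)
      next
        case False
        \<comment> \<open>Here \<open>p\<close> does not divide \<open>a\<close>; if it did not
          divide \<open>\<mu>\<close> either, the quotient would have negative value at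
          \<open>p\<close>, against the hypothesis.\<close>
        have mp: "\<mu> / p \<in> P"
        proof (rule ccontr)
          assume "\<mu> / p \<notin> P"
          then have "0 \<le> pval P p (a / (p * b))" using prime.prems(2)[OF prime(1)] a0 pD prime(3) by auto
          moreover have "pval P p (a / (p * b) * (p * b)) = pval P p (a / (p * b)) + pval P p (p * b)"
            using abQ PQ pD prime P_closed(4) a0 by (intro pval_mult[OF prime(1)]) auto
          moreover have "0 < pval P p (p * b)"
            using pval_pos_iff[OF prime(1), of "p * b"] prime(2,3) pD P_closed(4) by auto
          moreover have "pval P p a = 0" by (rule pval_zero[OF prime(1) prime.prems(1) False])
          ultimately show False using pD prime(3) by auto
        qed
        have ex: "\<exists>k. a / b * \<mu> ^ k \<in> P"
        proof (rule prime.IH[OF prime.prems(1)])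
          fix q assume q: "prime_on P q" "\<mu> / q \<notin> P" "a / b \<noteq> 0"
          have "pval P q (a / (p * b) * p) = pval P q (a / (p * b)) + pval P q p"
            using abQ PQ pD prime a0 by (intro pval_mult[OF q(1)]) auto
          moreover have "0 \<le> pval P q (a / (p * b))" using prime.prems(2)[OF q(1,2)] a0 pD prime(3) by auto
          moreover have "0 \<le> pval P q p" using pval_nonneg[OF q(1)] pD by auto
          ultimately show "0 \<le> pval P q (a / b)" using pD(2) by simp
        qed
        then obtain k where k: "a / b * \<mu> ^ k \<in> P" by auto
        have "a / b * \<mu> ^ k * (\<mu> / p) \<in> P" by (rule P_closed(4)[OF k mp])
        moreover have "a / b * \<mu> ^ k * (\<mu> / p) = a / (p * b) * \<mu> ^ Suc k" using pD(2) by (simp add: field_simps)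
        ultimately show ?thesis by metis
      qed
    qed
  qed
  then show ?thesis using ab by simp
qed

end

subsection \<open>Evaluation and weights of multivariate polynomials\<close>

definition monom_val :: "(nat \<Rightarrow> 'r::comm_monoid_mult) \<Rightarrow> (nat \<Rightarrow>\<^sub>0 nat) \<Rightarrow> 'r" where
  "monom_val x t = (\<Prod>k\<in>Poly_Mapping.keys t. x k ^ Poly_Mapping.lookup t k)"

lemma monom_val_superset:
  assumes "finite S" "Poly_Mapping.keys t \<subseteq> S"
  shows "monom_val x t = (\<Prod>k\<in>S. x k ^ Poly_Mapping.lookup t k)"
  unfolding monom_val_def using assms
  by (intro prod.mono_neutral_left) (auto simp: in_keys_iff)

lemma monom_val_add: "monom_val x (s + t) = monom_val x s * monom_val x t"
proof -
  let ?S = "Poly_Mapping.keys s \<union> Poly_Mapping.keys t"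
  have "monom_val x u = (\<Prod>k\<in>?S. x k ^ Poly_Mapping.lookup u k)" if "u \<in> {s, t, s + t}" for u
    using that keys_add[of s t] by (intro monom_val_superset) auto
  then show ?thesis by (simp add: lookup_add power_add prod.distrib)
qed

lemma monom_val_0 [simp]: "monom_val x 0 = 1"
  by (simp add: monom_val_def)

lemma monom_val_single [simp]: "monom_val x (Poly_Mapping.single k n) = x k ^ n"
  by (cases "n = 0") (auto simp: monom_val_def)

definition weight :: "(nat \<Rightarrow> nat) \<Rightarrow> (nat \<Rightarrow>\<^sub>0 nat) \<Rightarrow> nat" where
  "weight \<omega> t = (\<Sum>k\<in>Poly_Mapping.keys t. \<omega> k * Poly_Mapping.lookup t k)"

lemma weight_superset:
  assumes "finite S" "Poly_Mapping.keys t \<subseteq> S"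
  shows "weight \<omega> t = (\<Sum>k\<in>S. \<omega> k * Poly_Mapping.lookup t k)"
  unfolding weight_def using assms
  by (intro sum.mono_neutral_left) (auto simp: in_keys_iff)

lemma weight_add: "weight \<omega> (s + t) = weight \<omega> s + weight \<omega> t"
proof -
  let ?S = "Poly_Mapping.keys s \<union> Poly_Mapping.keys t"
  have "weight \<omega> u = (\<Sum>k\<in>?S. \<omega> k * Poly_Mapping.lookup u k)" if "u \<in> {s, t, s + t}" for u
    using that keys_add[of s t] by (intro weight_superset) auto
  then show ?thesis by (simp add: lookup_add distrib_left sum.distrib)
qed

lemma weight_0 [simp]: "weight \<omega> 0 = 0"
  by (simp add: weight_def)

lemma weight_single [simp]: "weight \<omega> (Poly_Mapping.single k n) = \<omega> k * n"
  by (cases "n = 0") (auto simp: weight_def)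

lemma poly_mapping_sum_singles:
  "p = (\<Sum>t\<in>Poly_Mapping.keys p. Poly_Mapping.single t (Poly_Mapping.lookup p t))"
proof (rule poly_mapping_eqI)
  fix s
  have "(\<Sum>t\<in>Poly_Mapping.keys p. Poly_Mapping.lookup (Poly_Mapping.single t (Poly_Mapping.lookup p t)) s)
     = (\<Sum>t\<in>Poly_Mapping.keys p. if t = s then Poly_Mapping.lookup p s else 0)"
    by (intro sum.cong) (auto simp: lookup_single)
  then show "Poly_Mapping.lookup p s = Poly_Mapping.lookup (\<Sum>t\<in>Poly_Mapping.keys p. Poly_Mapping.single t (Poly_Mapping.lookup p t)) s"
    by (simp add: lookup_sum sum.delta in_keys_iff)
qed

text \<open>The coefficient map is a parameter because evaluation is needed twice: at rational
  functions, with \<open>const\<close>, and as substitution of polynomials, with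
  \<open>Poly_Mapping.single 0\<close>.\<close>

definition eval_hom :: "('a::idom \<Rightarrow> 'r::comm_ring_1) \<Rightarrow> (nat \<Rightarrow> 'r) \<Rightarrow> 'a mpoly \<Rightarrow> 'r" where
  "eval_hom \<phi> x p = (\<Sum>t\<in>Poly_Mapping.keys p. \<phi> (Poly_Mapping.lookup p t) * monom_val x t)"

locale coeff_hom =
  fixes \<phi> :: "'a::idom \<Rightarrow> 'r::comm_ring_1"
  assumes hom_add: "\<phi> (a + b) = \<phi> a + \<phi> b" and hom_mult: "\<phi> (a * b) = \<phi> a * \<phi> b" and hom_1: "\<phi> 1 = 1"
begin

lemma hom_0: "\<phi> 0 = 0"
  using hom_add[of 0 0] by simp

lemma eval_hom_superset:
  assumes "finite S" "Poly_Mapping.keys p \<subseteq> S"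
  shows "eval_hom \<phi> x p = (\<Sum>t\<in>S. \<phi> (Poly_Mapping.lookup p t) * monom_val x t)"
  unfolding eval_hom_def using assms
  by (intro sum.mono_neutral_left) (auto simp: in_keys_iff hom_0)

lemma eval_hom_add: "eval_hom \<phi> x (p + q) = eval_hom \<phi> x p + eval_hom \<phi> x q"
proof -
  let ?S = "Poly_Mapping.keys p \<union> Poly_Mapping.keys q"
  have "eval_hom \<phi> x u = (\<Sum>t\<in>?S. \<phi> (Poly_Mapping.lookup u t) * monom_val x t)" if "u \<in> {p, q, p + q}" for u
    using that keys_add[of p q] by (intro eval_hom_superset) auto
  then show ?thesis by (simp add: lookup_add hom_add distrib_right sum.distrib)
qed

lemma eval_hom_0 [simp]: "eval_hom \<phi> x 0 = 0"
  by (simp add: eval_hom_def)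

lemma eval_hom_sum: "eval_hom \<phi> x (sum f S) = (\<Sum>i\<in>S. eval_hom \<phi> x (f i))"
  by (induction S rule: infinite_finite_induct) (auto simp: eval_hom_add)

lemma eval_hom_single: "eval_hom \<phi> x (Poly_Mapping.single t c) = \<phi> c * monom_val x t"
  by (cases "c = 0") (auto simp: eval_hom_def hom_0)

lemma eval_hom_mult: "eval_hom \<phi> x (p * q) = eval_hom \<phi> x p * eval_hom \<phi> x q"
proof -
  have "p * q = (\<Sum>s\<in>Poly_Mapping.keys p. \<Sum>t\<in>Poly_Mapping.keys q.
      Poly_Mapping.single (s + t) (Poly_Mapping.lookup p s * Poly_Mapping.lookup q t))"
    by (subst poly_mapping_sum_singles[of p], subst poly_mapping_sum_singles[of q])
       (simp add: sum_product mult_single)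
  then have "eval_hom \<phi> x (p * q) = (\<Sum>s\<in>Poly_Mapping.keys p. \<Sum>t\<in>Poly_Mapping.keys q.
      (\<phi> (Poly_Mapping.lookup p s) * monom_val x s) * (\<phi> (Poly_Mapping.lookup q t) * monom_val x t))"
    by (simp add: eval_hom_sum eval_hom_single monom_val_add hom_mult mult_ac)
  then show ?thesis by (simp add: eval_hom_def sum_product)
qed

lemma eval_hom_1: "eval_hom \<phi> x 1 = 1"
  using eval_hom_single[of x 0 1] by (simp add: hom_1)

lemma eval_hom_power: "eval_hom \<phi> x (p ^ n) = eval_hom \<phi> x p ^ n"
  by (induction n) (auto simp: eval_hom_1 eval_hom_mult)

lemma eval_hom_prod: "eval_hom \<phi> x (prod f S) = (\<Prod>i\<in>S. eval_hom \<phi> x (f i))"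
  by (induction S rule: infinite_finite_induct) (auto simp: eval_hom_mult eval_hom_1)

end

definition mvar :: "nat \<Rightarrow> 'a::{zero,one} mpoly" where
  "mvar k = Poly_Mapping.single (Poly_Mapping.single k 1) 1"

definition rvar :: "nat \<Rightarrow> 'a::idom ratfun" where
  "rvar k = Fract (mvar k) 1"

interpretation single_hom: coeff_hom "Poly_Mapping.single 0 :: 'a::idom \<Rightarrow> 'a mpoly"
  by unfold_locales (auto simp: single_add mult_single)

interpretation const_hom: coeff_hom "const :: 'a::idom \<Rightarrow> 'a ratfun"
  by unfold_locales (auto simp: const_def single_add mult_single Fract_of_nat_eq One_fract_def)

lemma eval_mpoly_eq: "eval_mpoly x p = eval_hom const x p"
  by (simp add: eval_mpoly_def eval_hom_def monom_val_def)

lemma Fract_power: "Fract p 1 ^ n = Fract (p ^ n) (1 :: 'a::idom)"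
  by (induction n) (auto simp: One_fract_def)

lemma Fract_prod: "(\<Prod>i\<in>S. Fract (f i) 1) = Fract (prod f S) (1 :: 'a::idom)"
  by (induction S rule: infinite_finite_induct) (auto simp: One_fract_def)

lemma Fract_sum: "(\<Sum>i\<in>S. Fract (f i) 1) = Fract (sum f S) (1 :: 'a::idom)"
  by (induction S rule: infinite_finite_induct) (auto simp: Zero_fract_def)

lemma Fract_1_eq_iff [simp]: "Fract p 1 = Fract q (1 :: 'a::idom) \<longleftrightarrow> p = q"
  by (simp add: eq_fract)

lemma Fract_1_eq_0_iff [simp]: "Fract p (1 :: 'a::idom) = 0 \<longleftrightarrow> p = 0"
  by (simp add: Zero_fract_def eq_fract)

lemma eval_mpoly_Fract: "eval_mpoly (\<lambda>k. Fract (P k) 1) p = Fract (eval_hom (Poly_Mapping.single 0) P p) 1"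
  unfolding eval_mpoly_eq eval_hom_def monom_val_def const_def
  by (simp add: Fract_power Fract_prod Fract_sum)

lemma monom_val_mvar: "monom_val mvar t = Poly_Mapping.single t (1 :: 'a::idom)"
proof -
  have p: "mvar k ^ n = Poly_Mapping.single (Poly_Mapping.single k n) (1 :: 'a)" for k n
    by (induction n) (auto simp: mvar_def mult_single simp flip: single_add single_one)
  have "(\<Prod>k\<in>S. mvar k ^ Poly_Mapping.lookup t k) =
      Poly_Mapping.single (\<Sum>k\<in>S. Poly_Mapping.single k (Poly_Mapping.lookup t k)) (1 :: 'a)" if "finite S" for S
    using that by induction (auto simp: p mult_single)
  then show ?thesis using poly_mapping_sum_singles[of t] by (simp add: monom_val_def)
qed

lemma eval_hom_mvar: "eval_hom (Poly_Mapping.single 0) mvar p = (p :: 'a::idom mpoly)"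
  unfolding eval_hom_def using poly_mapping_sum_singles[of p] by (simp add: monom_val_mvar mult_single)

lemma eval_mpoly_var: "eval_mpoly rvar p = Fract p 1"
  using eval_mpoly_Fract[of mvar p] by (simp add: rvar_def[abs_def] eval_hom_mvar)

lemma eval_hom_cong:
  assumes "p \<in> mpolys N" "\<And>k. k \<in> {1..N} \<Longrightarrow> x k = y k"
  shows "eval_hom \<phi> x p = eval_hom \<phi> y p"
  unfolding eval_hom_def monom_val_def
proof (intro sum.cong HOL.refl arg_cong2[where f = "(*)"] prod.cong)
  fix t k assume "t \<in> Poly_Mapping.keys p" "k \<in> Poly_Mapping.keys t"
  then have "x k = y k" using assms unfolding mpolys_def by blast
  then show "x k ^ Poly_Mapping.lookup t k = y k ^ Poly_Mapping.lookup t k" by simp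
qed

text \<open>A polynomial substitution with a left inverse preserves algebraic independence.\<close>

lemma alg_independent_substitution:
  fixes P Q :: "nat \<Rightarrow> 'a::idom mpoly"
  assumes "\<And>k. k \<in> {1..N} \<Longrightarrow> eval_hom (Poly_Mapping.single 0) Q (P k) = mvar k"
    and "\<And>k. k \<in> {1..N} \<Longrightarrow> x k = Fract (P k) 1"
  shows "alg_independent N x"
  unfolding alg_independent_def
proof (intro ballI impI)
  fix p :: "'a mpoly" assume p: "p \<in> mpolys N" "eval_mpoly x p = 0"
  let ?s = "Poly_Mapping.single 0 :: 'a \<Rightarrow> 'a mpoly"
  have "eval_mpoly x p = eval_mpoly (\<lambda>k. Fract (P k) 1) p"
    unfolding eval_mpoly_eq by (rule eval_hom_cong[OF p(1)]) (use assms in auto)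
  then have "eval_hom ?s P p = 0" using p by (simp add: eval_mpoly_Fract)
  then have "eval_hom ?s Q (eval_hom ?s P p) = 0" by simp
  also have "eval_hom ?s Q (eval_hom ?s P p) = eval_hom ?s (\<lambda>k. eval_hom ?s Q (P k)) p"
    unfolding eval_hom_def[of ?s P] monom_val_def
    by (simp add: single_hom.eval_hom_sum single_hom.eval_hom_mult single_hom.eval_hom_prod
        single_hom.eval_hom_power single_hom.eval_hom_single)
       (simp add: eval_hom_def monom_val_def)
  also have "\<dots> = eval_hom ?s mvar p" by (rule eval_hom_cong[OF p(1)]) (use assms in auto)
  finally show "p = 0" by (simp add: eval_hom_mvar)
qed

section \<open>Monomial valuations\<close>

lemma mult_keys_weight:
  fixes p q :: "'a::idom mpoly"
  assumes "\<And>t. t \<in> Poly_Mapping.keys p \<Longrightarrow> a \<le> weight \<omega> t" "\<And>t. t \<in> Poly_Mapping.keys q \<Longrightarrow> b \<le> weight \<omega> t"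
    and "t \<in> Poly_Mapping.keys (p * q)"
  shows "a + b \<le> weight \<omega> t"
proof -
  obtain s u where "s \<in> Poly_Mapping.keys p" "u \<in> Poly_Mapping.keys q" "t = s + u"
    using keys_mult[of p q] assms(3) by auto
  then show ?thesis using assms(1)[of s] assms(2)[of u] by (simp add: weight_add)
qed

definition ord :: "(nat \<Rightarrow> nat) \<Rightarrow> 'a::zero mpoly \<Rightarrow> nat" where
  "ord \<omega> p = Min (weight \<omega> ` Poly_Mapping.keys p)"

lemma ord_le: "t \<in> Poly_Mapping.keys p \<Longrightarrow> ord \<omega> p \<le> weight \<omega> t"
  unfolding ord_def by (intro Min_le) auto

lemma keys_nonempty: "p \<noteq> 0 \<Longrightarrow> Poly_Mapping.keys p \<noteq> {}"
  by (metis all_not_in_conv in_keys_iff lookup_zero poly_mapping_eqI)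

lemma ord_attained: "p \<noteq> 0 \<Longrightarrow> \<exists>t\<in>Poly_Mapping.keys p. weight \<omega> t = ord \<omega> p"
  using Min_in[of "weight \<omega> ` Poly_Mapping.keys p"] keys_nonempty[of p] by (fastforce simp: ord_def)

lemma ord_eqI:
  assumes "t \<in> Poly_Mapping.keys p" "weight \<omega> t = n" "\<And>s. s \<in> Poly_Mapping.keys p \<Longrightarrow> n \<le> weight \<omega> s"
  shows "ord \<omega> p = n"
  unfolding ord_def using assms by (intro Min_eqI) auto

lemma ord_add:
  assumes "p + q \<noteq> 0" "p \<noteq> 0" "q \<noteq> 0"
  shows "min (ord \<omega> p) (ord \<omega> q) \<le> ord \<omega> (p + q)"
proof -
  obtain t where t: "t \<in> Poly_Mapping.keys (p + q)" "weight \<omega> t = ord \<omega> (p + q)" using ord_attained[OF assms(1)] by auto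
  then have "t \<in> Poly_Mapping.keys p \<or> t \<in> Poly_Mapping.keys q" using keys_add[of p q] by auto
  then show ?thesis using ord_le[of t p \<omega>] ord_le[of t q \<omega>] t(2) by auto
qed

text \<open>The products of the components of lowest weight do not cancel since \<open>'a mpoly\<close> is a domain.\<close>

lemma ord_mult:
  fixes p q :: "'a::idom mpoly"
  assumes "p \<noteq> 0" "q \<noteq> 0"
  shows "ord \<omega> (p * q) = ord \<omega> p + ord \<omega> q"
proof -
  have split: "\<exists>f0 f1. f = f0 + f1 \<and> f0 \<noteq> 0 \<and> (\<forall>t\<in>Poly_Mapping.keys f0. weight \<omega> t = ord \<omega> f) \<and>
      (\<forall>t\<in>Poly_Mapping.keys f1. ord \<omega> f + 1 \<le> weight \<omega> t)" if f: "f \<noteq> 0" for f :: "'a mpoly"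
  proof -
    define f0 where "f0 = (\<Sum>t\<in>{t \<in> Poly_Mapping.keys f. weight \<omega> t = ord \<omega> f}. Poly_Mapping.single t (Poly_Mapping.lookup f t))"
    define f1 where "f1 = f - f0"
    have l0: "Poly_Mapping.lookup f0 s = (if weight \<omega> s = ord \<omega> f then Poly_Mapping.lookup f s else 0)" for s
    proof -
      let ?K = "{t \<in> Poly_Mapping.keys f. weight \<omega> t = ord \<omega> f}"
      have "(\<Sum>t\<in>?K. Poly_Mapping.lookup (Poly_Mapping.single t (Poly_Mapping.lookup f t)) s)
         = (\<Sum>t\<in>?K. if t = s then Poly_Mapping.lookup f s else 0)"
        by (intro sum.cong) (auto simp: lookup_single)
      also have "\<dots> = (if s \<in> ?K then Poly_Mapping.lookup f s else 0)" by (simp add: sum.delta)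
      finally show ?thesis by (auto simp: f0_def lookup_sum in_keys_iff)
    qed
    obtain t where "t \<in> Poly_Mapping.keys f" "weight \<omega> t = ord \<omega> f" using ord_attained[OF f] by auto
    then have "Poly_Mapping.lookup f0 t \<noteq> 0" using l0 by (simp add: in_keys_iff)
    then have "f0 \<noteq> 0" by auto
    moreover have "\<forall>t\<in>Poly_Mapping.keys f0. weight \<omega> t = ord \<omega> f" using l0 by (auto simp: in_keys_iff split: if_splits)
    moreover have "ord \<omega> f + 1 \<le> weight \<omega> t" if "t \<in> Poly_Mapping.keys f1" for t
    proof -
      have "t \<in> Poly_Mapping.keys f" "weight \<omega> t \<noteq> ord \<omega> f"
        using that l0[of t] by (auto simp: f1_def in_keys_iff lookup_minus split: if_splits)
      then show ?thesis using ord_le[of t f \<omega>] by auto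
    qed
    ultimately show ?thesis by (intro exI[of _ f0] exI[of _ f1]) (auto simp: f1_def)
  qed
  obtain p0 p1 where p: "p = p0 + p1" "p0 \<noteq> 0" "\<forall>t\<in>Poly_Mapping.keys p0. weight \<omega> t = ord \<omega> p"
    "\<forall>t\<in>Poly_Mapping.keys p1. ord \<omega> p + 1 \<le> weight \<omega> t" using split[OF assms(1)] by auto
  obtain q0 q1 where q: "q = q0 + q1" "q0 \<noteq> 0" "\<forall>t\<in>Poly_Mapping.keys q0. weight \<omega> t = ord \<omega> q"
    "\<forall>t\<in>Poly_Mapping.keys q1. ord \<omega> q + 1 \<le> weight \<omega> t" using split[OF assms(2)] by auto
  have "p0 * q0 \<noteq> 0" using p q by simp
  then obtain t where t: "t \<in> Poly_Mapping.keys (p0 * q0)" using keys_nonempty by blast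
  have w: "weight \<omega> t = ord \<omega> p + ord \<omega> q"
  proof -
    obtain s u where "s \<in> Poly_Mapping.keys p0" "u \<in> Poly_Mapping.keys q0" "t = s + u"
      using keys_mult[of p0 q0] t by auto
    then show ?thesis using p q by (simp add: weight_add)
  qed
  have "p * q = p0 * q0 + (p0 * q1 + p1 * q)" using p q by (simp add: algebra_simps)
  moreover have "t \<notin> Poly_Mapping.keys (p0 * q1)"
    using mult_keys_weight[of p0 "ord \<omega> p" \<omega> q1 "ord \<omega> q + 1" t] p q w by auto
  moreover have "t \<notin> Poly_Mapping.keys (p1 * q)"
    using mult_keys_weight[of p1 "ord \<omega> p + 1" \<omega> q "ord \<omega> q" t] p w ord_le[of _ q \<omega>] by auto
  ultimately have "t \<in> Poly_Mapping.keys (p * q)" using t by (simp add: in_keys_iff lookup_add)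
  then show ?thesis
    using w mult_keys_weight[of p "ord \<omega> p" \<omega> q "ord \<omega> q"] ord_le[of _ p \<omega>] ord_le[of _ q \<omega>]
    by (intro ord_eqI[of t]) auto
qed

text \<open>The extension of the weighted order \<open>ord\<close> to fractions; multiplicativity of
  \<open>ord\<close> makes it independent of the representation of \<open>z\<close>.\<close>

definition wval :: "(nat \<Rightarrow> nat) \<Rightarrow> 'a::idom ratfun \<Rightarrow> int" where
  "wval \<omega> z = (THE k. \<exists>p q. p \<noteq> 0 \<and> q \<noteq> 0 \<and> z = Fract p q \<and> k = int (ord \<omega> p) - int (ord \<omega> q))"

lemma wval_Fract: "p \<noteq> 0 \<Longrightarrow> q \<noteq> 0 \<Longrightarrow> wval \<omega> (Fract p q) = int (ord \<omega> p) - int (ord \<omega> q)"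
  for p q :: "'a::idom mpoly"
  unfolding wval_def
proof (rule the_equality)
  assume pq: "p \<noteq> 0" "q \<noteq> 0"
  then show "\<exists>p' q'. p' \<noteq> 0 \<and> q' \<noteq> 0 \<and> Fract p q = Fract p' q' \<and> int (ord \<omega> p) - int (ord \<omega> q) = int (ord \<omega> p') - int (ord \<omega> q')"
    by blast
  fix k assume "\<exists>p' q'. p' \<noteq> 0 \<and> q' \<noteq> 0 \<and> Fract p q = Fract p' q' \<and> k = int (ord \<omega> p') - int (ord \<omega> q')"
  then obtain p' q' where *: "p' \<noteq> 0" "q' \<noteq> 0" "Fract p q = Fract p' q'" "k = int (ord \<omega> p') - int (ord \<omega> q')" by auto
  then have "p * q' = p' * q" using pq by (simp add: eq_fract)
  then have "ord \<omega> p + ord \<omega> q' = ord \<omega> p' + ord \<omega> q" using ord_mult pq *(1,2) by metis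
  then show "k = int (ord \<omega> p) - int (ord \<omega> q)" using *(4) by simp
qed

lemma wval_Fract_1: "p \<noteq> 0 \<Longrightarrow> wval \<omega> (Fract p 1) = int (ord \<omega> p)" for p :: "'a::idom mpoly"
  by (simp add: wval_Fract ord_eqI[of 0])

lemma wval_valuation: "valuation_on UNIV (wval \<omega>)"
  unfolding valuation_on_def
proof (intro ballI conjI impI)
  fix x y :: "'a ratfun" assume xy: "x \<in> UNIV - {0}" "y \<in> UNIV - {0}"
  obtain a b where ab: "x = Fract a b" "b \<noteq> 0" by (cases x)
  obtain c d where cd: "y = Fract c d" "d \<noteq> 0" by (cases y)
  have ac: "a \<noteq> 0" "c \<noteq> 0" using xy ab cd by (auto simp: Zero_fract_def eq_fract)
  show "wval \<omega> (x * y) = wval \<omega> x + wval \<omega> y"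
    using ab cd ac by (simp add: wval_Fract ord_mult)
  assume "x + y \<noteq> 0"
  have s: "x + y = Fract (a * d + c * b) (b * d)" using ab cd by simp
  then have n: "a * d + c * b \<noteq> 0" using \<open>x + y \<noteq> 0\<close> ab cd by (auto simp: Zero_fract_def eq_fract)
  have "min (ord \<omega> (a * d)) (ord \<omega> (c * b)) \<le> ord \<omega> (a * d + c * b)"
    using n ac ab cd by (intro ord_add) auto
  then have "min (ord \<omega> a + ord \<omega> d) (ord \<omega> c + ord \<omega> b) \<le> ord \<omega> (a * d + c * b)"
    using ac ab cd by (simp add: ord_mult)
  then show "min (wval \<omega> x) (wval \<omega> y) \<le> wval \<omega> (x + y)"
    unfolding s using ab cd ac n by (simp add: wval_Fract ord_mult min_def split: if_splits)
qed

lemma wval_const: "c \<noteq> 0 \<Longrightarrow> wval \<omega> (const c) = 0"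
proof -
  assume "c \<noteq> 0"
  moreover then have "Poly_Mapping.single 0 c \<noteq> (0 :: 'a mpoly)" by (metis lookup_single_eq lookup_zero)
  ultimately show ?thesis unfolding const_def by (subst wval_Fract_1) (auto intro!: ord_eqI[of 0])
qed

lemma mvar_nonzero: "mvar k \<noteq> (0 :: 'a::idom mpoly)"
  unfolding mvar_def by (metis lookup_single_eq lookup_zero zero_neq_one)

lemma wval_rvar: "wval \<omega> (rvar k :: 'a::idom ratfun) = int (\<omega> k)"
proof -
  have "ord \<omega> (mvar k :: 'a mpoly) = \<omega> k"
    by (rule ord_eqI[of "Poly_Mapping.single k 1"]) (auto simp: mvar_def)
  then show ?thesis unfolding rvar_def wval_Fract_1[OF mvar_nonzero] by simp
qed

subsection \<open>The tower of polynomial rings\<close>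

definition mring :: "nat \<Rightarrow> 'a::idom ratfun set" where
  "mring N = (\<lambda>p. Fract p 1) ` mpolys N"

lemma mpolys_closed:
  fixes p q :: "'a::idom mpoly"
  shows "p \<in> mpolys N \<Longrightarrow> q \<in> mpolys N \<Longrightarrow> p - q \<in> mpolys N"
    "p \<in> mpolys N \<Longrightarrow> q \<in> mpolys N \<Longrightarrow> p * q \<in> mpolys N" "1 \<in> mpolys N"
    "Poly_Mapping.single 0 c \<in> mpolys N" "k \<in> {1..N} \<Longrightarrow> mvar k \<in> mpolys N"
proof -
  show "p \<in> mpolys N \<Longrightarrow> q \<in> mpolys N \<Longrightarrow> p - q \<in> mpolys N"
  proof -
    assume pq: "p \<in> mpolys N" "q \<in> mpolys N"
    have "Poly_Mapping.keys (p - q) \<subseteq> Poly_Mapping.keys p \<union> Poly_Mapping.keys q"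
      by (auto simp: in_keys_iff lookup_minus)
    then show "p - q \<in> mpolys N" using pq unfolding mpolys_def by blast
  qed
  show "p * q \<in> mpolys N" if "p \<in> mpolys N" "q \<in> mpolys N"
    unfolding mpolys_def
  proof safe
    fix t k assume "t \<in> Poly_Mapping.keys (p * q)" "k \<in> Poly_Mapping.keys t"
    then obtain s u where "s \<in> Poly_Mapping.keys p" "u \<in> Poly_Mapping.keys q" "k \<in> Poly_Mapping.keys (s + u)"
      using keys_mult[of p q] by auto
    then show "k \<in> {1..N}" using that keys_add[of s u] unfolding mpolys_def by blast
  qed
qed (auto simp: mpolys_def mvar_def)

lemma mring_subring: "is_subring (mring N :: 'a::idom ratfun set)"
  unfolding is_subring_def
proof (intro conjI ballI)
  show "1 \<in> mring N" unfolding mring_def One_fract_def using mpolys_closed(3) by blast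
  fix x y :: "'a ratfun" assume "x \<in> mring N" "y \<in> mring N"
  then obtain p q where pq: "p \<in> mpolys N" "q \<in> mpolys N" "x = Fract p 1" "y = Fract q 1" by (auto simp: mring_def)
  show "x - y \<in> mring N" "x * y \<in> mring N" using mpolys_closed(1,2)[OF pq(1,2)] pq by (auto simp: mring_def)
qed

lemma const_in_mring: "const c \<in> mring N"
  using mpolys_closed(4) by (auto simp: mring_def const_def)

lemma var_in_mring: "k \<in> {1..N} \<Longrightarrow> rvar k \<in> mring N"
  using mpolys_closed(5) by (auto simp: mring_def rvar_def)

lemma mring_0: "mring 0 = range const"
proof
  show "range const \<subseteq> mring 0" using const_in_mring by auto
  show "mring 0 \<subseteq> range (const :: 'a \<Rightarrow> _)"
  proof
    fix x :: "'a ratfun" assume "x \<in> mring 0"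
    then obtain p where p: "x = Fract p 1" "\<forall>t\<in>Poly_Mapping.keys p. t = 0"
      by (force simp: mring_def mpolys_def intro: poly_mapping_eqI)
    then have "p = Poly_Mapping.single 0 (Poly_Mapping.lookup p 0)"
      by (intro poly_mapping_eqI) (auto simp: lookup_single when_def in_keys_iff)
    then show "x \<in> range const" using p by (auto simp: const_def)
  qed
qed

lemma mring_mono: "N \<le> N' \<Longrightarrow> mring N \<subseteq> mring N'"
  unfolding mring_def mpolys_def by (intro image_mono) force

lemma mring_generated:
  fixes S :: "'a::idom ratfun set"
  assumes S: "is_subring S" and c: "range const \<subseteq> S" and v: "\<And>k. k \<in> {1..N} \<Longrightarrow> rvar k \<in> S"
  shows "mring N \<subseteq> S"
proof
  fix x :: "'a ratfun" assume "x \<in> mring N"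
  then obtain p where p: "p \<in> mpolys N" "x = Fract p 1" by (auto simp: mring_def)
  then have "x = (\<Sum>t\<in>Poly_Mapping.keys p. const (Poly_Mapping.lookup p t) * monom_val rvar t)"
    by (simp add: eval_mpoly_var[symmetric] eval_mpoly_eq eval_hom_def)
  also have "\<dots> \<in> S"
  proof (intro is_subring_sum[OF S] is_subring_closed(4)[OF S])
    fix t assume t: "t \<in> Poly_Mapping.keys p"
    show "monom_val rvar t \<in> S" unfolding monom_val_def
    proof (intro is_subring_prod[OF S] is_subring_closed(7)[OF S] v)
      fix k assume "k \<in> Poly_Mapping.keys t"
      then show "k \<in> {1..N}" using t p(1) unfolding mpolys_def by blast
    qed
  qed (use c in auto)
  finally show "x \<in> S" .
qed

text \<open>Lets factoriality, primes and units be handled by adjoining one variable at a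
  time.\<close>

lemma mring_Suc: "(mring (Suc N) :: 'a::idom ratfun set) = adjoin (mring N) (rvar (Suc N))"
proof
  show "(mring (Suc N) :: 'a ratfun set) \<subseteq> adjoin (mring N) (rvar (Suc N))"
  proof (rule mring_generated[OF adjoin_subring[OF mring_subring]])
    show "range (const :: 'a \<Rightarrow> _) \<subseteq> adjoin (mring N) (rvar (Suc N))"
      using subset_adjoin[OF mring_subring] const_in_mring by blast
    fix k assume k: "k \<in> {1..Suc N}"
    show "(rvar k :: 'a ratfun) \<in> adjoin (mring N) (rvar (Suc N))"
    proof (cases "k = Suc N")
      case True
      then show ?thesis using adjoin_self[OF mring_subring] by simp
    next
      case False
      then have "(rvar k :: 'a ratfun) \<in> mring N" using k by (intro var_in_mring) auto
      then show ?thesis using subset_adjoin[OF mring_subring] by blast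
    qed
  qed
  show "adjoin (mring N) (rvar (Suc N)) \<subseteq> (mring (Suc N) :: 'a ratfun set)"
  proof
    fix x :: "'a ratfun" assume "x \<in> adjoin (mring N) (rvar (Suc N))"
    then obtain f where f: "\<And>i. coeff f i \<in> mring N" "x = poly f (rvar (Suc N))" by (auto simp: adjoin_def polys_on_def)
    have "coeff f i \<in> mring (Suc N)" for i using f(1) mring_mono[of N "Suc N"] by auto
    then show "x \<in> mring (Suc N)" unfolding f(2) poly_altdef
      by (intro is_subring_sum[OF mring_subring] is_subring_closed(4,7)[OF mring_subring] var_in_mring) auto
  qed
qed

lemma lookup_mult_monomial: "Poly_Mapping.lookup (g * Poly_Mapping.single s c) (t + s) = Poly_Mapping.lookup g t * c"
  for g :: "'a::idom mpoly"
proof -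
  have "g * Poly_Mapping.single s c = (\<Sum>u\<in>Poly_Mapping.keys g. Poly_Mapping.single (u + s) (Poly_Mapping.lookup g u * c))"
    by (subst poly_mapping_sum_singles[of g]) (simp add: sum_distrib_right mult_single)
  then have "Poly_Mapping.lookup (g * Poly_Mapping.single s c) (t + s) =
     (\<Sum>u\<in>Poly_Mapping.keys g. if u = t then Poly_Mapping.lookup g t * c else 0)"
    by (auto simp: lookup_sum lookup_single when_def intro!: sum.cong)
  then show ?thesis by (simp add: sum.delta in_keys_iff)
qed

text \<open>The last variable does not occur in the coefficients, so it has exponent
  \<open>j\<close> in every monomial of the summand \<open>j\<close>, and different summands cannot
  cancel.\<close>

lemma var_transcendental: "transcendental_on (mring N) (rvar (Suc N))"
  unfolding transcendental_on_def
proof (intro ballI impI)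
  fix f :: "'a ratfun poly" assume f: "f \<in> polys_on (mring N)" "poly f (rvar (Suc N)) = 0"
  have "\<forall>i. \<exists>p. p \<in> mpolys N \<and> coeff f i = Fract p 1" using f(1) by (auto simp: polys_on_def mring_def)
  then obtain g where g: "\<And>i. g i \<in> mpolys N" "\<And>i. coeff f i = Fract (g i) 1" by metis
  let ?m = "\<lambda>i. Poly_Mapping.single (Suc N) i :: nat \<Rightarrow>\<^sub>0 nat"
  have pw: "mvar (Suc N) ^ i = Poly_Mapping.single (?m i) (1 :: 'a)" for i
    by (induction i) (auto simp: mvar_def mult_single simp flip: single_add single_one)
  have "poly f (rvar (Suc N)) = Fract (\<Sum>i\<le>degree f. g i * Poly_Mapping.single (?m i) 1) 1"
    unfolding poly_altdef g(2) rvar_def Fract_power pw by (simp flip: Fract_sum)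
  then have z: "(\<Sum>i\<le>degree f. g i * Poly_Mapping.single (?m i) 1) = 0" using f(2) by simp
  have "Poly_Mapping.lookup (g j) t = 0" if j: "j \<le> degree f" for j t
  proof (cases "t \<in> Poly_Mapping.keys (g j)")
    case True
    then have tN: "Poly_Mapping.lookup t (Suc N) = 0" using g(1)[of j] by (force simp: mpolys_def in_keys_iff)
    have "Poly_Mapping.lookup (g i * Poly_Mapping.single (?m i) 1) (t + ?m j) = 0" if "i \<noteq> j" for i
    proof (rule ccontr)
      assume "\<not> ?thesis"
      then have "t + ?m j \<in> Poly_Mapping.keys (g i * Poly_Mapping.single (?m i) 1)" by (simp add: in_keys_iff)
      then obtain s u where s: "s \<in> Poly_Mapping.keys (g i)" "u \<in> Poly_Mapping.keys (Poly_Mapping.single (?m i) (1::'a))"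
        "t + ?m j = s + u" using keys_mult by blast
      then have "t + ?m j = s + ?m i" by simp
      moreover have "Poly_Mapping.lookup s (Suc N) = 0" using g(1)[of i] s(1) by (force simp: mpolys_def in_keys_iff)
      ultimately show False using tN that
        by (metis add_0 lookup_add lookup_single_eq)
    qed
    then have "Poly_Mapping.lookup (\<Sum>i\<le>degree f. g i * Poly_Mapping.single (?m i) 1) (t + ?m j)
       = (\<Sum>i\<le>degree f. if i = j then Poly_Mapping.lookup (g j) t else 0)"
      unfolding lookup_sum by (intro sum.cong) (auto simp: lookup_mult_monomial)
    then show ?thesis using z j by (simp add: sum.delta)
  qed (simp add: in_keys_iff)
  then have "g j = 0" if "j \<le> degree f" for j using that by (intro poly_mapping_eqI) auto
  then have "lead_coeff f = 0" using g(2)[of "degree f"] by simp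
  then show "f = 0" by simp
qed

lemma const_inverse: "inverse (const c) = const (inverse c)" for c :: "'a::field"
proof (cases "c = 0")
  case False
  have "const c * const (inverse c) = 1" using False by (simp flip: const_hom.hom_mult add: const_hom.hom_1)
  then show ?thesis by (rule inverse_unique)
qed (simp add: const_hom.hom_0)

lemma mring_factorial: "factorial_on (mring N :: 'a::field ratfun set)"
proof (induction N)
  case 0
  show ?case using mring_subring[of 0] unfolding mring_0
    by (intro factorial_on_field) (auto simp: const_inverse)
next
  case (Suc N)
  then show ?case unfolding mring_Suc by (rule factorial_adjoin[OF _ var_transcendental])
qed

lemma var_prime: "k \<in> {1..N} \<Longrightarrow> prime_on (mring N) (rvar k :: 'a::field ratfun)"
proof (induction N)
  case (Suc N)
  note ctx = mring_factorial[of N] var_transcendental[of N]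
  show ?case
  proof (cases "k = Suc N")
    case True
    have "prime_on (adjoin (mring N) (rvar (Suc N))) (0 + 1 * (rvar (Suc N) :: 'a ratfun))"
    proof (rule prime_on_linear[OF ctx])
      show "0 \<in> mring N" "1 \<in> mring N" using is_subring_closed[OF mring_subring] by auto
      fix p :: "'a ratfun" assume "prime_on (mring N) p" "1 / p \<in> mring N"
      then show False using prime_onD(3) by (auto simp: inverse_eq_divide)
    qed simp
    then show ?thesis using True by (simp add: mring_Suc)
  next
    case False
    then have "prime_on (mring N) (rvar k :: 'a ratfun)" using Suc by auto
    then show ?thesis unfolding mring_Suc by (rule prime_on_adjoin[OF ctx])
  qed
qed simp

lemma mring_unit: "unit_on (mring N) u \<Longrightarrow> u \<in> range (const :: 'a::field \<Rightarrow> _)"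
proof (induction N)
  case 0
  then show ?case using unit_onD(1)[OF 0] unfolding mring_0 by blast
next
  case (Suc N)
  have u: "unit_on (adjoin (mring N) (rvar (Suc N))) u" using Suc.prems unfolding mring_Suc .
  then obtain f where f: "f \<in> polys_on (mring N)" "u = poly f (rvar (Suc N))" using unit_onD(1)[OF u] unfolding adjoin_def by blast
  have "degree f = 0" "unit_on (mring N) (coeff f 0)"
    using unit_adjoin[OF mring_factorial var_transcendental f(1)] u unfolding f(2) by blast+
  moreover from this(1) obtain c where "f = [:c:]" by (elim degree_eq_zeroE)
  ultimately show ?case using Suc.IH f(2) by simp
qed

lemma quotient_field_mring: "quotient_field (mring N) = ratfun_field N"
proof
  show "quotient_field (mring N) \<subseteq> (ratfun_field N :: 'a::idom ratfun set)"
    unfolding quotient_field_def fractions_def mring_def ratfun_field_def by force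
  show "(ratfun_field N :: 'a ratfun set) \<subseteq> quotient_field (mring N)"
  proof
    fix x :: "'a ratfun" assume "x \<in> ratfun_field N"
    then obtain p q where pq: "p \<in> mpolys N" "q \<in> mpolys N" "q \<noteq> 0" "x = Fract p q" by (auto simp: ratfun_field_def)
    then have "x = Fract p 1 / Fract q 1" "Fract q 1 \<in> mring N - {0}" "Fract p 1 \<in> mring N" by (auto simp: mring_def)
    then show "x \<in> quotient_field (mring N)" unfolding quotient_field_def by (intro fractionsI) 
  qed
qed

section \<open>Cardinality of polynomial rings\<close>

lemma times_countable_lepoll:
  assumes "countable A" "infinite B"
  shows "A \<times> B \<lesssim> B"
proof -
  have "A \<lesssim> B" using assms by (meson countable_def infinite_le_lepoll lepoll_def lepoll_trans subset_UNIV)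
  then have "A \<times> B \<lesssim> B \<times> B" by (rule times_lepoll_mono) simp
  also have "B \<times> B \<approx> B" unfolding eqpoll_iff_card_of_ordIso using assms(2) by (rule card_of_Times_same_infinite)
  finally show ?thesis .
qed

text \<open>A finitely supported map is determined by its graph over the support, a finite set of
  pairs.\<close>

lemma poly_mapping_lepoll_Fpow:
  "(UNIV :: ('x \<Rightarrow>\<^sub>0 'y::zero) set) \<lesssim> Fpow ((UNIV :: 'x set) \<times> (UNIV :: 'y set))"
proof -
  have "(UNIV :: ('x \<Rightarrow>\<^sub>0 'y) set) \<lesssim> {f :: 'x \<Rightarrow> 'y. f ` UNIV \<subseteq> UNIV \<and> {x. f x \<noteq> 0} \<subseteq> UNIV \<and> finite {x. f x \<noteq> 0}}"
    unfolding lepoll_def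
  proof (intro exI conjI)
    show "inj (Poly_Mapping.lookup :: ('x \<Rightarrow>\<^sub>0 'y) \<Rightarrow> _)" 
    proof (rule injI)
      fix a b :: "'x \<Rightarrow>\<^sub>0 'y" assume "Poly_Mapping.lookup a = Poly_Mapping.lookup b"
      then show "a = b" by (intro poly_mapping_eqI) simp
    qed
    show "range Poly_Mapping.lookup \<subseteq> {f :: 'x \<Rightarrow> 'y. f ` UNIV \<subseteq> UNIV \<and> {x. f x \<noteq> 0} \<subseteq> UNIV \<and> finite {x. f x \<noteq> 0}}"
      by (intro image_subsetI CollectI conjI finite_lookup subset_UNIV)
  qed
  also have "\<dots> \<lesssim> Fpow ((UNIV :: 'x set) \<times> (UNIV :: 'y set))" by (rule lepoll_restricted_funspace)
  finally show ?thesis .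
qed

text \<open>There are only countably many monomials, and passing to finite subsets does not increase
  an infinite cardinality.\<close>

lemma mring_lepoll:
  assumes inf: "infinite (UNIV :: 'a::idom set)"
  shows "(mring N :: 'a::idom ratfun set) \<lesssim> (UNIV :: 'a::idom set)"
proof -
  have "(UNIV :: (nat \<Rightarrow>\<^sub>0 nat) set) \<lesssim> Fpow ((UNIV :: nat set) \<times> (UNIV :: nat set))"
    by (rule poly_mapping_lepoll_Fpow)
  also have "\<dots> \<approx> (UNIV :: nat set) \<times> (UNIV :: nat set)" by (intro eqpoll_Fpow) (simp add: finite_prod)
  finally have "(UNIV :: (nat \<Rightarrow>\<^sub>0 nat) set) \<lesssim> (UNIV :: nat set) \<times> (UNIV :: nat set)" .
  then have "countable (UNIV :: (nat \<Rightarrow>\<^sub>0 nat) set)" by (rule countable_lepoll[rotated]) simp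
  then have mc: "(UNIV :: (nat \<Rightarrow>\<^sub>0 nat) set) \<times> (UNIV :: 'a set) \<lesssim> (UNIV :: 'a set)"
    using inf by (rule times_countable_lepoll)
  have "(mring N :: 'a ratfun set) \<lesssim> (mpolys N :: 'a mpoly set)" unfolding mring_def by (rule image_lepoll)
  also have "\<dots> \<lesssim> (UNIV :: 'a mpoly set)" by (intro subset_imp_lepoll) simp
  also have "\<dots> \<lesssim> Fpow ((UNIV :: (nat \<Rightarrow>\<^sub>0 nat) set) \<times> (UNIV :: 'a set))" by (rule poly_mapping_lepoll_Fpow)
  also have "\<dots> \<approx> (UNIV :: (nat \<Rightarrow>\<^sub>0 nat) set) \<times> (UNIV :: 'a set)"
  proof (intro eqpoll_Fpow notI)
    assume "finite ((UNIV :: (nat \<Rightarrow>\<^sub>0 nat) set) \<times> (UNIV :: 'a set))"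
    then have "finite (UNIV :: 'a set)" by (rule finite_cartesian_productD2) (rule UNIV_not_empty)
    then show False using inf by contradiction
  qed
  also have "\<dots> \<lesssim> (UNIV :: 'a set)" by (rule mc)
  finally show ?thesis .
qed

subsection \<open>Finitely generated abelian groups\<close>

context comm_group
begin

definition comb :: "'i set \<Rightarrow> ('i \<Rightarrow> 'a) \<Rightarrow> ('i \<Rightarrow> int) \<Rightarrow> 'a" where
  "comb I g c = finprod G (\<lambda>i. g i [^] c i) I"

lemma comb_closed: "g \<in> I \<rightarrow> carrier G \<Longrightarrow> comb I g c \<in> carrier G"
  unfolding comb_def by (intro finprod_closed) auto

lemma comb_cong: "(\<And>i. i \<in> I \<Longrightarrow> g i = g' i) \<Longrightarrow> (\<And>i. i \<in> I \<Longrightarrow> c i = c' i) \<Longrightarrow> g' \<in> I \<rightarrow> carrier G \<Longrightarrow>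
    comb I g c = comb I g' c'"
  unfolding comb_def by (intro finprod_cong') auto

lemma comb_add:
  assumes "g \<in> I \<rightarrow> carrier G"
  shows "comb I g (\<lambda>i. c i + c' i) = comb I g c \<otimes> comb I g c'"
proof -
  have "comb I g (\<lambda>i. c i + c' i) = finprod G (\<lambda>i. g i [^] c i \<otimes> g i [^] c' i) I"
    unfolding comb_def using assms by (intro finprod_cong') (auto simp: int_pow_mult Pi_iff)
  also have "\<dots> = comb I g c \<otimes> comb I g c'"
    unfolding comb_def using assms by (intro finprod_multf) (auto simp: Pi_iff)
  finally show ?thesis .
qed

lemma comb_zero: "(\<And>i. i \<in> I \<Longrightarrow> c i = 0) \<Longrightarrow> comb I g c = \<one>"
  unfolding comb_def by (intro finprod_one_eqI) auto

lemma comb_pow: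
  assumes "finite I" "g \<in> I \<rightarrow> carrier G"
  shows "comb I g c [^] (k::int) = comb I g (\<lambda>i. k * c i)"
  using assms
proof (induction I)
  case empty
  then show ?case by (simp add: comb_def)
next
  case (insert x I)
  then have g: "g \<in> I \<rightarrow> carrier G" "g x \<in> carrier G" by auto
  have "comb (insert x I) g c = g x [^] c x \<otimes> comb I g c" for c
    unfolding comb_def using insert g by (intro finprod_insert) auto
  then show ?case using insert g comb_closed[OF g(1)]
    by (simp add: int_pow_distrib int_pow_pow mult.commute)
qed

lemma comb_minus:
  assumes "finite I" "g \<in> I \<rightarrow> carrier G"
  shows "comb I g (\<lambda>i. - c i) = inv (comb I g c)"
  using comb_pow[OF assms, of c "-1"] comb_closed[OF assms(2)] by (simp add: int_pow_neg)

lemma comb_remove: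
  assumes "finite I" "j \<in> I" "g \<in> I \<rightarrow> carrier G"
  shows "comb I g c = g j [^] c j \<otimes> comb (I - {j}) g c"
proof -
  have "comb (insert j (I - {j})) g c = g j [^] c j \<otimes> comb (I - {j}) g c"
    unfolding comb_def using assms by (intro finprod_insert) auto
  then show ?thesis using assms by (simp add: insert_absorb)
qed

text \<open>Changing one generator amounts to the dual elementary operation on coefficient vectors,
  so spans and relations can be carried back and forth.\<close>

lemma comb_transvection:
  fixes q :: "'i \<Rightarrow> int"
  assumes "finite I" "j \<in> I" "g \<in> I \<rightarrow> carrier G"
  defines "g' \<equiv> g(j := g j \<otimes> comb (I - {j}) g q)"
  shows "comb I g' c = comb I g (\<lambda>i. if i = j then c j else c i + c j * q i)"
proof -
  have gj: "g j \<in> carrier G" "g \<in> (I - {j}) \<rightarrow> carrier G" using assms by auto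
  note cl = comb_closed[OF gj(2)]
  have g': "g' \<in> I \<rightarrow> carrier G" using gj cl assms(3) by (auto simp: g'_def)
  have "comb I g' c = (g j \<otimes> comb (I - {j}) g q) [^] c j \<otimes> comb (I - {j}) g' c"
    using comb_remove[OF assms(1,2) g'] by (simp add: g'_def)
  also have "comb (I - {j}) g' c = comb (I - {j}) g c"
    using gj by (intro comb_cong) (auto simp: g'_def)
  also have "(g j \<otimes> comb (I - {j}) g q) [^] c j = g j [^] c j \<otimes> comb (I - {j}) g (\<lambda>i. c j * q i)"
    using gj cl assms by (simp add: int_pow_distrib comb_pow)
  also have "g j [^] c j \<otimes> comb (I - {j}) g (\<lambda>i. c j * q i) \<otimes> comb (I - {j}) g c =
     g j [^] c j \<otimes> comb (I - {j}) g (\<lambda>i. c i + c j * q i)"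
    using gj cl by (simp add: comb_add m_ac)
  also have "comb (I - {j}) g (\<lambda>i. c i + c j * q i) = comb (I - {j}) g (\<lambda>i. if i = j then c j else c i + c j * q i)"
    using gj by (intro comb_cong) auto
  also have "g j [^] c j \<otimes> \<dots> = comb I g (\<lambda>i. if i = j then c j else c i + c j * q i)"
    using comb_remove[OF assms(1-3), of "\<lambda>i. if i = j then c j else c i + c j * q i"] by simp
  finally show ?thesis .
qed

text \<open>
  Rado's argument: among all generating families with the same span and all their relations, take
  one with the smallest positive coefficient \<open>m\<close>, at \<open>g\<^sub>j\<close> say. Changing \<open>g\<^sub>j\<close> by a transvection
  reduces the other coefficients modulo \<open>m\<close>, hence to zero, so that \<open>g\<^sub>j\<close> splits off as \<open>\<int>/m\<close>.
\<close>

lemma independent_generators: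
  assumes "finite I" "g \<in> I \<rightarrow> carrier G"
  shows "\<exists>g' m. g' \<in> I \<rightarrow> carrier G \<and> range (comb I g') = range (comb I g) \<and>
    (\<forall>c. comb I g' c = \<one> \<longleftrightarrow> (\<forall>i\<in>I. int (m i) dvd c i))"
  using assms
proof (induction "card I" arbitrary: I g rule: less_induct)
  case less
  note fin = less.prems(1) and g = less.prems(2)
  define S where "S = {n. \<exists>g' c j. g' \<in> I \<rightarrow> carrier G \<and> range (comb I g') = range (comb I g) \<and>
     comb I g' c = \<one> \<and> j \<in> I \<and> c j = int n \<and> n > 0}"
  show ?case
  proof (cases "S = {}")
    case True
    have "c i = 0" if c: "comb I g c = \<one>" "i \<in> I" for c i
    proof (rule ccontr)
      assume "c i \<noteq> 0"
      moreover have "nat (c i) \<in> S" if "c i > 0"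
        unfolding S_def using c g that by (intro CollectI exI[of _ g] exI[of _ c] exI[of _ i]) auto
      moreover have "nat (- c i) \<in> S" if "c i < 0"
        unfolding S_def using c g that comb_minus[OF fin g, of c]
        by (intro CollectI exI[of _ g] exI[of _ "\<lambda>i. - c i"] exI[of _ i]) auto
      ultimately show False using True by (meson empty_iff linorder_neqE)
    qed
    \<comment> \<open>There is no nontrivial relation, and modulus \<open>0\<close> expresses this
      because \<open>0\<close> divides only \<open>0\<close>.\<close>
    then show ?thesis using g comb_zero[of I _ g] by (intro exI[of _ g] exI[of _ "\<lambda>_. 0"]) auto
  next
    case False
    define m where "m = (LEAST n. n \<in> S)"
    have "m \<in> S" and least: "\<And>n. n \<in> S \<Longrightarrow> m \<le> n"
      unfolding m_def using False by (auto intro: LeastI Least_le)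
    then obtain h c j where h: "h \<in> I \<rightarrow> carrier G" "range (comb I h) = range (comb I g)"
      "comb I h c = \<one>" "j \<in> I" "c j = int m" "m > 0" unfolding S_def by blast
    have small: "c i = 0" if "g' \<in> I \<rightarrow> carrier G" "range (comb I g') = range (comb I g)"
      "comb I g' c = \<one>" "i \<in> I" "0 \<le> c i" "c i < int m" for g' c i
    proof (rule ccontr)
      assume "c i \<noteq> 0"
      then have "nat (c i) \<in> S" unfolding S_def using that
        by (intro CollectI exI[of _ g'] exI[of _ c] exI[of _ i]) auto
      then show False using least that by force
    qed
    define q where "q = (\<lambda>i. c i div int m)"
    define h' where "h' = h(j := h j \<otimes> comb (I - {j}) h q)"
    have tv: "comb I h' c = comb I h (\<lambda>i. if i = j then c j else c i + c j * q i)" for c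
      unfolding h'_def by (rule comb_transvection[OF fin h(4,1)])
    have hj: "h j \<in> carrier G" "h \<in> I - {j} \<rightarrow> carrier G" using h(1,4) by auto
    have h': "h' \<in> I \<rightarrow> carrier G" unfolding h'_def using h(1) hj comb_closed[OF hj(2)] by auto
    have "comb I h c \<in> range (comb I h')" for c
    proof -
      \<comment> \<open>These coefficients come from the inverse transvection, so the span does not
        shrink.\<close>
      have "comb I h' (\<lambda>i. if i = j then c j else c i - c j * q i) = comb I h c"
        unfolding tv using h by (intro comb_cong) auto
      then show ?thesis by (metis rangeI)
    qed
    then have "range (comb I h) \<subseteq> range (comb I h')" by blast
    moreover have "range (comb I h') \<subseteq> range (comb I h)" unfolding tv by blast
    ultimately have rg: "range (comb I h') = range (comb I g)" unfolding h(2) by (rule antisym[rotated])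
    define c' where "c' = (\<lambda>i. if i = j then int m else c i mod int m)"
    have "comb I h' c' = comb I h c"
      unfolding tv c'_def using h by (intro comb_cong) (auto simp: q_def)
    then have rel: "comb I h' c' = \<one>" using h by simp
    have "c' i = 0" if "i \<in> I - {j}" for i
      using small[OF h' rg rel, of i] that h(6) by (auto simp: c'_def)
    then have "comb (I - {j}) h' c' = \<one>" by (intro comb_zero) auto
    moreover have hj': "h' j \<in> carrier G" using h' h(4) by auto
    ultimately have hm: "h' j [^] int m = \<one>"
      using comb_remove[OF fin h(4) h', of c'] rel by (auto simp: c'_def)
    \<comment> \<open>As \<open>m\<close> kills \<open>h' j\<close>, reducing the coefficient at
      \<open>j\<close> modulo \<open>m\<close> leaves a relation, and minimality of \<open>m\<close>
      makes the remainder zero.\<close>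
    have dvd: "int m dvd c j" if "comb I h' c = \<one>" for c
    proof -
      have hj: "h' j \<in> carrier G" using h' h(4) by auto
      define c1 where "c1 = c(j := c j mod int m)"
      have "h' j [^] (int m * (c j div int m)) = \<one>" using hm int_pow_pow[OF hj, of "int m"] by simp
      then have "h' j [^] (int m * (c j div int m) + c j mod int m) = h' j [^] (c j mod int m)"
        using hj by (subst int_pow_mult) auto
      then have "h' j [^] c j = h' j [^] (c j mod int m)" by simp
      moreover have "comb (I - {j}) h' c1 = comb (I - {j}) h' c"
        using h' by (intro comb_cong) (auto simp: c1_def)
      ultimately have "comb I h' c1 = comb I h' c"
        using comb_remove[OF fin h(4) h'] by (simp add: c1_def)
      then have "c1 j = 0" using small[OF h' rg, of c1 j] that h by (auto simp: c1_def)
      then show ?thesis by (auto simp: c1_def)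
    qed
    have "card (I - {j}) < card I" using fin h(4) by (meson card_Diff1_less)
    moreover have h'': "h' \<in> (I - {j}) \<rightarrow> carrier G" using h' by auto
    ultimately obtain k mm where k: "k \<in> (I - {j}) \<rightarrow> carrier G" "range (comb (I - {j}) k) = range (comb (I - {j}) h')"
      "\<forall>c. comb (I - {j}) k c = \<one> \<longleftrightarrow> (\<forall>i\<in>I - {j}. int (mm i) dvd c i)"
      using less.hyps[of "I - {j}" h'] fin by auto
    define f where "f = k(j := h' j)"
    have f: "f \<in> I \<rightarrow> carrier G" using k h' h(4) by (auto simp: f_def)
    have fI: "comb I f c = h' j [^] c j \<otimes> comb (I - {j}) k c" for c
    proof -
      have "comb (I - {j}) f c = comb (I - {j}) k c" using k by (intro comb_cong) (auto simp: f_def)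
      then show ?thesis using comb_remove[OF fin h(4) f] by (simp add: f_def)
    qed
    have "comb I f c \<in> range (comb I h')" for c
    proof -
      obtain b where b: "comb (I - {j}) k c = comb (I - {j}) h' b" using k(2) by (metis rangeE rangeI)
      also have "\<dots> = comb (I - {j}) h' (b(j := c j))" using h'' by (intro comb_cong) auto
      finally have "comb I f c = comb I h' (b(j := c j))"
        unfolding fI comb_remove[OF fin h(4) h', of "b(j := c j)"] by simp
      then show ?thesis by simp
    qed
    moreover have "comb I h' c \<in> range (comb I f)" for c
    proof -
      obtain b where b: "comb (I - {j}) h' c = comb (I - {j}) k b" using k(2) by (metis rangeE rangeI)
      also have "\<dots> = comb (I - {j}) k (b(j := c j))" using k(1) by (intro comb_cong) auto
      finally have "comb I h' c = comb I f (b(j := c j))"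
        unfolding fI comb_remove[OF fin h(4) h', of c] by simp
      then show ?thesis by simp
    qed
    ultimately have "range (comb I f) = range (comb I h')"
      by (intro subset_antisym image_subsetI)
    then have rf: "range (comb I f) = range (comb I g)" using rg by simp
    have "comb I f c = \<one> \<longleftrightarrow> (\<forall>i\<in>I. int ((mm(j := m)) i) dvd c i)" for c
    proof
      assume 1: "comb I f c = \<one>"
      obtain b where b: "comb (I - {j}) k c = comb (I - {j}) h' b" using k(2) by (metis rangeE rangeI)
      also have "\<dots> = comb (I - {j}) h' (b(j := c j))" using h'' by (intro comb_cong) auto
      finally have "comb I h' (b(j := c j)) = \<one>"
        using 1 unfolding fI comb_remove[OF fin h(4) h', of "b(j := c j)"] by simp
      then have m: "int m dvd c j" using dvd[of "b(j := c j)"] by simp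
      then obtain l where "c j = int m * l" by auto
      then have "h' j [^] c j = \<one>" using hm int_pow_pow[OF hj', of "int m"] by simp
      then have "comb (I - {j}) k c = \<one>" using 1 fI comb_closed[OF k(1)] by simp
      then show "\<forall>i\<in>I. int ((mm(j := m)) i) dvd c i" using m k(3) by auto
    next
      assume d: "\<forall>i\<in>I. int ((mm(j := m)) i) dvd c i"
      have "int m dvd c j" using bspec[OF d h(4)] by simp
      then obtain l where "c j = int m * l" by auto
      then have "h' j [^] c j = \<one>" using hm int_pow_pow[OF hj', of "int m"] by simp
      moreover have "comb (I - {j}) k c = \<one>" using d k(3) by (metis DiffD1 DiffD2 fun_upd_apply singletonI)
      ultimately show "comb I f c = \<one>" using fI by simp
    qed
    then show ?thesis using f rf by blast
  qed
qed

lemma generate_subset_range_comb: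
  assumes "finite I" "g \<in> I \<rightarrow> carrier G"
  shows "generate G (g ` I) \<subseteq> range (comb I g)"
proof
  fix x assume "x \<in> generate G (g ` I)"
  then show "x \<in> range (comb I g)"
  proof induction
    case one
    then show ?case using comb_zero[of I "\<lambda>_. 0" g] by (metis rangeI)
  next
    case (incl h)
    then obtain j where j: "j \<in> I" "h = g j" by auto
    then have "g j \<in> carrier G" using assms(2) by auto
    have "comb (I - {j}) g (\<lambda>i. if i = j then 1 else 0) = \<one>" by (intro comb_zero) auto
    then have "comb I g (\<lambda>i. if i = j then 1 else 0) = h"
      using comb_remove[OF assms(1) j(1) assms(2)] j \<open>g j \<in> carrier G\<close> by auto
    then show ?case by (metis rangeI)
  next
    case (inv h)
    then obtain j where j: "j \<in> I" "h = g j" by auto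
    then have "g j \<in> carrier G" using assms(2) by auto
    have "comb (I - {j}) g (\<lambda>i. if i = j then -1 else 0) = \<one>" by (intro comb_zero) auto
    then have "comb I g (\<lambda>i. if i = j then -1 else 0) = inv h"
      using comb_remove[OF assms(1) j(1) assms(2), of "\<lambda>i. if i = j then -1 else 0"] j \<open>g j \<in> carrier G\<close>
      by (auto simp: int_pow_neg)
    then show ?case by (metis rangeI)
  next
    case (eng h1 h2)
    then obtain c c' where "h1 = comb I g c" "h2 = comb I g c'" by blast
    then have "h1 \<otimes> h2 = comb I g (\<lambda>i. c i + c' i)" using comb_add[OF assms(2)] by simp
    then show ?case by blast
  qed
qed

text \<open>\<open>m i = 0\<close> encodes an infinite cyclic factor and \<open>m i = 1\<close> a
  trivial one.\<close>

theorem finitely_generated_cyclic_decomposition: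
  assumes "finite Y" "Y \<subseteq> carrier G" "generate G Y = carrier G"
  shows "\<exists>(n::nat) g m. g \<in> {1..n} \<rightarrow> carrier G \<and> range (comb {1..n} g) = carrier G \<and>
    (\<forall>c. comb {1..n} g c = \<one> \<longleftrightarrow> (\<forall>i\<in>{1..n}. int (m i) dvd c i))"
proof -
  obtain y where y: "bij_betw y {1..card Y} Y"
    using ex_bij_betw_nat_finite_1[OF assms(1)] by auto
  then have img: "y ` {1..card Y} = Y" by (simp add: bij_betw_def)
  then have yc: "y \<in> {1..card Y} \<rightarrow> carrier G" using assms by auto
  have "carrier G \<subseteq> range (comb {1..card Y} y)"
    using generate_subset_range_comb[OF _ yc] assms(3) img by auto
  then have "range (comb {1..card Y} y) = carrier G" using comb_closed[OF yc] by auto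
  then show ?thesis using independent_generators[OF _ yc] by auto
qed

end

subsection \<open>Generated subalgebras\<close>

lemma ring_of_type_algebra_simps [simp]:
  "x \<otimes>\<^bsub>ring_of_type_algebra\<^esub> y = x * y" "x \<oplus>\<^bsub>ring_of_type_algebra\<^esub> y = x + y"
  "\<one>\<^bsub>ring_of_type_algebra\<^esub> = 1" "\<zero>\<^bsub>ring_of_type_algebra\<^esub> = 0" "carrier ring_of_type_algebra = UNIV"
  by (auto simp: ring_of_type_algebra_def)

lemma a_inv_ring_of_type_algebra [simp]: "\<ominus>\<^bsub>ring_of_type_algebra\<^esub> x = - (x :: 'f::field)"
proof -
  interpret ring "ring_of_type_algebra :: 'f ring" by (rule ring_from_type_algebra)
  show ?thesis by (intro minus_equality) auto
qed

lemma subalgebra_gen_subring: "is_subring (subalgebra_gen H)"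
  unfolding is_subring_def subalgebra_gen_def
proof (intro conjI ballI)
  let ?R = "ring_of_type_algebra :: 'a ratfun ring"
  let ?G = "generate_ring ?R (range const \<union> H)"
  show "1 \<in> ?G" using generate_ring.one[of ?R] by simp
  fix x y assume xy: "x \<in> ?G" "y \<in> ?G"
  have "x + - y \<in> ?G" using generate_ring.eng_add[OF xy(1) generate_ring.a_inv[OF xy(2)]] by simp
  then show "x - y \<in> ?G" by simp
  show "x * y \<in> ?G" using generate_ring.eng_mult[OF xy] by simp
qed

lemma subalgebra_gen_const: "const c \<in> subalgebra_gen H"
  unfolding subalgebra_gen_def by (rule generate_ring.incl) simp

lemma subalgebra_gen_incl: "x \<in> H \<Longrightarrow> x \<in> subalgebra_gen H"
  unfolding subalgebra_gen_def by (rule generate_ring.incl) simp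

lemma subalgebra_gen_least:
  assumes S: "is_subring S" and "range const \<subseteq> S" "H \<subseteq> S"
  shows "subalgebra_gen H \<subseteq> S"
proof
  fix x assume "x \<in> subalgebra_gen H"
  then show "x \<in> S" unfolding subalgebra_gen_def
  proof induction
    case one
    then show ?case using is_subring_closed(1)[OF S] by simp
  next
    case (incl h)
    then show ?case using assms by auto
  next
    case (a_inv h)
    then show ?case using is_subring_closed(5)[OF S] by simp
  next
    case (eng_add h1 h2)
    then show ?case using is_subring_closed(6)[OF S] by simp
  next
    case (eng_mult h1 h2)
    then show ?case using is_subring_closed(4)[OF S] by simp
  qed
qed

subsection \<open>Homogenization\<close>

text \<open>This is the shape of an exchange polynomial whose column of \<open>\<beta>\<close> has
  \<open>1\<close> and \<open>-1\<close> as its only nonzero entries.\<close>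

definition homogenize :: "nat \<Rightarrow> 'a::idom poly \<Rightarrow> 'a ratfun \<Rightarrow> 'a ratfun \<Rightarrow> 'a ratfun" where
  "homogenize d q u v = (\<Sum>j=0..d. const (coeff q j) * u ^ j * v ^ (d - j))"

lemma homogenize_linear_mult:
  assumes "degree q \<le> d"
  shows "homogenize (Suc d) ([:- a, 1:] * q) u v = (u - const a * v) * homogenize d q u v"
proof -
  have s: "homogenize (Suc d) (pCons 0 q) u v = u * homogenize d q u v"
    unfolding homogenize_def sum.atLeast0_atMost_Suc_shift
    by (simp add: const_hom.hom_0 sum_distrib_left mult_ac)
  have m: "const (- b) = - const b" for b :: 'a
    using const_hom.hom_add[of b "- b"] by (simp add: const_hom.hom_0 eq_neg_iff_add_eq_0 add.commute)
  have "coeff q (Suc d) = 0" using assms by (intro coeff_eq_0) auto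
  then have t: "homogenize (Suc d) (smult (- a) q) u v = - const a * v * homogenize d q u v"
  proof -
    have "homogenize (Suc d) (smult (- a) q) u v = (\<Sum>j=0..d. const (coeff (smult (- a) q) j) * u ^ j * v ^ (Suc d - j))"
      using \<open>coeff q (Suc d) = 0\<close> by (simp add: homogenize_def const_hom.hom_0)
    also have "\<dots> = (\<Sum>j=0..d. (- const a * v) * (const (coeff q j) * u ^ j * v ^ (d - j)))"
      by (intro sum.cong) (auto simp: const_hom.hom_mult m Suc_diff_le)
    finally show ?thesis by (simp add: homogenize_def sum_distrib_left)
  qed
  have "homogenize (Suc d) (p + q) u v = homogenize (Suc d) p u v + homogenize (Suc d) q u v" for p q
    by (simp add: homogenize_def const_hom.hom_add distrib_right sum.distrib)
  moreover have "[:- a, 1:] * q = smult (- a) q + pCons 0 q" by simp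
  ultimately have "homogenize (Suc d) ([:- a, 1:] * q) u v = - const a * v * homogenize d q u v + u * homogenize d q u v"
    using s t by metis
  then show ?thesis by (simp add: algebra_simps)
qed

lemma homogenize_linear_power_mult:
  assumes "degree q \<le> d"
  shows "homogenize (m + d) ([:- a, 1:] ^ m * q) u v = (u - const a * v) ^ m * homogenize d q u v"
proof (induction m)
  case (Suc m)
  have "degree ([:- a, 1:] ^ m * q) \<le> m + d"
    using assms degree_mult_le[of "[:- a, 1:] ^ m" q] degree_power_le[of "[:- a, 1:]" m] by auto
  from homogenize_linear_mult[OF this, of a u v] show ?case
    using Suc by (simp only: power_Suc mult.assoc add_Suc)
qed simp

text \<open>Each root \<open>a\<close> turns into a linear factor \<open>u - const a * v\<close>; in
  this way an exchange polynomial, given as a sum, becomes a product.\<close>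

lemma homogenize_two_roots:
  "homogenize (m + k) ([:- a, 1:] ^ m * [:- b, 1:] ^ k) u v = (u - const a * v) ^ m * (u - const b * v) ^ k"
proof -
  have "homogenize 0 1 u v = 1" by (simp add: homogenize_def const_hom.hom_1)
  then have "homogenize (k + 0) ([:- b, 1:] ^ k * 1) u v = (u - const b * v) ^ k"
    using homogenize_linear_power_mult[of 1 0 k b u v] by simp
  moreover have "degree ([:- b, 1:] ^ k) \<le> k" using degree_power_le[of "[:- b, 1:]" k] by simp
  ultimately show ?thesis using homogenize_linear_power_mult[of "[:- b, 1:] ^ k" k m a u v] by simp
qed

subsection \<open>The seed\<close>

text \<open>
  Block \<open>i\<close> consists of the cluster variable \<open>x\<^sub>i = X\<^sub>i\<close> and two frozen variables \<open>u\<^sub>i\<close>, \<open>v\<^sub>i\<close>, which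
  are linear forms in \<open>s\<^sub>i = X\<^bsub>n+i\<^esub>\<close> and \<open>r\<^sub>i = X\<^bsub>2n+i\<^esub>\<close> such that \<open>s\<^sub>i = u\<^sub>i - \<alpha>\<^sub>i v\<^sub>i\<close> and
  \<open>r\<^sub>i = u\<^sub>i - (\<alpha>\<^sub>i + 1) v\<^sub>i\<close>. With the right coefficients \<open>\<rho>\<^sub>i\<^sub>,\<^sub>j\<close> the exchange polynomial
  is \<open>s\<^sub>i^e\<^sub>i r\<^sub>i^e'\<^sub>i\<close>. The condition on \<open>\<alpha>\<^sub>i\<close> expresses \<open>\<rho>\<^sub>i\<^sub>,\<^sub>0 = 1\<close>. One further frozen variable is not
  used by the exchange polynomials; it makes it easy to write down prime elements.
\<close>

locale block_seed =
  fixes n :: nat and e e' :: "nat \<Rightarrow> nat" and \<alpha> :: "nat \<Rightarrow> 'a::field_char_0"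
  assumes e_pos: "i \<in> {1..n} \<Longrightarrow> 0 < e i"
    and root: "i \<in> {1..n} \<Longrightarrow> (- \<alpha> i) ^ e i * (- (\<alpha> i + 1)) ^ e' i = 1"
begin

abbreviation "V \<equiv> n + (2 * n + 1)"
abbreviation "d i \<equiv> e i + e' i"
abbreviation "x i \<equiv> rvar i :: 'a ratfun"
abbreviation "s i \<equiv> rvar (n + i) :: 'a ratfun"
abbreviation "r i \<equiv> rvar (2 * n + i) :: 'a ratfun"
abbreviation "t \<equiv> rvar (3 * n + 1) :: 'a ratfun"
abbreviation "C \<equiv> Poly_Mapping.single 0 :: 'a \<Rightarrow> 'a mpoly"

text \<open>Solving \<open>s = u - \<alpha> v\<close> and \<open>r = u - (\<alpha> + 1) v\<close>
  gives \<open>v = s - r\<close> and \<open>u = (\<alpha> + 1) s - \<alpha> r\<close>. The second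
  branch is \<open>u\<close>, with \<open>r\<close> at index \<open>k + n\<close>; the third is
  \<open>v\<close>, with \<open>s\<close> at index \<open>k - n\<close>.\<close>

definition clus_poly :: "nat \<Rightarrow> 'a mpoly" where
  "clus_poly k = (if k \<le> n then mvar k
     else if k \<le> 2 * n then C (\<alpha> (k - n) + 1) * mvar k - C (\<alpha> (k - n)) * mvar (k + n)
     else if k \<le> 3 * n then mvar (k - n) - mvar k
     else mvar k)"

definition clus :: "nat \<Rightarrow> 'a ratfun" where "clus k = Fract (clus_poly k) 1"

definition f :: "nat \<Rightarrow> 'a ratfun" where "f i = s i ^ e i * r i ^ e' i"

text \<open>Its coefficients are the exchange coefficients: it is monic, and \<open>root\<close>
  says that its constant term is \<open>1\<close>.\<close>

definition q :: "nat \<Rightarrow> 'a poly" where "q i = [:- \<alpha> i, 1:] ^ e i * [:- (\<alpha> i + 1), 1:] ^ e' i"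

text \<open>Column \<open>l\<close> is \<open>d l\<close> at \<open>u\<close>, \<open>- d l\<close>
  at \<open>v\<close> and \<open>0\<close> elsewhere, so after division by \<open>d l\<close> the
  exchange polynomial is a form of degree \<open>d l\<close> in these two frozen variables. The
  square part of the matrix is zero.\<close>

definition seed :: "'a gen_seed" where
  "seed = \<lparr>cluster = clus, coeffs = (\<lambda>i j. const (coeff (q i) j)),
     exch = (\<lambda>k l. if k = n + l then int (d l) else if k = 2 * n + l then - int (d l) else 0)\<rparr>"

lemma clus_simps:
  "i \<in> {1..n} \<Longrightarrow> clus i = x i"
  "i \<in> {1..n} \<Longrightarrow> clus (n + i) = const (\<alpha> i + 1) * s i - const (\<alpha> i) * r i"
  "i \<in> {1..n} \<Longrightarrow> clus (2 * n + i) = s i - r i"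
  "clus (3 * n + 1) = t"
  by (auto simp: clus_def clus_poly_def rvar_def const_def mult_2 add_ac)

lemma s_eq:
  assumes "i \<in> {1..n}"
  shows "s i = clus (n + i) - const (\<alpha> i) * clus (2 * n + i)"
  unfolding clus_simps(2)[OF assms] clus_simps(3)[OF assms]
  by (simp add: const_hom.hom_add const_hom.hom_1 algebra_simps)

lemma r_eq:
  assumes "i \<in> {1..n}"
  shows "r i = clus (n + i) - const (\<alpha> i + 1) * clus (2 * n + i)"
  unfolding clus_simps(2)[OF assms] clus_simps(3)[OF assms]
  by (simp add: const_hom.hom_add const_hom.hom_1 algebra_simps)

lemma block_cases:
  assumes "k \<in> {1..V}"
  obtains (x) "k \<in> {1..n}" | (u) i where "i \<in> {1..n}" "k = n + i"
    | (v) i where "i \<in> {1..n}" "k = 2 * n + i" | (t) "k = 3 * n + 1"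
proof -
  consider "k \<le> n" | "n < k" "k \<le> 2 * n" | "2 * n < k" "k \<le> 3 * n" | "k = 3 * n + 1" using assms by force
  then show ?thesis
  proof cases
    case 2
    then show ?thesis using u[of "k - n"] by auto
  next
    case 3
    then show ?thesis using v[of "k - 2 * n"] by auto
  qed (use assms x t in auto)
qed

lemma clus_poly_mpolys: "k \<in> {1..V} \<Longrightarrow> clus_poly k \<in> mpolys V"
  by (auto simp: clus_poly_def intro!: mpolys_closed)

lemma clus_mring: "k \<in> {1..V} \<Longrightarrow> clus k \<in> mring V"
  unfolding clus_def mring_def using clus_poly_mpolys by blast

lemma alg_independent_clus: "alg_independent V clus"
proof (rule alg_independent_substitution[of V _ clus_poly])
  \<comment> \<open>The inverse substitution: \<open>s\<close> and \<open>r\<close> expressed in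
    \<open>u\<close> and \<open>v\<close>.\<close>
  define Q where "Q k = (if k \<le> n then mvar k
     else if k \<le> 2 * n then mvar k - C (\<alpha> (k - n)) * mvar (k + n)
     else if k \<le> 3 * n then mvar (k - n) - C (\<alpha> (k - 2 * n) + 1) * mvar k
     else mvar k)" for k
  have C1: "C (a + 1) = C a + 1" for a by (simp add: single_add)
  have ev: "eval_hom C Q (mvar k) = Q k" "eval_hom C Q (C a) = C a" for k a
    using single_hom.eval_hom_single[of Q "Poly_Mapping.single k 1" 1] single_hom.eval_hom_single[of Q 0 a]
    by (simp_all add: mvar_def)
  have neg: "eval_hom C Q (a - b) = eval_hom C Q a - eval_hom C Q b" for a b
    using single_hom.eval_hom_add[of Q "a - b" b] by (simp add: algebra_simps)
  fix k assume "k \<in> {1..V}"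
  then show "eval_hom C Q (clus_poly k) = mvar k"
  proof (cases rule: block_cases)
    case (u i)
    then have "clus_poly k = C (\<alpha> i + 1) * mvar (n + i) - C (\<alpha> i) * mvar (2 * n + i)"
      "Q (n + i) = mvar (n + i) - C (\<alpha> i) * mvar (2 * n + i)"
      "Q (2 * n + i) = mvar (n + i) - C (\<alpha> i + 1) * mvar (2 * n + i)"
      by (auto simp: clus_poly_def Q_def mult_2 add_ac)
    note Qeq = this
    have "eval_hom C Q (clus_poly k) = C (\<alpha> i + 1) * Q (n + i) - C (\<alpha> i) * Q (2 * n + i)"
      unfolding Qeq(1) neg single_hom.eval_hom_mult ev ..
    also have "\<dots> = mvar (n + i)" unfolding Qeq(2,3) C1 by (simp add: algebra_simps)
    finally show ?thesis using u by simp
  next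
    case (v i)
    then have "clus_poly k = mvar (n + i) - mvar (2 * n + i)"
      "Q (n + i) = mvar (n + i) - C (\<alpha> i) * mvar (2 * n + i)"
      "Q (2 * n + i) = mvar (n + i) - C (\<alpha> i + 1) * mvar (2 * n + i)"
      by (auto simp: clus_poly_def Q_def mult_2 add_ac)
    note Qeq = this
    have "eval_hom C Q (clus_poly k) = Q (n + i) - Q (2 * n + i)"
      unfolding Qeq(1) neg single_hom.eval_hom_mult ev ..
    also have "\<dots> = mvar (2 * n + i)" unfolding Qeq(2,3) C1 by (simp add: algebra_simps)
    finally show ?thesis using v by simp
  qed (auto simp: clus_poly_def Q_def ev)
qed (simp add: clus_def)

lemma degree_q: "degree (q i) = d i"
  unfolding q_def by (simp add: degree_mult_eq degree_linear_power)

lemma lead_coeff_q: "lead_coeff (q i) = 1"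
  unfolding q_def lead_coeff_mult lead_coeff_power by simp

lemma coeff_q: "i \<in> {1..n} \<Longrightarrow> coeff (q i) 0 = 1" "coeff (q i) (d i) = 1"
proof -
  show "i \<in> {1..n} \<Longrightarrow> coeff (q i) 0 = 1" using root[of i] by (simp add: q_def coeff_mult coeff_0_power)
  show "coeff (q i) (d i) = 1" using lead_coeff_q[of i] by (simp add: degree_q)
qed

lemma mring_subset_ratfun_field: "mring N \<subseteq> (ratfun_field N :: 'a ratfun set)"
  using factorial_subring.PQ[OF factorial_subring.intro[OF mring_factorial]] by (simp add: quotient_field_mring)

lemma is_gen_seed: "is_gen_seed n (2 * n + 1) d seed"
  unfolding is_gen_seed_def
proof (intro conjI ballI)
  show "cluster seed k \<in> ratfun_field V" if "k \<in> {1..V}" for k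
    using clus_mring[OF that] mring_subset_ratfun_field by (auto simp: seed_def)
  show "alg_independent V (cluster seed)" using alg_independent_clus by (simp add: seed_def)
  show "skew_symmetrizable n (exch seed)"
    unfolding skew_symmetrizable_def by (rule exI[of _ "\<lambda>_. 1"]) (auto simp: seed_def)
  fix i assume i: "i \<in> {1..n}"
  show "0 < d i" using e_pos[OF i] by simp
  show "coeffs seed i 0 = 1" "coeffs seed i (d i) = 1"
    using coeff_q[of i] i by (simp_all add: seed_def const_hom.hom_1)
  \<comment> \<open>The coefficients are constants, that is, monomials with all exponents
    \<open>0\<close>.\<close>
  show "\<exists>c k'. coeffs seed i j = const c * (\<Prod>k = n + 1..V. cluster seed k ^ k' k)" for j
    by (rule exI[of _ "coeff (q i) j"], rule exI[of _ "\<lambda>_. 0"]) (simp add: seed_def)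
  show "int (d i) dvd exch seed j i" for j by (simp add: seed_def del: of_nat_add)
qed (auto simp: seed_def)

lemma acyclic_seed: "acyclic_seed n seed"
proof -
  have "{(i, j). i \<in> {1..n} \<and> j \<in> {1..n} \<and> 0 < exch seed i j} = {}" by (auto simp: seed_def)
  then show ?thesis unfolding acyclic_seed_def by (simp only: acyclic_def) simp
qed

text \<open>
  The block structure makes mutation trivial: it flips the sign of a column and exchanges
  \<open>x\<^sub>i\<close> and \<open>f\<^sub>i / x\<^sub>i\<close>; \<open>\<epsilon> i\<close> tells whether the direction \<open>i\<close> is in its initial state.
\<close>

definition mutated :: "(nat \<Rightarrow> bool) \<Rightarrow> 'a gen_seed \<Rightarrow> bool" where
  "mutated \<epsilon> T \<longleftrightarrow>
     (\<forall>k\<in>{1..V}. \<forall>l\<in>{1..n}. exch T k l = (if \<epsilon> l then 1 else - 1) * exch seed k l) \<and>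
     (\<forall>i\<in>{1..n}. \<forall>j\<le>d i. coeffs T i j = coeffs seed i (if \<epsilon> i then j else d i - j)) \<and>
     (\<forall>k\<in>{n + 1..V}. cluster T k = clus k) \<and>
     (\<forall>i\<in>{1..n}. cluster T i = (if \<epsilon> i then x i else f i / x i))"

lemma rvar_nonzero: "(rvar k :: 'a ratfun) \<noteq> 0"
  by (simp add: rvar_def mvar_nonzero)

lemma f_homogenize:
  assumes "i \<in> {1..n}"
  shows "f i = homogenize (d i) (q i) (clus (n + i)) (clus (2 * n + i))"
  unfolding q_def homogenize_two_roots f_def using s_eq[OF assms] r_eq[OF assms] by simp

text \<open>Changing the sign of column \<open>i\<close> interchanges the roles of \<open>u\<close>
  and \<open>v\<close>, and reversing the coefficients undoes this; in the mutated state the same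
  sum is merely run through backwards.\<close>

lemma exch_poly_mutated:
  assumes T: "mutated \<epsilon> T" and i: "i \<in> {1..n}"
  shows "exch_poly n (2 * n + 1) d T i = f i"
proof -
  have di: "0 < d i" using e_pos[OF i] by simp
  define \<sigma> :: int where "\<sigma> = (if \<epsilon> i then 1 else - 1)"
  define \<beta> where "\<beta> k = exch T k i div int (d i)" for k
  have \<beta>: "\<beta> k = (if k = n + i then \<sigma> else if k = 2 * n + i then - \<sigma> else 0)" if "k \<in> {1..V}" for k
  proof -
    have "exch T k i = \<sigma> * exch seed k i" using T i that by (auto simp: mutated_def \<sigma>_def)
    moreover have "- int (d i) div int (d i) = - 1"
    proof -
      have "int (d i) \<noteq> 0" using di by linarith
      from nonzero_mult_div_cancel_left[OF this, of "- 1"] show ?thesis by (simp del: of_nat_add)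
    qed
    ultimately show ?thesis using di i unfolding \<beta>_def by (auto simp: seed_def \<sigma>_def simp del: of_nat_add)
  qed
  have cl: "cluster T (n + i) = clus (n + i)" "cluster T (2 * n + i) = clus (2 * n + i)"
    using T i by (auto simp: mutated_def)
  let ?E = "\<lambda>j k. nat (int j * pos_part (\<beta> k) + (int (d i) - int j) * pos_part (- \<beta> k))"
  have pr: "(\<Prod>k = 1..V. cluster T k ^ ?E j k) = clus (n + i) ^ ?E j (n + i) * clus (2 * n + i) ^ ?E j (2 * n + i)" for j
  proof -
    have "(\<Prod>k = 1..V. cluster T k ^ ?E j k) = (\<Prod>k\<in>{n + i, 2 * n + i}. cluster T k ^ ?E j k)"
    proof (rule prod.mono_neutral_right)
      show "\<forall>k\<in>{1..V} - {n + i, 2 * n + i}. cluster T k ^ ?E j k = 1"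
        using \<beta> by (auto simp: pos_part_def)
    qed (use i in auto)
    then show ?thesis using i cl by simp
  qed
  have b: "\<beta> (n + i) = \<sigma>" "\<beta> (2 * n + i) = - \<sigma>" using \<beta>[of "n + i"] \<beta>[of "2 * n + i"] i by auto
  have "exch_poly n (2 * n + 1) d T i =
      (\<Sum>j = 0..d i. coeffs T i j * (clus (n + i) ^ ?E j (n + i) * clus (2 * n + i) ^ ?E j (2 * n + i)))"
    unfolding exch_poly_def Let_def \<beta>_def[symmetric] pr ..
  also have "\<dots> = (\<Sum>j = 0..d i. const (coeff (q i) (if \<epsilon> i then j else d i - j)) *
      clus (n + i) ^ (if \<epsilon> i then j else d i - j) * clus (2 * n + i) ^ (d i - (if \<epsilon> i then j else d i - j)))"
  proof (rule sum.cong)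
    fix j assume j: "j \<in> {0..d i}"
    have "coeffs T i j = const (coeff (q i) (if \<epsilon> i then j else d i - j))"
      using T i j by (auto simp: mutated_def seed_def)
    moreover have "?E j (n + i) = (if \<epsilon> i then j else d i - j)" "?E j (2 * n + i) = d i - (if \<epsilon> i then j else d i - j)"
      unfolding b using j by (auto simp: \<sigma>_def pos_part_def nat_diff_distrib)
    ultimately show "coeffs T i j * (clus (n + i) ^ ?E j (n + i) * clus (2 * n + i) ^ ?E j (2 * n + i)) =
      const (coeff (q i) (if \<epsilon> i then j else d i - j)) *
      clus (n + i) ^ (if \<epsilon> i then j else d i - j) * clus (2 * n + i) ^ (d i - (if \<epsilon> i then j else d i - j))"
      by (simp only: mult.assoc)
  qed simp
  also have "\<dots> = (\<Sum>j = 0..d i. const (coeff (q i) j) * clus (n + i) ^ j * clus (2 * n + i) ^ (d i - j))"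
  proof (cases "\<epsilon> i")
    case False
    then show ?thesis
      using sum.atLeastAtMost_rev[of "\<lambda>j. const (coeff (q i) j) * clus (n + i) ^ j * clus (2 * n + i) ^ (d i - j)" 0 "d i"]
      by simp
  qed simp
  also have "\<dots> = f i" unfolding f_homogenize[OF i] homogenize_def ..
  finally show ?thesis .
qed

lemma mutation_class_mutated:
  assumes "T \<in> mutation_class n (2 * n + 1) d seed"
  shows "\<exists>\<epsilon>. mutated \<epsilon> T"
  using assms
proof induction
  case refl
  have "mutated (\<lambda>_. True) seed"
    unfolding mutated_def using clus_simps(1) by (auto simp: seed_def)
  then show ?case by blast
next
  case (step T i)
  then obtain \<epsilon> where T: "mutated \<epsilon> T" by auto
  note i = step.hyps(2)
  have fi: "exch_poly n (2 * n + 1) d T i = f i" by (rule exch_poly_mutated[OF T i])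
  have f0: "f i \<noteq> 0" by (simp add: f_def rvar_nonzero)
  define T' where "T' = mutate n (2 * n + 1) d i T"
  \<comment> \<open>The square part stays zero, so mutation in direction \<open>i\<close> touches no
    column but \<open>i\<close>.\<close>
  have z: "exch T k l = 0" if "k \<in> {1..n}" "l \<in> {1..n}" for k l
    using T that by (auto simp: mutated_def seed_def)
  have "mutated (\<epsilon>(i := \<not> \<epsilon> i)) T'"
    unfolding mutated_def
  proof (intro conjI ballI allI impI)
    fix k l assume kl: "k \<in> {1..V}" "l \<in> {1..n}"
    have "exch T' k l = (if l = i then - exch T k l else exch T k l)"
      using z[OF i kl(2)] z[of k l] kl i by (auto simp: T'_def mutate_def mutate_exch_def pos_part_def)
    then show "exch T' k l = (if (\<epsilon>(i := \<not> \<epsilon> i)) l then 1 else - 1) * exch seed k l"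
      using T kl by (auto simp: mutated_def)
  next
    fix l j assume l: "l \<in> {1..n}" and j: "j \<le> d l"
    show "coeffs T' l j = coeffs seed l (if (\<epsilon>(i := \<not> \<epsilon> i)) l then j else d l - j)"
      using T l j by (auto simp: T'_def mutate_def mutated_def)
  next
    fix k assume "k \<in> {n + 1..V}"
    then show "cluster T' k = clus k" using T i by (auto simp: T'_def mutate_def mutated_def)
  next
    fix l assume l: "l \<in> {1..n}"
    then show "cluster T' l = (if (\<epsilon>(i := \<not> \<epsilon> i)) l then x l else f l / x l)"
      using T i fi f0 by (auto simp: T'_def mutate_def mutated_def rvar_nonzero)
  qed
  then show ?case unfolding T'_def by blast
qed

section \<open>Generators of the cluster algebra\<close>

definition algebra :: "'a ratfun set" where
  "algebra = gen_cluster_algebra n (2 * n + 1) d seed"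

lemma algebra_subring: "is_subring algebra"
  unfolding algebra_def gen_cluster_algebra_def by (rule subalgebra_gen_subring)

lemma algebra_const: "const c \<in> algebra"
  unfolding algebra_def gen_cluster_algebra_def by (rule subalgebra_gen_const)

lemma algebra_frozen: "k \<in> {n + 1..V} \<Longrightarrow> clus k \<in> algebra" "k \<in> {n + 1..V} \<Longrightarrow> inverse (clus k) \<in> algebra"
  unfolding algebra_def gen_cluster_algebra_def
  by (intro subalgebra_gen_incl; force simp: seed_def)+

lemma algebra_cluster: "i \<in> {1..n} \<Longrightarrow> x i \<in> algebra" "i \<in> {1..n} \<Longrightarrow> f i / x i \<in> algebra"
proof -
  assume i: "i \<in> {1..n}"
  have *: "cluster T i \<in> algebra" if "T \<in> mutation_class n (2 * n + 1) d seed" for T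
    unfolding algebra_def gen_cluster_algebra_def using that i by (intro subalgebra_gen_incl) blast
  have m: "mutated (\<lambda>_. True) seed"
    unfolding mutated_def using clus_simps(1) by (auto simp: seed_def)
  show "x i \<in> algebra" using *[OF mutation_class.refl] clus_simps(1)[OF i] by (simp add: seed_def)
  show "f i / x i \<in> algebra"
    using *[OF mutation_class.step[OF mutation_class.refl i]] exch_poly_mutated[OF m i] clus_simps(1)[OF i]
    by (simp add: mutate_def seed_def)
qed

text \<open>Every seed of the class is \<open>mutated\<close>, so besides frozen variables and their
  inverses only \<open>x i\<close> and \<open>f i / x i\<close> occur as generators.\<close>

lemma algebra_subset:
  assumes "is_subring S" "range const \<subseteq> S" "\<And>k. k \<in> {n + 1..V} \<Longrightarrow> clus k \<in> S \<and> inverse (clus k) \<in> S"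
    "\<And>i. i \<in> {1..n} \<Longrightarrow> x i \<in> S \<and> f i / x i \<in> S"
  shows "algebra \<subseteq> S"
  unfolding algebra_def gen_cluster_algebra_def
proof (rule subalgebra_gen_least[OF assms(1,2)])
  have "cluster T i \<in> S" if "T \<in> mutation_class n (2 * n + 1) d seed" "i \<in> {1..n}" for T i
    using mutation_class_mutated[OF that(1)] assms(4)[OF that(2)] that(2) by (auto simp: mutated_def)
  then show "{cluster seed k |k. k \<in> {n + 1..V}} \<union> {inverse (cluster seed k) |k. k \<in> {n + 1..V}} \<union>
    {cluster T i |T i. T \<in> mutation_class n (2 * n + 1) d seed \<and> i \<in> {1..n}} \<subseteq> S"
    using assms(3) by (auto simp: seed_def)
qed

lemma algebra_coordinates: "i \<in> {1..n} \<Longrightarrow> s i \<in> algebra" "i \<in> {1..n} \<Longrightarrow> r i \<in> algebra"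
  unfolding s_eq r_eq
  by (intro is_subring_closed(3,4)[OF algebra_subring] algebra_const algebra_frozen; simp)+

text \<open>The coordinate change is linear and invertible over the ground field, so coprimality may
  be tested in the polynomial ring in the variables \<open>rvar k\<close>.\<close>

lemma subalgebra_gen_clus: "subalgebra_gen (clus ` {1..V}) = mring V"
proof
  show "subalgebra_gen (clus ` {1..V}) \<subseteq> mring V"
    using const_in_mring clus_mring by (intro subalgebra_gen_least mring_subring) auto
  show "mring V \<subseteq> subalgebra_gen (clus ` {1..V})"
  proof (rule mring_generated[OF subalgebra_gen_subring])
    let ?S = "subalgebra_gen (clus ` {1..V})"
    show "range const \<subseteq> ?S" using subalgebra_gen_const by blast
    fix k assume "k \<in> {1..V}"
    then show "rvar k \<in> ?S"
    proof (cases rule: block_cases)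
      case x
      have "clus k \<in> ?S" using x by (intro subalgebra_gen_incl imageI) auto
      then show ?thesis using clus_simps(1)[OF x] by simp
    next
      case (u i)
      have "clus (n + i) - const (\<alpha> i) * clus (2 * n + i) \<in> ?S" using u(1)
        by (intro is_subring_closed(3,4)[OF subalgebra_gen_subring] subalgebra_gen_const subalgebra_gen_incl imageI) auto
      then show ?thesis using s_eq[OF u(1)] u(2) by simp
    next
      case (v i)
      have "clus (n + i) - const (\<alpha> i + 1) * clus (2 * n + i) \<in> ?S" using v(1)
        by (intro is_subring_closed(3,4)[OF subalgebra_gen_subring] subalgebra_gen_const subalgebra_gen_incl imageI) auto
      then show ?thesis using r_eq[OF v(1)] v(2) by simp
    next
      case t
      have "clus k \<in> ?S" using t by (intro subalgebra_gen_incl imageI) auto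
      then show ?thesis using clus_simps(4) t by simp
    qed
  qed
qed

section \<open>Coprimality of the exchange polynomials\<close>

lemma wval_nonneg: "z \<in> mring N \<Longrightarrow> z \<noteq> 0 \<Longrightarrow> 0 \<le> wval \<omega> (z :: 'a ratfun)"
  by (auto simp: mring_def wval_Fract_1)

lemma wval_field: "valued_field UNIV (wval \<omega> :: 'a ratfun \<Rightarrow> int)"
  by unfold_locales (auto simp: is_subring_def wval_valuation)

text \<open>The valuation that gives weight \<open>1\<close> to \<open>rvar k\<close> alone is
  \<open>-1\<close> on this quotient but nonnegative on polynomials.\<close>

lemma rvar_not_dvd: "k \<noteq> l \<Longrightarrow> rvar l / rvar k \<notin> (mring N :: 'a ratfun set)"
proof
  assume kl: "k \<noteq> l" and m: "rvar l / rvar k \<in> (mring N :: 'a ratfun set)"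
  define \<omega> :: "nat \<Rightarrow> nat" where "\<omega> = (\<lambda>i. if i = k then 1 else 0)"
  have "wval \<omega> (rvar l / rvar k :: 'a ratfun) = wval \<omega> (rvar l :: 'a ratfun) - wval \<omega> (rvar k :: 'a ratfun)"
    by (rule valued_field.val_divide[OF wval_field]) (simp_all add: rvar_nonzero)
  also have "\<dots> = - 1" using kl by (simp add: wval_rvar \<omega>_def)
  finally show False using wval_nonneg[OF m, of \<omega>] by (simp add: rvar_nonzero)
qed

lemma prime_dvd_rvar_unique:
  assumes p: "prime_on (mring N) (p :: 'a ratfun)" and "k \<in> {1..N}" "l \<in> {1..N}"
    and k: "rvar k / p \<in> mring N" and l: "rvar l / p \<in> mring N"
  shows "k = l"
proof (rule ccontr)
  assume "k \<noteq> l"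
  note P = mring_subring[of N, where 'a = 'a]
  have "unit_on (mring N) (rvar k / p)"
    using var_prime[OF assms(2)] by (rule prime_dvd_prime[OF P _ p k])
  then have "inverse (rvar k / p) * (rvar l / p) \<in> mring N" using l is_subring_closed(4)[OF P] unit_onD(3) by blast
  moreover have "inverse (rvar k / p) * (rvar l / p) = rvar l / rvar k" using prime_onD(2)[OF p] by (simp add: field_simps)
  ultimately show False using rvar_not_dvd[OF \<open>k \<noteq> l\<close>] by simp
qed

text \<open>Exchange polynomials of different blocks are monomials in different variables, and a
  prime divides at most one variable.\<close>

lemma coprime_seed: "coprime_seed n (2 * n + 1) d seed"
  unfolding coprime_seed_def coprime_in_def
proof (intro ballI impI)
  have m: "mutated (\<lambda>_. True) seed"
    unfolding mutated_def using clus_simps(1) by (auto simp: seed_def)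
  have R: "subring_on (subalgebra_gen (cluster seed ` {1..V})) = subring_on (mring V)"
    using subalgebra_gen_clus by (simp add: seed_def)
  note P = mring_subring[of V, where 'a = 'a]
  fix i j h assume i: "i \<in> {1..n}" and j: "j \<in> {1..n}" and ij: "i \<noteq> j"
    and h: "h \<in> carrier (subring_on (subalgebra_gen (cluster seed ` {1..V})))"
    and hd: "h divides\<^bsub>subring_on (subalgebra_gen (cluster seed ` {1..V}))\<^esub> exch_poly n (2 * n + 1) d seed i \<and>
      h divides\<^bsub>subring_on (subalgebra_gen (cluster seed ` {1..V}))\<^esub> exch_poly n (2 * n + 1) d seed j"
  have hP: "h \<in> mring V" using h unfolding R by simp
  obtain a b where ab: "a \<in> mring V" "b \<in> mring V" "f i = h * a" "f j = h * b"
    using hd unfolding R exch_poly_mutated[OF m i] exch_poly_mutated[OF m j] by (auto simp: factor_def)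
  have h0: "h \<noteq> 0" using ab(3) by (auto simp: f_def rvar_nonzero)
  have "inverse h \<in> mring V"
  proof (rule ccontr)
    assume "inverse h \<notin> mring V"
    then obtain p where p: "prime_on (mring V) p" "h / p \<in> mring V"
      using nonunit_prime_divisor[OF mring_factorial hP h0] by auto
    have dv: "\<exists>k\<in>{n + l, 2 * n + l}. rvar k / p \<in> mring V" if l: "l \<in> {1..n}" and "f l = h * c" "c \<in> mring V" for l c
    proof -
      have sr: "s l \<in> mring V" "r l \<in> mring V" using l by (auto intro!: var_in_mring)
      have "(h / p) * c \<in> mring V" using is_subring_closed(4)[OF P p(2) that(3)] .
      then have "s l ^ e l * r l ^ e' l / p \<in> mring V" using that(2) by (simp add: f_def)
      then have "s l ^ e l / p \<in> mring V \<or> r l ^ e' l / p \<in> mring V"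
        by (rule prime_onD(4)[OF p(1) is_subring_closed(7)[OF P sr(1)] is_subring_closed(7)[OF P sr(2)]])
      then show ?thesis using prime_on_dvd_power[OF P p(1) sr(1)] prime_on_dvd_power[OF P p(1) sr(2)] by blast
    qed
    obtain k l where k: "k \<in> {n + i, 2 * n + i}" "rvar k / p \<in> mring V" and l: "l \<in> {n + j, 2 * n + j}" "rvar l / p \<in> mring V"
      using dv[OF i ab(3,1)] dv[OF j ab(4,2)] by blast
    have "k = l" by (rule prime_dvd_rvar_unique[OF p(1) _ _ k(2) l(2)]) (use k(1) l(1) i j in auto)
    then show False using k(1) l(1) i j ij by auto
  qed
  then show "h \<in> Units (subring_on (subalgebra_gen (cluster seed ` {1..V})))"
    unfolding R Units_def using hP h0 by (auto intro!: bexI[of _ "inverse h"])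
qed

end

context block_seed
begin

subsection \<open>The valuations of the cluster algebra\<close>

text \<open>One index for each prime factor of an exchange polynomial: \<open>s i\<close> always
  occurs, \<open>r i\<close> only with positive exponent.\<close>

definition J :: "nat set" where
  "J = (\<lambda>i. n + i) ` {1..n} \<union> (\<lambda>i. 2 * n + i) ` {i \<in> {1..n}. 0 < e' i}"

definition blk :: "nat \<Rightarrow> nat" where "blk j = (if j \<le> 2 * n then j - n else j - 2 * n)"

text \<open>For \<open>j \<in> J\<close> this is the multiplicity of \<open>rvar j\<close> in the
  exchange polynomial of its block.\<close>

definition expo :: "nat \<Rightarrow> nat" where "expo j = (if j \<le> 2 * n then e (j - n) else e' (j - 2 * n))"

text \<open>
  For \<open>j \<in> J\<close> the prime \<open>(X\<^sub>j, x\<^sub>i)\<close>, \<open>i = blk j\<close>, becomes invisible after inverting \<open>x\<^sub>i\<close>; its valuation is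
  \<open>w j\<close>, given by the weights \<open>1\<close> on \<open>X\<^sub>j\<close> and \<open>expo j\<close> on \<open>x\<^sub>i\<close>.
\<close>

definition w :: "nat \<Rightarrow> 'a ratfun \<Rightarrow> int" where
  "w j = wval (\<lambda>k. if k = j then 1 else if k = blk j then expo j else 0)"

text \<open>Inverting \<open>\<mu>\<close> yields the Laurent polynomial ring of the initial seed,
  whose places are those of the primes not dividing \<open>\<mu>\<close>.\<close>

definition \<mu> :: "'a ratfun" where
  "\<mu> = (\<Prod>i\<in>{1..n}. clus i * clus (n + i) * clus (2 * n + i)) * clus (3 * n + 1)"

definition M :: "'a ratfun set" where "M = mring V"

definition K :: "'a ratfun set" where "K = ratfun_field V"

text \<open>The places of the Laurent ring together with the finitely many that disappear when the
  \<open>x i\<close> are inverted.\<close>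

definition W :: "('a ratfun \<Rightarrow> int) set" where
  "W = pval M ` {p. prime_on M p \<and> \<mu> / p \<notin> M} \<union> w ` J"

lemma J_cases:
  assumes "j \<in> J"
  obtains (s) i where "i \<in> {1..n}" "j = n + i" "blk j = i" "expo j = e i"
    | (r) i where "i \<in> {1..n}" "j = 2 * n + i" "blk j = i" "expo j = e' i" "0 < e' i"
proof -
  from assms consider i where "i \<in> {1..n}" "j = n + i" | i where "i \<in> {1..n}" "j = 2 * n + i" "0 < e' i"
    unfolding J_def by blast
  then show ?thesis
  proof cases
    case 1
    then show ?thesis using s[of i] by (auto simp: blk_def expo_def)
  next
    case 2
    then show ?thesis using r[of i] by (auto simp: blk_def expo_def)
  qed
qed

lemma J_facts: "j \<in> J \<Longrightarrow> n < j" "j \<in> J \<Longrightarrow> j \<le> 3 * n" "j \<in> J \<Longrightarrow> blk j \<in> {1..n}" "j \<in> J \<Longrightarrow> 0 < expo j"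
  by (auto elim!: J_cases simp: e_pos)

lemma finite_J: "finite J"
  by (auto simp: J_def)

text \<open>Otherwise \<open>root\<close> would read \<open>0 = 1\<close>. It follows that no prime
  factor of an exchange polynomial divides a frozen variable, which is a unit of the cluster
  algebra.\<close>

lemma alpha_nonzero:
  assumes "i \<in> {1..n}"
  shows "\<alpha> i \<noteq> 0" "0 < e' i \<Longrightarrow> \<alpha> i + 1 \<noteq> 0"
proof -
  show "\<alpha> i \<noteq> 0" using root[OF assms] e_pos[OF assms] by (auto simp: zero_power)
  show "\<alpha> i + 1 \<noteq> 0" if "0 < e' i"
  proof
    assume z: "\<alpha> i + 1 = 0"
    have "(- (\<alpha> i + 1)) ^ e' i = 0" unfolding z using that by simp
    then show False using root[OF assms] by (simp only: mult_zero_right) simp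
  qed
qed

lemma w_field: "valued_field UNIV (w j)"
  unfolding w_def by (rule wval_field)

lemma w_rvar: "w j (rvar k) = (if k = j then 1 else if k = blk j then int (expo j) else 0)"
  by (simp add: w_def wval_rvar)

lemma w_x: "j \<in> J \<Longrightarrow> i \<in> {1..n} \<Longrightarrow> w j (x i) = (if i = blk j then int (expo j) else 0)"
  using J_facts(1)[of j] by (auto simp: w_rvar)

lemma w_coordinate: "j \<in> J \<Longrightarrow> n < k \<Longrightarrow> w j (rvar k) = (if k = j then 1 else 0)"
  using J_facts(3)[of j] by (auto simp: w_rvar)

lemma w_mult: "y \<noteq> 0 \<Longrightarrow> z \<noteq> 0 \<Longrightarrow> w j (y * z) = w j y + w j z"
  using valued_field.val_mult[OF w_field] by simp

lemma w_power: "y \<noteq> 0 \<Longrightarrow> w j (y ^ k) = int k * w j y"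
  using valued_field.val_power[OF w_field] by simp

lemma w_prod: "finite I \<Longrightarrow> (\<And>i. i \<in> I \<Longrightarrow> g i \<noteq> 0) \<Longrightarrow> w j (prod g I) = (\<Sum>i\<in>I. w j (g i))"
proof (induction I rule: finite_induct)
  case empty
  then show ?case using valued_field.val_1[OF w_field] by simp
next
  case (insert i I)
  then show ?case by (simp add: w_mult)
qed

lemma w_nonneg: "z \<in> mring N \<Longrightarrow> z \<noteq> 0 \<Longrightarrow> 0 \<le> w j z"
  unfolding w_def by (rule wval_nonneg)

lemma w_const: "c \<noteq> 0 \<Longrightarrow> w j (const c) = 0"
  unfolding w_def by (rule wval_const)

lemma clus_nonzero: "k \<in> {1..V} \<Longrightarrow> clus k \<noteq> 0"
proof -
  assume k: "k \<in> {1..V}"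
  have "mvar k \<in> mpolys V" using k by (intro mpolys_closed)
  moreover have "eval_mpoly clus (mvar k) = clus k"
    using const_hom.eval_hom_single[of clus "Poly_Mapping.single k 1" 1]
    by (simp add: eval_mpoly_eq mvar_def const_hom.hom_1)
  ultimately show ?thesis using alg_independent_clus mvar_nonzero[of k] unfolding alg_independent_def by metis
qed

text \<open>One monomial of weight \<open>0\<close> is enough, as the order is a minimum. In
  \<open>u\<close> and \<open>v\<close> it is \<open>s i\<close> for the place of \<open>r i\<close>
  and \<open>r i\<close> for any other place, with nonzero coefficient.\<close>

lemma w_clus_frozen:
  assumes j: "j \<in> J" and k: "k \<in> {n + 1..V}"
  shows "w j (clus k) = 0"
proof -
  define \<omega> :: "nat \<Rightarrow> nat" where "\<omega> = (\<lambda>k. if k = j then 1 else if k = blk j then expo j else 0)"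
  have wz: "w j (clus k) = 0" if "Poly_Mapping.lookup (clus_poly k) (Poly_Mapping.single l 1) \<noteq> 0" "l \<noteq> j" "n < l" for l
  proof -
    have "Poly_Mapping.single l 1 \<in> Poly_Mapping.keys (clus_poly k)" using that(1) by (simp add: in_keys_iff)
    moreover have "weight \<omega> (Poly_Mapping.single l 1) = 0" using that(2,3) J_facts(3)[OF j] by (simp add: \<omega>_def)
    ultimately have "ord \<omega> (clus_poly k) = 0" using ord_le[of "Poly_Mapping.single l 1" "clus_poly k" \<omega>] by simp
    moreover have "clus_poly k \<noteq> 0" using that(1) by auto
    ultimately show ?thesis unfolding w_def clus_def \<omega>_def[symmetric] by (simp add: wval_Fract_1)
  qed
  have Cm: "C a * mvar l = Poly_Mapping.single (Poly_Mapping.single l 1) a" for a l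
    by (simp add: mvar_def mult_single)
  have mv: "mvar l = Poly_Mapping.single (Poly_Mapping.single l 1) (1 :: 'a)" for l
    by (simp add: mvar_def)
  have inj: "Poly_Mapping.single a (1::nat) = Poly_Mapping.single b 1 \<longleftrightarrow> a = b" for a b :: nat
    by (metis keys_single singleton_inject zero_neq_one)
  have "k \<in> {1..V}" using k by auto
  then show ?thesis
  proof (cases rule: block_cases)
    case x
    then show ?thesis using k by auto
  next
    case (u i)
    then have p: "clus_poly k = Poly_Mapping.single (Poly_Mapping.single (n + i) 1) (\<alpha> i + 1) - Poly_Mapping.single (Poly_Mapping.single (2 * n + i) 1) (\<alpha> i)"
      by (auto simp: clus_poly_def Cm mult_2 add_ac)
    show ?thesis
    proof (cases "j = 2 * n + i")
      case True
      then have "0 < e' i" using j u(1) by (auto elim!: J_cases)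
      then show ?thesis using alpha_nonzero(2)[OF u(1)] True u(1)
        by (intro wz[of "n + i"]) (auto simp: p lookup_minus lookup_single inj when_def simp del: One_nat_def)
    next
      case False
      then show ?thesis using alpha_nonzero(1)[OF u(1)] u(1) False
        by (intro wz[of "2 * n + i"]) (auto simp: p lookup_minus lookup_single inj when_def simp del: One_nat_def)
    qed
  next
    case (v i)
    then have p: "clus_poly k = Poly_Mapping.single (Poly_Mapping.single (n + i) 1) 1 - Poly_Mapping.single (Poly_Mapping.single (2 * n + i) 1) 1"
      by (auto simp: clus_poly_def mv mult_2 add_ac)
    show ?thesis
    proof (cases "j = 2 * n + i")
      case True
      then show ?thesis using v(1) by (intro wz[of "n + i"]) (auto simp: p lookup_minus lookup_single inj when_def simp del: One_nat_def)
    next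
      case False
      then show ?thesis using v(1) by (intro wz[of "2 * n + i"]) (auto simp: p lookup_minus lookup_single inj when_def simp del: One_nat_def)
    qed
  next
    case t
    then show ?thesis using J_facts(2)[OF j] by (intro wz[of k]) (auto simp: clus_poly_def mv)
  qed
qed

lemma w_\<mu>: "j \<in> J \<Longrightarrow> w j \<mu> = int (expo j)"
proof -
  assume j: "j \<in> J"
  have nz: "clus i \<noteq> 0" "clus (n + i) \<noteq> 0" "clus (2 * n + i) \<noteq> 0" "clus (3 * n + 1) \<noteq> 0" if "i \<in> {1..n}" for i
    using that by (auto intro!: clus_nonzero)
  have "clus (3 * n + 1) \<noteq> 0" by (rule clus_nonzero) simp
  then have "w j \<mu> = (\<Sum>i\<in>{1..n}. w j (clus i * clus (n + i) * clus (2 * n + i))) + w j (clus (3 * n + 1))"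
  proof -
    have "w j (\<Prod>i\<in>{1..n}. clus i * clus (n + i) * clus (2 * n + i)) = (\<Sum>i\<in>{1..n}. w j (clus i * clus (n + i) * clus (2 * n + i)))"
      by (rule w_prod) (use nz in auto)
    moreover have "(\<Prod>i\<in>{1..n}. clus i * clus (n + i) * clus (2 * n + i)) \<noteq> 0" using nz by auto
    ultimately show ?thesis unfolding \<mu>_def using \<open>clus (3 * n + 1) \<noteq> 0\<close> by (simp add: w_mult)
  qed
  also have "w j (clus (3 * n + 1)) = 0" using j by (intro w_clus_frozen) auto
  also have "(\<Sum>i\<in>{1..n}. w j (clus i * clus (n + i) * clus (2 * n + i))) = (\<Sum>i\<in>{1..n}. if i = blk j then int (expo j) else 0)"
  proof (rule sum.cong)
    fix i assume i: "i \<in> {1..n}"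
    have "w j (clus i * clus (n + i) * clus (2 * n + i)) = w j (clus i) + w j (clus (n + i)) + w j (clus (2 * n + i))"
      using nz[OF i] by (simp add: w_mult)
    then show "w j (clus i * clus (n + i) * clus (2 * n + i)) = (if i = blk j then int (expo j) else 0)"
      using i j w_clus_frozen[OF j, of "n + i"] w_clus_frozen[OF j, of "2 * n + i"] by (simp add: clus_simps(1) w_x)
  qed simp
  also have "\<dots> = int (expo j)" using J_facts(3)[OF j] by simp
  finally show ?thesis by simp
qed

lemma M_subring: "is_subring M"
  unfolding M_def by (rule mring_subring)

lemma clus_M: "k \<in> {1..V} \<Longrightarrow> clus k \<in> M"
  unfolding M_def by (rule clus_mring)

lemma rvar_M: "k \<in> {1..V} \<Longrightarrow> rvar k \<in> M"
  unfolding M_def by (rule var_in_mring)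

sublocale F: factorial_subring M
  by unfold_locales (unfold M_def, rule mring_factorial)

lemma K_eq: "quotient_field M = K"
  unfolding M_def K_def by (rule quotient_field_mring)

lemma MK: "M \<subseteq> K"
  unfolding M_def K_def by (rule mring_subset_ratfun_field)

lemma W_field: "v \<in> W \<Longrightarrow> valued_field K v"
proof
  show "is_subring K" using F.Q unfolding K_eq .
  show "y \<in> K \<Longrightarrow> inverse y \<in> K" for y using F.Q_inverse unfolding K_eq .
  show "v \<in> W \<Longrightarrow> valuation_on K v"
    using F.pval_valuation valued_field.val[OF w_field] unfolding W_def K_eq
    by (auto simp: valuation_on_def)
qed

lemma \<mu>_mem: "\<mu> \<in> M"
  unfolding \<mu>_def
  by (intro is_subring_closed(4)[OF M_subring] is_subring_prod[OF M_subring] clus_M) auto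

lemma \<mu>_nonzero: "\<mu> \<noteq> 0"
  unfolding \<mu>_def by (auto simp: clus_nonzero)

lemma clus_dvd_\<mu>: "k \<in> {1..V} \<Longrightarrow> \<mu> / clus k \<in> M"
proof -
  assume k: "k \<in> {1..V}"
  let ?g = "\<lambda>i. clus i * clus (n + i) * clus (2 * n + i)"
  note mult = is_subring_closed(4)[OF M_subring]
  have tM: "clus (3 * n + 1) \<in> M" by (rule clus_M) simp
  have nz: "clus k \<noteq> 0" by (rule clus_nonzero[OF k])
  have cM: "clus i \<in> M" "clus (n + i) \<in> M" "clus (2 * n + i) \<in> M" if "i \<in> {1..n}" for i
    using that by (auto intro!: clus_M)
  have rest: "(\<Prod>i\<in>I. ?g i) \<in> M" if "I \<subseteq> {1..n}" for I
    using that cM by (intro is_subring_prod[OF M_subring] mult) auto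
  have *: "\<mu> / clus k \<in> M" if i: "i \<in> {1..n}" and c: "?g i / clus k \<in> M" for i
  proof -
    have "\<mu> = ?g i * (\<Prod>i\<in>{1..n} - {i}. ?g i) * clus (3 * n + 1)"
      unfolding \<mu>_def using i by (simp add: prod.remove[of _ i])
    then have e: "\<mu> / clus k = (?g i / clus k) * ((\<Prod>i\<in>{1..n} - {i}. ?g i) * clus (3 * n + 1))" by simp
    show ?thesis unfolding e by (rule mult[OF c mult[OF rest tM]]) auto
  qed
  show ?thesis using k
  proof (cases rule: block_cases)
    case x
    then have "?g k / clus k = clus (n + k) * clus (2 * n + k)" using nz by simp
    then show ?thesis using *[OF x] mult[OF cM(2)[OF x] cM(3)[OF x]] by simp
  next
    case (u i)
    then have "?g i / clus k = clus i * clus (2 * n + i)" using nz by simp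
    then show ?thesis using *[OF u(1)] mult[OF cM(1)[OF u(1)] cM(3)[OF u(1)]] by simp
  next
    case (v i)
    then have "?g i / clus k = clus i * clus (n + i)" using nz by simp
    then show ?thesis using *[OF v(1)] mult[OF cM(1)[OF v(1)] cM(2)[OF v(1)]] by simp
  next
    case t
    then have "\<mu> / clus k = (\<Prod>i\<in>{1..n}. ?g i)" using nz by (simp add: \<mu>_def)
    then show ?thesis using rest[of "{1..n}"] by simp
  qed
qed

lemma pval_clus:
  assumes p: "prime_on M p" "\<mu> / p \<notin> M" and k: "k \<in> {1..V}"
  shows "pval M p (clus k) = 0"
proof (rule F.pval_zero[OF p(1) clus_M[OF k]])
  show "clus k / p \<notin> M"
  proof
    assume "clus k / p \<in> M"
    then have "(\<mu> / clus k) * (clus k / p) \<in> M" using clus_dvd_\<mu>[OF k] is_subring_closed(4)[OF M_subring] by blast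
    then show False using p(2) clus_nonzero[OF k] by simp
  qed
qed

lemma W_cases:
  assumes "v \<in> W"
  obtains (prime) p where "prime_on M p" "\<mu> / p \<notin> M" "v = pval M p" | (weight) j where "j \<in> J" "v = w j"
  using assms unfolding W_def by blast

lemma W_frozen: "v \<in> W \<Longrightarrow> k \<in> {n + 1..V} \<Longrightarrow> v (clus k) = 0"
  using pval_clus w_clus_frozen by (elim W_cases) auto

lemma W_nonneg: "v \<in> W \<Longrightarrow> z \<in> M \<Longrightarrow> z \<noteq> 0 \<Longrightarrow> 0 \<le> v z"
  by (elim W_cases) (auto intro: F.pval_nonneg w_nonneg[of _ V, folded M_def])

section \<open>The cluster algebra as an intersection of valuation rings\<close>

definition A where "A = {z \<in> K. z = 0 \<or> (\<forall>v\<in>W. 0 \<le> v z)}"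

lemma A_subring: "is_subring A"
proof -
  have "A = (if W = {} then K else (\<Inter>v\<in>W. valued_field.valring K v))"
    by (auto simp: A_def valued_field.valring_def[OF W_field])
  then show ?thesis using F.Q[unfolded K_eq] valued_field.valring_subring[OF W_field]
    by (auto simp: is_subring_def)
qed

lemma MA: "M \<subseteq> A"
  using MK W_nonneg by (auto simp: A_def)

lemma f_nonzero: "f i \<noteq> 0"
  by (simp add: f_def rvar_nonzero)

text \<open>The weight \<open>expo j\<close> on the cluster variable is chosen for this agreement
  with \<open>w_x\<close>: it gives \<open>f i / x i\<close> the value \<open>0\<close> at
  \<open>w j\<close>, and any larger weight would make that value negative.\<close>

lemma w_f: "j \<in> J \<Longrightarrow> i \<in> {1..n} \<Longrightarrow> w j (f i) = (if i = blk j then int (expo j) else 0)"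
proof -
  assume j: "j \<in> J" and i: "i \<in> {1..n}"
  have "w j (f i) = int (e i) * w j (s i) + int (e' i) * w j (r i)"
    by (simp add: f_def w_mult w_power rvar_nonzero)
  also have "\<dots> = int (e i) * (if n + i = j then 1 else 0) + int (e' i) * (if 2 * n + i = j then 1 else 0)"
    using w_coordinate[OF j, of "n + i"] w_coordinate[OF j, of "2 * n + i"] i by simp
  also have "\<dots> = (if i = blk j then int (expo j) else 0)" using j i by (auto elim!: J_cases)
  finally show ?thesis .
qed

lemma algebra_subset_A: "algebra \<subseteq> A"
proof (rule algebra_subset[OF A_subring])
  show "range const \<subseteq> A" using const_in_mring[of _ V] MA unfolding M_def by blast
  fix k assume k: "k \<in> {n + 1..V}"
  then have kV: "k \<in> {1..V}" by auto
  have cK: "clus k \<in> K" using clus_M[OF kV] MK by blast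
  have "0 \<le> v (inverse (clus k))" if "v \<in> W" for v
    using valued_field.val_inverse[OF W_field[OF that] cK clus_nonzero[OF kV]] W_frozen[OF that k] by simp
  moreover have "inverse (clus k) \<in> K" using F.Q_inverse cK unfolding K_eq by blast
  ultimately have "inverse (clus k) \<in> A" unfolding A_def by blast
  then show "clus k \<in> A \<and> inverse (clus k) \<in> A" using clus_M[OF kV] MA by blast
next
  fix i assume i: "i \<in> {1..n}"
  have xM: "x i \<in> M" and fM: "f i \<in> M"
  proof -
    show "x i \<in> M" using i by (intro rvar_M) auto
    show "f i \<in> M" unfolding f_def using i
      by (intro is_subring_closed(4,7)[OF M_subring] rvar_M) auto
  qed
  have xf: "x i \<in> K" "f i \<in> K" using xM fM MK by auto
  have "0 \<le> v (f i / x i)" if "v \<in> W" for v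
  proof -
    have "v (f i / x i) = v (f i) - v (x i)"
      by (rule valued_field.val_divide[OF W_field[OF that] xf(2,1) f_nonzero rvar_nonzero])
    moreover have "v (x i) \<le> v (f i)" using that
    proof (cases rule: W_cases)
      case (prime p)
      have "pval M p (x i) = 0" using pval_clus[OF prime(1,2), of i] i clus_simps(1)[OF i] by simp
      then show ?thesis using W_nonneg[OF that fM f_nonzero] prime(3) by simp
    next
      case (weight j)
      then show ?thesis using w_f w_x i by simp
    qed
    ultimately show ?thesis by simp
  qed
  moreover have "f i / x i \<in> K"
    using valued_field.K_closed(7)[OF valued_field.intro, of K "\<lambda>_. 0"] xf F.Q F.Q_inverse is_subring_closed(4)[OF F.Q]
    unfolding K_eq by (metis divide_inverse)
  ultimately show "x i \<in> A \<and> f i / x i \<in> A" using xM MA by (auto simp: A_def)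
qed

lemma prod_split: "(\<Prod>k\<in>{1..a + b}. g k) = (\<Prod>k\<in>{1..a}. g k) * (\<Prod>k\<in>{1..b}. g (a + k))"
  for g :: "nat \<Rightarrow> 'b::comm_monoid_mult"
  using prod.ub_add_nat[of 1 a g b] prod.shift_bounds_cl_nat_ivl[of g 1 a b] by (simp add: add.commute)

lemma prod_V: "(\<Prod>k\<in>{1..V}. g k) = (\<Prod>i\<in>{1..n}. g i * g (n + i) * g (2 * n + i)) * g (3 * n + 1)"
  for g :: "nat \<Rightarrow> 'b::comm_monoid_mult"
proof -
  have "(\<Prod>k\<in>{1..n + (n + (n + 1))}. g k) = (\<Prod>k\<in>{1..n}. g k) * ((\<Prod>k\<in>{1..n}. g (n + k)) *
      ((\<Prod>k\<in>{1..n}. g (n + (n + k))) * (\<Prod>k\<in>{1..1}. g (n + (n + (n + k))))))"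
    unfolding prod_split[of g n "n + (n + 1)"] prod_split[of "\<lambda>k. g (n + k)" n "n + 1"]
      prod_split[of "\<lambda>k. g (n + (n + k))" n 1] ..
  moreover have "V = n + (n + (n + 1))" "n + (n + (n + 1)) = 3 * n + 1" "\<And>k. n + (n + k) = 2 * n + k" by auto
  ultimately show ?thesis by (simp add: prod.distrib mult.assoc)
qed

text \<open>If \<open>x i\<close> is divided out \<open>l\<close> times more often than the
  numerator allows, each of these divisions is paid for by one factor \<open>f i\<close>; the
  hypotheses say that enough powers of \<open>s i\<close> and \<open>r i\<close> are
  available.\<close>

lemma block_monomial:
  assumes i: "i \<in> {1..n}" and s: "e i * k \<le> b + e i * a" and r: "e' i * k \<le> c + e' i * a"
  shows "x i ^ a * s i ^ b * r i ^ c / x i ^ k \<in> algebra"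
proof -
  note cl = is_subring_closed(4,7)[OF algebra_subring]
  note xsr = algebra_cluster[OF i] algebra_coordinates[OF i]
  show ?thesis
  proof (cases "k \<le> a")
    case True
    have "x i ^ a = x i ^ (a - k) * x i ^ k" using True by (simp flip: power_add)
    then have "x i ^ a * s i ^ b * r i ^ c / x i ^ k = x i ^ (a - k) * s i ^ b * r i ^ c"
      by (simp add: rvar_nonzero)
    then show ?thesis using xsr by (simp add: cl)
  next
    case False
    define l where "l = k - a"
    have k: "k = a + l" using False by (simp add: l_def)
    have b: "e i * l \<le> b" "e' i * l \<le> c" using s r by (auto simp: k distrib_left)
    have "s i ^ b = s i ^ (e i * l) * s i ^ (b - e i * l)" "r i ^ c = r i ^ (e' i * l) * r i ^ (c - e' i * l)"
      using b by (simp_all flip: power_add)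
    then have "x i ^ a * s i ^ b * r i ^ c / x i ^ k = (f i / x i) ^ l * s i ^ (b - e i * l) * r i ^ (c - e' i * l)"
      unfolding k by (simp add: f_def power_add power_divide power_mult_distrib power_mult rvar_nonzero)
    then show ?thesis using xsr by (simp add: cl)
  qed
qed

text \<open>
  Membership in the cluster algebra can be checked monomial by monomial because the \<open>w j\<close> are
  monomial valuations.
\<close>

lemma A_subset_algebra: "A \<subseteq> algebra"
proof
  fix z assume zA: "z \<in> A"
  note cl = is_subring_closed(4,7)[OF algebra_subring]
  show "z \<in> algebra"
  proof (cases "z = 0")
    case True
    then show ?thesis using is_subring_closed(2)[OF algebra_subring] by simp
  next
    case False
    have "\<exists>k. z * \<mu> ^ k \<in> M"
    proof (rule F.clear_denominators[OF \<mu>_mem \<mu>_nonzero])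
      show "z \<in> quotient_field M" using zA by (simp add: A_def K_eq)
      fix p assume "prime_on M p" "\<mu> / p \<notin> M"
      then show "0 \<le> pval M p z" using zA False by (auto simp: A_def W_def)
    qed
    then obtain k p where p: "p \<in> mpolys V" "z * \<mu> ^ k = Fract p 1" by (auto simp: mring_def M_def)
    have p0: "p \<noteq> 0" using p(2) False \<mu>_nonzero by (metis Fract_1_eq_0_iff mult_eq_0_iff power_eq_0_iff)
    \<comment> \<open>Nonnegativity of \<open>w j z\<close> bounds the order of \<open>p\<close>
      from below, and as the order is a minimum the bound holds for each monomial; it is the
      hypothesis of \<open>block_monomial\<close>.\<close>
    have wt: "expo j * k \<le> Poly_Mapping.lookup \<tau> j + expo j * Poly_Mapping.lookup \<tau> (blk j)"
      if \<tau>: "\<tau> \<in> Poly_Mapping.keys p" and j: "j \<in> J" for \<tau> j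
    proof -
      let ?\<omega> = "\<lambda>k. if k = j then 1 else if k = blk j then expo j else 0"
      have "w j (Fract p 1) = w j z + int k * int (expo j)"
        unfolding p(2)[symmetric] using False \<mu>_nonzero by (simp add: w_mult w_power w_\<mu>[OF j])
      moreover have "0 \<le> w j z" using zA False j by (auto simp: A_def W_def)
      ultimately have "int k * int (expo j) \<le> int (ord ?\<omega> p)"
        using wval_Fract_1[OF p0, of ?\<omega>] by (simp add: w_def)
      then have "k * expo j \<le> ord ?\<omega> p" by (metis of_nat_le_iff of_nat_mult)
      also have "\<dots> \<le> weight ?\<omega> \<tau>" by (rule ord_le[OF \<tau>])
      also have "weight ?\<omega> \<tau> = (\<Sum>k\<in>Poly_Mapping.keys \<tau> \<union> {j, blk j}. ?\<omega> k * Poly_Mapping.lookup \<tau> k)"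
        by (rule weight_superset) auto
      also have "\<dots> = (\<Sum>k\<in>{j, blk j}. ?\<omega> k * Poly_Mapping.lookup \<tau> k)"
        by (rule sum.mono_neutral_right) auto
      also have "\<dots> = Poly_Mapping.lookup \<tau> j + expo j * Poly_Mapping.lookup \<tau> (blk j)"
        using J_facts(1,3)[OF j] by simp
      finally show ?thesis by (simp add: mult.commute)
    qed
    have mono: "monom_val rvar \<tau> / \<mu> ^ k \<in> algebra" if \<tau>: "\<tau> \<in> Poly_Mapping.keys p" for \<tau>
    proof -
      let ?l = "Poly_Mapping.lookup \<tau>"
      have "Poly_Mapping.keys \<tau> \<subseteq> {1..V}" using p(1) \<tau> by (auto simp: mpolys_def)
      then have "monom_val rvar \<tau> = (\<Prod>k\<in>{1..V}. rvar k ^ ?l k :: 'a ratfun)" by (intro monom_val_superset) auto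
      also have "\<dots> = (\<Prod>i\<in>{1..n}. x i ^ ?l i * s i ^ ?l (n + i) * r i ^ ?l (2 * n + i)) * t ^ ?l (3 * n + 1)"
        by (rule prod_V)
      finally have me: "monom_val rvar \<tau> = (\<Prod>i\<in>{1..n}. x i ^ ?l i * s i ^ ?l (n + i) * r i ^ ?l (2 * n + i)) * t ^ ?l (3 * n + 1)" .
      have mk: "\<mu> ^ k = (\<Prod>i\<in>{1..n}. (clus i * clus (n + i) * clus (2 * n + i)) ^ k) * clus (3 * n + 1) ^ k"
        unfolding \<mu>_def by (simp only: power_mult_distrib[of _ "clus (3 * n + 1)"] prod_power_distrib)
      have "monom_val rvar \<tau> / \<mu> ^ k =
        (\<Prod>i\<in>{1..n}. (x i ^ ?l i * s i ^ ?l (n + i) * r i ^ ?l (2 * n + i)) / (clus i * clus (n + i) * clus (2 * n + i)) ^ k) *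
          (t ^ ?l (3 * n + 1) / clus (3 * n + 1) ^ k)"
        by (simp only: me mk prod_dividef times_divide_times_eq)
      also have "\<dots> \<in> algebra"
      proof (intro cl is_subring_prod[OF algebra_subring])
        fix i assume i: "i \<in> {1..n}"
        have b: "e i * k \<le> ?l (n + i) + e i * ?l i"
        proof -
          have "n + i \<in> J" using i by (auto simp: J_def)
          from wt[OF \<tau> this] show ?thesis using i by (simp add: blk_def expo_def)
        qed
        \<comment> \<open>If \<open>r i\<close> is no prime factor, there is no place to use, but
          then the inequality is trivial.\<close>
        have c: "e' i * k \<le> ?l (2 * n + i) + e' i * ?l i"
        proof (cases "0 < e' i")
          case True
          then have "2 * n + i \<in> J" using i by (auto simp: J_def)
          from wt[OF \<tau> this] show ?thesis using i by (simp add: blk_def expo_def)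
        qed simp
        have "inverse (clus (n + i)) ^ k * inverse (clus (2 * n + i)) ^ k \<in> algebra"
          using i by (intro cl algebra_frozen) auto
        then have "(x i ^ ?l i * s i ^ ?l (n + i) * r i ^ ?l (2 * n + i) / x i ^ k) *
           (inverse (clus (n + i)) ^ k * inverse (clus (2 * n + i)) ^ k) \<in> algebra"
          by (rule cl(1)[OF block_monomial[OF i b c]])
        also have "(x i ^ ?l i * s i ^ ?l (n + i) * r i ^ ?l (2 * n + i) / x i ^ k) *
           (inverse (clus (n + i)) ^ k * inverse (clus (2 * n + i)) ^ k) =
           (x i ^ ?l i * s i ^ ?l (n + i) * r i ^ ?l (2 * n + i)) / (clus i * clus (n + i) * clus (2 * n + i)) ^ k"
          unfolding clus_simps(1)[OF i] by (simp add: power_mult_distrib divide_inverse power_inverse mult_ac)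
        finally show "(x i ^ ?l i * s i ^ ?l (n + i) * r i ^ ?l (2 * n + i)) / (clus i * clus (n + i) * clus (2 * n + i)) ^ k \<in> algebra" .
      next
        have "clus (3 * n + 1) ^ ?l (3 * n + 1) * inverse (clus (3 * n + 1)) ^ k \<in> algebra"
          by (intro cl algebra_frozen) auto
        then show "t ^ ?l (3 * n + 1) / clus (3 * n + 1) ^ k \<in> algebra"
          unfolding clus_simps(4) by (simp add: divide_inverse power_inverse)
      qed
      finally show ?thesis .
    qed
    have "Fract p 1 = (\<Sum>\<tau>\<in>Poly_Mapping.keys p. const (Poly_Mapping.lookup p \<tau>) * monom_val rvar \<tau>)"
      by (simp add: eval_mpoly_var[symmetric] eval_mpoly_eq eval_hom_def)
    then have "z = (\<Sum>\<tau>\<in>Poly_Mapping.keys p. const (Poly_Mapping.lookup p \<tau>) * monom_val rvar \<tau>) / \<mu> ^ k"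
      using p(2) \<mu>_nonzero by (simp add: field_simps)
    also have "\<dots> = (\<Sum>\<tau>\<in>Poly_Mapping.keys p. const (Poly_Mapping.lookup p \<tau>) * (monom_val rvar \<tau> / \<mu> ^ k))"
      by (simp add: sum_divide_distrib)
    also have "\<dots> \<in> algebra"
      by (intro is_subring_sum[OF algebra_subring] cl(1) algebra_const mono)
    finally show ?thesis .
  qed
qed

lemma algebra_eq: "algebra = {z \<in> K. z = 0 \<or> (\<forall>v\<in>W. 0 \<le> v z)}"
  using algebra_subset_A A_subset_algebra by (auto simp: A_def)

end

subsection \<open>The class group of the cluster algebra\<close>

text \<open>\<open>\<gamma> j\<close> is to be the class of the prime at \<open>w j\<close>. The
  divisor of \<open>x i\<close> has coefficient \<open>expo j\<close> at each \<open>j\<close> of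
  block \<open>i\<close>, and \<open>relations\<close> says that all relations come from these
  divisors, taken with multiplicities \<open>l\<close>.\<close>

locale block_class = block_seed n e e' \<alpha> + G: comm_group G
  for n :: nat and e e' :: "nat \<Rightarrow> nat" and \<alpha> :: "nat \<Rightarrow> 'a::field_char_0"
    and G :: "('g, 'h) monoid_scheme" +
  fixes \<gamma> :: "nat \<Rightarrow> 'g"
  assumes \<gamma>: "\<gamma> \<in> J \<rightarrow> carrier G"
    and relations: "G.comb J \<gamma> c = \<one>\<^bsub>G\<^esub> \<longleftrightarrow> (\<exists>l. \<forall>j\<in>J. c j = l (blk j) * int (expo j))"
    and spanning: "range (G.comb J \<gamma>) = carrier G"
begin

lemma M_units: "unit_on M u \<Longrightarrow> \<exists>c. c \<noteq> 0 \<and> u = const c"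
proof -
  assume u: "unit_on M u"
  obtain c where c: "u = const c" using mring_unit[OF u[unfolded M_def]] by (elim rangeE)
  have "c \<noteq> 0"
  proof
    assume "c = 0"
    then show False using c unit_onD(2)[OF u] const_hom.hom_0[where 'a = 'a] by simp
  qed
  then show ?thesis using c by (intro exI conjI)
qed

lemma w_inj:
  assumes "j \<in> J" "j' \<in> J" "w j = w j'"
  shows "j = j'"
proof (rule ccontr)
  assume ne: "j \<noteq> j'"
  have "w j (rvar j) = 1" using w_coordinate[OF assms(1) J_facts(1)[OF assms(1)]] by simp
  moreover have "w j' (rvar j) = 0" using w_coordinate[OF assms(2) J_facts(1)[OF assms(1)]] ne by simp
  ultimately show False unfolding assms(3) by simp
qed

text \<open>\<open>x (blk j)\<close> divides \<open>\<mu>\<close>, so its value is \<open>0\<close>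
  at every prime not dividing \<open>\<mu>\<close>, but positive at \<open>w j\<close>.\<close>

lemma w_not_pval:
  assumes p: "prime_on M p" "\<mu> / p \<notin> M" and j: "j \<in> J"
  shows "w j \<noteq> pval M p"
proof
  assume eq: "w j = pval M p"
  have b: "blk j \<in> {1..n}" by (rule J_facts(3)[OF j])
  have "pval M p (x (blk j)) = 0" using pval_clus[OF p, of "blk j"] b clus_simps(1)[OF b] by simp
  moreover have "w j (x (blk j)) = int (expo j)" using w_x[OF j b] by simp
  ultimately show False using eq J_facts(4)[OF j] by simp
qed

lemma pval_notin_weights:
  assumes "prime_on M p" "\<mu> / p \<notin> M"
  shows "pval M p \<notin> w ` J"
proof
  assume "pval M p \<in> w ` J"
  then obtain j where j: "j \<in> J" "pval M p = w j" by (elim imageE)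
  show False using w_not_pval[OF assms j(1)] j(2) by (elim notE) (rule sym)
qed

lemma associated_w:
  assumes p: "prime_on M p" and p': "prime_on M p'" and pq: "p / p' \<in> M"
  shows "w j p = w j p'"
proof -
  obtain c where c: "c \<noteq> 0" "p / p' = const c"
    using M_units[OF prime_dvd_prime[OF M_subring p p' pq]] by auto
  then have "p = const c * p'" using prime_onD(2)[OF p'] by (simp add: field_simps)
  moreover have "const c \<noteq> 0" using c prime_onD(2)[OF p] prime_onD(2)[OF p'] by (metis divide_eq_0_iff)
  ultimately show ?thesis using w_const[OF c(1)] prime_onD(2)[OF p'] by (simp add: w_mult)
qed

lemma pval_eq_imp_dvd:
  assumes p: "prime_on M p" and p': "prime_on M p'" and "pval M p = pval M p'"
  shows "p / p' \<in> M"
proof -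
  have "pval M p' p = 1" using F.pval_self[OF p] unfolding assms(3) .
  then show ?thesis using F.pval_pos_iff[OF p' prime_onD(1,2)[OF p]] by linarith
qed

text \<open>The class of a prime \<open>p\<close> is determined by \<open>div p = P\<^sub>p + \<Sum>\<^sub>j w\<^sub>j(p) P\<^sub>j\<close>.\<close>

definition \<psi> :: "('a ratfun \<Rightarrow> int) \<Rightarrow> 'g" where
  "\<psi> v = (if v \<in> w ` J then \<gamma> (inv_into J w v)
     else G.comb J \<gamma> (\<lambda>j. - w j (SOME p. prime_on M p \<and> \<mu> / p \<notin> M \<and> v = pval M p)))"

lemma inj_on_w: "inj_on w J"
  by (rule inj_onI) (rule w_inj)

lemma \<psi>_w: "j \<in> J \<Longrightarrow> \<psi> (w j) = \<gamma> j"
  by (simp add: \<psi>_def inv_into_f_f[OF inj_on_w])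

text \<open>The prime chosen in the definition is associated to \<open>p\<close>, and units of
  \<open>M\<close> are constants, which have weight \<open>0\<close>.\<close>

lemma \<psi>_pval:
  assumes p: "prime_on M p" "\<mu> / p \<notin> M"
  shows "\<psi> (pval M p) = G.comb J \<gamma> (\<lambda>j. - w j p)"
proof -
  define q where "q = (SOME q. prime_on M q \<and> \<mu> / q \<notin> M \<and> pval M p = pval M q)"
  have "prime_on M q \<and> \<mu> / q \<notin> M \<and> pval M p = pval M q"
    unfolding q_def by (rule someI[of _ p]) (use p in auto)
  then have "w j q = w j p" for j using associated_w[of q p] pval_eq_imp_dvd[of q p] p by simp
  moreover have "pval M p \<notin> w ` J" by (rule pval_notin_weights[OF p])
  then have "\<psi> (pval M p) = G.comb J \<gamma> (\<lambda>j. - w j q)" unfolding \<psi>_def q_def by (simp only: if_False)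
  ultimately show ?thesis by simp
qed

lemma \<psi>_closed: "\<psi> ` W \<subseteq> carrier G"
proof safe
  fix v assume "v \<in> W"
  then show "\<psi> v \<in> carrier G"
  proof (cases rule: W_cases)
    case (prime p)
    then show ?thesis using G.comb_closed[OF \<gamma>] by (simp add: \<psi>_pval)
  next
    case (weight j)
    then show ?thesis using \<gamma> by (auto simp: \<psi>_w)
  qed
qed

text \<open>The extension of \<open>\<psi>\<close> to divisors that the universal property of free
  abelian groups provides.\<close>

definition h :: "(('a ratfun \<Rightarrow> int) \<Rightarrow>\<^sub>0 int) \<Rightarrow> 'g" where
  "h = (SOME h. h \<in> hom (free_Abelian_group W) G \<and> (\<forall>v\<in>W. h (frag_of v) = \<psi> v))"

lemma h_hom: "h \<in> hom (free_Abelian_group W) G" and h_frag: "v \<in> W \<Longrightarrow> h (frag_of v) = \<psi> v"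
proof -
  have "\<exists>h. h \<in> hom (free_Abelian_group W) G \<and> (\<forall>v\<in>W. h (frag_of v) = \<psi> v)"
    by (rule G.free_Abelian_group_universal[OF \<psi>_closed]) blast
  then have "h \<in> hom (free_Abelian_group W) G \<and> (\<forall>v\<in>W. h (frag_of v) = \<psi> v)"
    unfolding h_def by (rule someI_ex)
  then show "h \<in> hom (free_Abelian_group W) G" "v \<in> W \<Longrightarrow> h (frag_of v) = \<psi> v" by blast+
qed

lemma h_group_hom: "group_hom (free_Abelian_group W) G h"
  using h_hom by (intro group_hom.intro group_hom_axioms.intro) auto

lemma h_add: "Poly_Mapping.keys D \<subseteq> W \<Longrightarrow> Poly_Mapping.keys E \<subseteq> W \<Longrightarrow> h (D + E) = h D \<otimes>\<^bsub>G\<^esub> h E"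
  using hom_mult[OF h_hom, of D E] by simp

lemma h_0: "h 0 = \<one>\<^bsub>G\<^esub>"
  using group_hom.hom_one[OF h_group_hom] by simp

lemma h_closed: "Poly_Mapping.keys D \<subseteq> W \<Longrightarrow> h D \<in> carrier G"
  using hom_in_carrier[OF h_hom, of D] by simp

definition wpart :: "(nat \<Rightarrow> int) \<Rightarrow> ('a ratfun \<Rightarrow> int) \<Rightarrow>\<^sub>0 int" where
  "wpart c = (\<Sum>j\<in>J. frag_cmul (c j) (frag_of (w j)))"

lemma w_W: "j \<in> J \<Longrightarrow> w j \<in> W"
  by (simp add: W_def)

lemma lookup_wpart:
  shows "j \<in> J \<Longrightarrow> Poly_Mapping.lookup (wpart c) (w j) = c j"
    and "v \<notin> w ` J \<Longrightarrow> Poly_Mapping.lookup (wpart c) v = 0"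
proof -
  assume j: "j \<in> J"
  have "(\<Sum>i\<in>J. Poly_Mapping.lookup (frag_cmul (c i) (frag_of (w i))) (w j)) = (\<Sum>i\<in>J. if i = j then c j else 0)"
  proof (rule sum.cong)
    fix i assume i: "i \<in> J"
    show "Poly_Mapping.lookup (frag_cmul (c i) (frag_of (w i))) (w j) = (if i = j then c j else 0)"
    proof (cases "i = j")
      case False
      then have "w j \<noteq> w i" using w_inj[OF j i] False by fast
      then show ?thesis using False by simp
    qed simp
  qed simp
  then show "Poly_Mapping.lookup (wpart c) (w j) = c j"
    using j finite_J by (simp add: wpart_def lookup_sum)
next
  assume v: "v \<notin> w ` J"
  have "(\<Sum>i\<in>J. Poly_Mapping.lookup (frag_cmul (c i) (frag_of (w i))) v) = 0"
  proof (rule sum.neutral, rule ballI)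
    fix i assume "i \<in> J"
    then have "v \<noteq> w i" using v by fast
    then show "Poly_Mapping.lookup (frag_cmul (c i) (frag_of (w i))) v = 0" by simp
  qed
  then show "Poly_Mapping.lookup (wpart c) v = 0" by (simp add: wpart_def lookup_sum)
qed

lemma wpart_keys: "Poly_Mapping.keys (wpart c) \<subseteq> W"
proof
  fix v assume "v \<in> Poly_Mapping.keys (wpart c)"
  then have nz: "Poly_Mapping.lookup (wpart c) v \<noteq> 0" unfolding in_keys_iff .
  have "v \<in> w ` J"
  proof (rule ccontr)
    assume "v \<notin> w ` J"
    from lookup_wpart(2)[OF this, of c] nz show False by contradiction
  qed
  then show "v \<in> W" unfolding W_def by (rule UnI2)
qed

lemma h_wpart: "h (wpart c) = G.comb J \<gamma> c"
proof -
  have "h (\<Sum>j\<in>I. frag_cmul (c j) (frag_of (w j))) = G.comb I \<gamma> c \<and>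
      Poly_Mapping.keys (\<Sum>j\<in>I. frag_cmul (c j) (frag_of (w j))) \<subseteq> W" if "finite I" "I \<subseteq> J" for I
    using that
  proof (induction I)
    case empty
    then show ?case by (simp add: h_0 G.comb_def)
  next
    case (insert j I)
    then have j: "j \<in> J" and I: "I \<subseteq> J" by auto
    then have fW: "Poly_Mapping.keys (frag_of (w j)) \<subseteq> W" using w_W[OF j] by (simp add: keys_frag_of)
    have k: "Poly_Mapping.keys (frag_cmul (c j) (frag_of (w j))) \<subseteq> W"
      by (rule subset_trans[OF keys_cmul fW])
    have "h (frag_cmul (c j) (frag_of (w j))) = h (frag_of (w j)) [^]\<^bsub>G\<^esub> c j"
      using group_hom.hom_int_pow[OF h_group_hom, of "frag_of (w j)" "c j"] fW
      by (simp only: int_pow_free_Abelian_group[OF fW] carrier_free_Abelian_group_iff)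
    also have "h (frag_of (w j)) = \<gamma> j" using h_frag[OF w_W[OF j]] \<psi>_w[OF j] by simp
    finally have e: "h (frag_cmul (c j) (frag_of (w j))) = \<gamma> j [^]\<^bsub>G\<^esub> c j" .
    have g: "\<gamma> \<in> I \<rightarrow> carrier G" "\<gamma> \<in> insert j I \<rightarrow> carrier G" using \<gamma> I j by auto
    have "G.comb (insert j I) \<gamma> c = \<gamma> j [^]\<^bsub>G\<^esub> c j \<otimes>\<^bsub>G\<^esub> G.comb I \<gamma> c"
      using G.comb_remove[of "insert j I" j \<gamma> c] insert(1,2) g by simp
    moreover have "Poly_Mapping.keys (frag_cmul (c j) (frag_of (w j)) + (\<Sum>j\<in>I. frag_cmul (c j) (frag_of (w j)))) \<subseteq> W"
      using k insert.IH[OF I] keys_add[of "frag_cmul (c j) (frag_of (w j))" "\<Sum>j\<in>I. frag_cmul (c j) (frag_of (w j))"]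
      by blast
    ultimately show ?case using insert(1,2) insert.IH[OF I] h_add[OF k] e by simp
  qed
  then show ?thesis using finite_J by (simp add: wpart_def)
qed

lemma K_subring: "is_subring K" and K_inverse: "z \<in> K \<Longrightarrow> inverse z \<in> K"
  using F.Q F.Q_inverse unfolding K_eq by auto

lemma W_finite: "z \<in> K \<Longrightarrow> z \<noteq> 0 \<Longrightarrow> finite {v \<in> W. v z \<noteq> 0}"
proof -
  assume z: "z \<in> K" "z \<noteq> 0"
  have "{v \<in> W. v z \<noteq> 0} \<subseteq> {v \<in> pval M ` {p. prime_on M p}. v z \<noteq> 0} \<union> w ` J"
    by (auto simp: W_def)
  moreover have "finite ({v \<in> pval M ` {p. prime_on M p}. v z \<noteq> 0} \<union> w ` J)"
    using F.pval_finite[unfolded K_eq, OF z] finite_J by simp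
  ultimately show ?thesis by (rule finite_subset)
qed

section \<open>Principal divisors and the kernel of the class map\<close>

definition pdiv :: "'a ratfun \<Rightarrow> ('a ratfun \<Rightarrow> int) \<Rightarrow>\<^sub>0 int" where
  "pdiv z = (\<Sum>v\<in>{v \<in> W. v z \<noteq> 0}. frag_cmul (v z) (frag_of v))"

lemma lookup_pdiv:
  assumes "z \<in> K" "z \<noteq> 0"
  shows "Poly_Mapping.lookup (pdiv z) v = (if v \<in> W then v z else 0)"
proof -
  have "(\<Sum>u\<in>{v \<in> W. v z \<noteq> 0}. Poly_Mapping.lookup (frag_cmul (u z) (frag_of u)) v)
      = (\<Sum>u\<in>{v \<in> W. v z \<noteq> 0}. if u = v then v z else 0)"
    by (intro sum.cong) auto
  then show ?thesis using W_finite[OF assms] by (simp add: pdiv_def lookup_sum)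
qed

lemma pdiv_keys: "z \<in> K \<Longrightarrow> z \<noteq> 0 \<Longrightarrow> Poly_Mapping.keys (pdiv z) \<subseteq> W"
  by (auto simp: in_keys_iff lookup_pdiv split: if_splits)

lemma divisor_eqI:
  assumes "Poly_Mapping.keys D \<subseteq> W" "Poly_Mapping.keys E \<subseteq> W"
    "\<And>v. v \<in> W \<Longrightarrow> Poly_Mapping.lookup D v = Poly_Mapping.lookup E v"
  shows "D = E"
proof (rule poly_mapping_eqI)
  fix v
  show "Poly_Mapping.lookup D v = Poly_Mapping.lookup E v"
  proof (cases "v \<in> W")
    case False
    then have "v \<notin> Poly_Mapping.keys D" "v \<notin> Poly_Mapping.keys E" using assms(1,2) by blast+
    then show ?thesis by (simp add: in_keys_iff)
  qed (rule assms(3))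
qed

lemma pdiv_mult:
  assumes "y \<in> K" "y \<noteq> 0" "z \<in> K" "z \<noteq> 0"
  shows "pdiv (y * z) = pdiv y + pdiv z"
proof (rule poly_mapping_eqI)
  fix v
  have "v (y * z) = v y + v z" if "v \<in> W" by (rule valued_field.val_mult[OF W_field[OF that] assms(1,3,2,4)])
  then show "Poly_Mapping.lookup (pdiv (y * z)) v = Poly_Mapping.lookup (pdiv y + pdiv z) v"
    using assms is_subring_closed(4)[OF K_subring] by (simp add: lookup_pdiv lookup_add)
qed

lemma pdiv_prime:
  assumes p: "prime_on M p" "\<mu> / p \<notin> M"
  shows "pdiv p = frag_of (pval M p) + wpart (\<lambda>j. w j p)"
proof (rule divisor_eqI)
  have pK: "p \<in> K" "p \<noteq> 0" using prime_onD[OF p(1)] MK by auto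
  have pW: "pval M p \<in> W" using p by (auto simp: W_def)
  show "Poly_Mapping.keys (pdiv p) \<subseteq> W" by (rule pdiv_keys[OF pK])
  show "Poly_Mapping.keys (frag_of (pval M p) + wpart (\<lambda>j. w j p)) \<subseteq> W"
    using keys_add[of "frag_of (pval M p)" "wpart (\<lambda>j. w j p)"] wpart_keys pW by (force simp: keys_frag_of)
  fix v assume v: "v \<in> W"
  have "Poly_Mapping.lookup (frag_of (pval M p) + wpart (\<lambda>j. w j p)) v = v p" using v
  proof (cases rule: W_cases)
    case (prime q)
    have "v \<notin> w ` J" unfolding prime(3) by (rule pval_notin_weights[OF prime(1,2)])
    then have z: "Poly_Mapping.lookup (wpart (\<lambda>j. w j p)) v = 0" by (rule lookup_wpart(2))
    show ?thesis
    proof (cases "p / q \<in> M")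
      case True
      then have "v = pval M p" using F.pval_associated[OF p(1) prime(1)] prime(3) by simp
      then show ?thesis using z F.pval_self[OF p(1)] by (simp add: lookup_add)
    next
      case False
      then have "v p = 0" using F.pval_zero[OF prime(1) prime_onD(1)[OF p(1)]] prime(3) by simp
      moreover have "v \<noteq> pval M p" using \<open>v p = 0\<close> F.pval_self[OF p(1)] by auto
      ultimately show ?thesis using z by (simp add: lookup_add)
    qed
  next
    case (weight j)
    then show ?thesis using lookup_wpart(1)[OF weight(1)] w_not_pval[OF p weight(1)] by (auto simp: lookup_add)
  qed
  then show "Poly_Mapping.lookup (pdiv p) v = Poly_Mapping.lookup (frag_of (pval M p) + wpart (\<lambda>j. w j p)) v"
    using v by (simp add: lookup_pdiv[OF pK])
qed

lemma pdiv_weights_only: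
  assumes z: "z \<in> K" "z \<noteq> 0" and "\<And>p. prime_on M p \<Longrightarrow> \<mu> / p \<notin> M \<Longrightarrow> pval M p z = 0"
  shows "pdiv z = wpart (\<lambda>j. w j z)"
proof (rule divisor_eqI[OF pdiv_keys[OF z] wpart_keys])
  fix v assume v: "v \<in> W"
  then show "Poly_Mapping.lookup (pdiv z) v = Poly_Mapping.lookup (wpart (\<lambda>j. w j z)) v"
  proof (cases rule: W_cases)
    case (prime p)
    have "v \<notin> w ` J" unfolding prime(3) by (rule pval_notin_weights[OF prime(1,2)])
    then show ?thesis using lookup_wpart(2) assms(3)[OF prime(1,2)] prime(3) by (simp add: lookup_pdiv[OF z])
  next
    case (weight j)
    then show ?thesis using v lookup_wpart(1)[OF weight(1)] by (simp add: lookup_pdiv[OF z])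
  qed
qed

lemma \<mu>_prime_factor:
  assumes p: "prime_on M p" "\<mu> / p \<in> M"
  shows "\<exists>k\<in>{1..V}. clus k / p \<in> M"
proof -
  note mult = is_subring_closed(4)[OF M_subring]
  have cM: "clus i \<in> M" "clus (n + i) \<in> M" "clus (2 * n + i) \<in> M" if "i \<in> {1..n}" for i
    using that by (auto intro!: clus_M)
  have gM: "clus i * clus (n + i) * clus (2 * n + i) \<in> M" if "i \<in> {1..n}" for i
    using cM[OF that] mult by blast
  have "(\<Prod>i\<in>{1..n}. clus i * clus (n + i) * clus (2 * n + i)) / p \<in> M \<or> clus (3 * n + 1) / p \<in> M"
  proof (rule prime_onD(4)[OF p(1)])
    show "(\<Prod>i\<in>{1..n}. clus i * clus (n + i) * clus (2 * n + i)) \<in> M" using gM by (rule is_subring_prod[OF M_subring])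
    show "clus (3 * n + 1) \<in> M" by (rule clus_M) simp
    show "(\<Prod>i\<in>{1..n}. clus i * clus (n + i) * clus (2 * n + i)) * clus (3 * n + 1) / p \<in> M"
      using p(2) unfolding \<mu>_def .
  qed
  then show ?thesis
  proof
    assume "(\<Prod>i\<in>{1..n}. clus i * clus (n + i) * clus (2 * n + i)) / p \<in> M"
    then have "\<exists>i\<in>{1..n}. clus i * clus (n + i) * clus (2 * n + i) / p \<in> M"
      by (intro prime_on_dvd_prod[OF M_subring p(1) finite_atLeastAtMost gM])
    then obtain i where i: "i \<in> {1..n}" "clus i * clus (n + i) * clus (2 * n + i) / p \<in> M" by blast
    then have "clus i / p \<in> M \<or> clus (n + i) / p \<in> M \<or> clus (2 * n + i) / p \<in> M"
      using prime_onD(4)[OF p(1)] cM[OF i(1)] mult by blast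
    moreover have "i \<in> {1..V}" "n + i \<in> {1..V}" "2 * n + i \<in> {1..V}" using i(1) by auto
    ultimately show ?thesis by blast
  next
    assume "clus (3 * n + 1) / p \<in> M"
    then show ?thesis by (intro bexI[of _ "3 * n + 1"]) auto
  qed
qed

lemma comb_x_weights:
  assumes "i \<in> {1..n}"
  shows "G.comb J \<gamma> (\<lambda>j. w j (x i)) = \<one>\<^bsub>G\<^esub>"
  unfolding relations
  using assms by (intro exI[of _ "\<lambda>k. if k = i then 1 else 0"]) (auto simp: w_x)

lemma h_pdiv_prime:
  assumes p: "prime_on M p"
  shows "h (pdiv p) = \<one>\<^bsub>G\<^esub>"
proof (cases "\<mu> / p \<in> M")
  case False
  have pW: "Poly_Mapping.keys (frag_of (pval M p)) \<subseteq> W" using p False by (auto simp: W_def keys_frag_of)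
  have "h (pdiv p) = \<psi> (pval M p) \<otimes>\<^bsub>G\<^esub> G.comb J \<gamma> (\<lambda>j. w j p)"
    unfolding pdiv_prime[OF p False] h_add[OF pW wpart_keys] h_wpart
    using pW by (simp add: h_frag keys_frag_of)
  also have "\<dots> = G.comb J \<gamma> (\<lambda>j. - w j p + w j p)"
    unfolding \<psi>_pval[OF p False] by (rule G.comb_add[OF \<gamma>, symmetric])
  also have "\<dots> = \<one>\<^bsub>G\<^esub>" by (rule G.comb_zero) simp
  finally show ?thesis .
next
  case True
  note pD = prime_onD[OF p]
  have pK: "p \<in> K" "p \<noteq> 0" using pD MK by auto
  have "pval M q p = 0" if q: "prime_on M q" "\<mu> / q \<notin> M" for q
  proof (rule F.pval_zero[OF q(1) pD(1)], rule notI)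
    assume "p / q \<in> M"
    then have "(\<mu> / p) * (p / q) \<in> M" using True is_subring_closed(4)[OF M_subring] by blast
    then show False using q(2) pD(2) by simp
  qed
  then have "pdiv p = wpart (\<lambda>j. w j p)" by (rule pdiv_weights_only[OF pK])
  then have "h (pdiv p) = G.comb J \<gamma> (\<lambda>j. w j p)" by (simp add: h_wpart)
  also have "\<dots> = \<one>\<^bsub>G\<^esub>"
  proof -
    obtain k where k: "k \<in> {1..V}" "clus k / p \<in> M" using \<mu>_prime_factor[OF p True] by auto
    show ?thesis
    proof (cases "k \<le> n")
      case True
      then have kn: "k \<in> {1..n}" using k(1) by auto
      have xk: "x k / p \<in> M" using k(2) clus_simps(1)[OF kn] by simp
      have "prime_on M (x k)" using var_prime[OF k(1)] unfolding M_def .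
      then have "w j p = w j (x k)" for j using associated_w[OF _ p xk] by simp
      then show ?thesis using comb_x_weights[OF kn] by simp
    next
      case False
      then have kf: "k \<in> {n + 1..V}" using k(1) by auto
      have "w j p = 0" if j: "j \<in> J" for j
      proof -
        have c0: "clus k / p \<noteq> 0" using clus_nonzero[OF k(1)] pD(2) by simp
        have "w j (clus k / p * p) = w j (clus k / p) + w j p" by (rule w_mult[OF c0 pD(2)])
        moreover have "w j (clus k) = 0" by (rule w_clus_frozen[OF j kf])
        moreover have "0 \<le> w j (clus k / p)" "0 \<le> w j p"
          using w_nonneg[of _ V, folded M_def] k(2) c0 pD by auto
        ultimately show ?thesis using pD(2) by simp
      qed
      then show ?thesis by (rule G.comb_zero)
    qed
  qed
  finally show ?thesis .
qed

text \<open>By multiplicativity it suffices to treat units and primes of \<open>M\<close>.\<close>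

lemma h_pdiv: "z \<in> K \<Longrightarrow> z \<noteq> 0 \<Longrightarrow> h (pdiv z) = \<one>\<^bsub>G\<^esub>"
proof -
  have M: "h (pdiv a) = \<one>\<^bsub>G\<^esub>" if "a \<in> M" "a \<noteq> 0" for a
    using F.fact that
  proof (induction a rule: factorial_induct)
    case (unit u)
    obtain c where c: "c \<noteq> 0" "u = const c" using M_units[OF unit] by auto
    have uK: "u \<in> K" "u \<noteq> 0" using unit_onD[OF unit] MK by auto
    have "pval M p u = 0" if "prime_on M p" for p
      using prime_not_dvd_unit[OF M_subring that unit] by (rule F.pval_zero[OF that unit_onD(1)[OF unit]])
    then have "pdiv u = wpart (\<lambda>j. w j u)" by (intro pdiv_weights_only[OF uK])
    then show ?case using h_wpart G.comb_zero[of J "\<lambda>j. w j u" \<gamma>] w_const[OF c(1)] c(2) by simp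
  next
    case (prime p a)
    note pD = prime_onD[OF prime(1)]
    have "p \<in> K" "a \<in> K" using pD(1) prime(2) MK by auto
    then show ?case
      using pdiv_mult[of p a] h_add[of "pdiv p" "pdiv a"] pdiv_keys h_pdiv_prime[OF prime(1)] prime(3,4) pD(2) by simp
  qed
  assume z: "z \<in> K" "z \<noteq> 0"
  then obtain a b where ab: "a \<in> M" "b \<in> M" "b \<noteq> 0" "z = a / b" using F.Q_iff unfolding K_eq by blast
  then have a0: "a \<noteq> 0" "a = z * b" using z by auto
  have bK: "b \<in> K" using ab MK by auto
  have "h (pdiv a) = h (pdiv z) \<otimes>\<^bsub>G\<^esub> h (pdiv b)"
    unfolding a0(2) pdiv_mult[OF z bK ab(3)] by (rule h_add[OF pdiv_keys[OF z] pdiv_keys[OF bK ab(3)]])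
  then show ?thesis using M[OF ab(1) a0(1)] M[OF ab(2,3)] h_closed[OF pdiv_keys[OF z]] by simp
qed

text \<open>This is the step of Nagata's theorem: by \<open>pdiv_prime\<close>, each place of a
  prime element can be exchanged for places \<open>w j\<close> at the cost of a principal
  divisor.\<close>

lemma divisor_decomposition:
  assumes "Poly_Mapping.keys D \<subseteq> W"
  shows "\<exists>z\<in>K - {0}. \<exists>c. D = pdiv z + wpart c"
  using assms
proof (rule free_Abelian_group_induct)
  have one: "1 \<in> K - {0}" using is_subring_closed(1)[OF K_subring] by simp
  have zero: "pdiv 1 = 0"
  proof (rule poly_mapping_eqI)
    fix v
    have "v 1 = 0" if "v \<in> W" using valued_field.val_1[OF W_field[OF that]] .
    then show "Poly_Mapping.lookup (pdiv 1) v = Poly_Mapping.lookup 0 v" using one by (simp add: lookup_pdiv)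
  qed
  have w0: "wpart (\<lambda>_. 0) = 0" by (simp add: wpart_def)
  show "\<exists>z\<in>K - {0}. \<exists>c. 0 = pdiv z + wpart c" using one zero w0 by (intro bexI[of _ 1] exI[of _ "\<lambda>_. 0"]) auto
  have wdiff: "wpart (\<lambda>j. c j - c' j) = wpart c - wpart c'" for c c'
    by (simp add: wpart_def frag_cmul_diff_distrib sum_subtractf)
  fix D E assume "\<exists>z\<in>K - {0}. \<exists>c. D = pdiv z + wpart c" "\<exists>z\<in>K - {0}. \<exists>c. E = pdiv z + wpart c"
  then obtain y z c c' where yz: "y \<in> K" "y \<noteq> 0" "z \<in> K" "z \<noteq> 0" "D = pdiv y + wpart c" "E = pdiv z + wpart c'" by blast
  have q: "y / z \<in> K" "y / z \<noteq> 0" using yz is_subring_closed(4)[OF K_subring yz(1) K_inverse[OF yz(3)]] by (auto simp: divide_inverse)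
  have "pdiv y = pdiv (y / z) + pdiv z" using pdiv_mult[OF q yz(3,4)] yz(4) by simp
  then have "D - E = pdiv (y / z) + wpart (\<lambda>j. c j - c' j)" unfolding yz(5,6) wdiff by simp
  then show "\<exists>z\<in>K - {0}. \<exists>c. D - E = pdiv z + wpart c" using q by blast
next
  have one: "1 \<in> K - {0}" using is_subring_closed(1)[OF K_subring] by simp
  fix v assume v: "v \<in> W"
  then show "\<exists>z\<in>K - {0}. \<exists>c. frag_of v = pdiv z + wpart c"
  proof (cases rule: W_cases)
    case (prime p)
    have "wpart (\<lambda>j. - w j p) = - wpart (\<lambda>j. w j p)" by (simp add: wpart_def sum_negf flip: minus_frag_cmul)
    then have "frag_of v = pdiv p + wpart (\<lambda>j. - w j p)"
      unfolding pdiv_prime[OF prime(1,2)] prime(3) by simp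
    then show ?thesis using prime_onD[OF prime(1)] MK by blast
  next
    case (weight j)
    have "frag_of v = pdiv 1 + wpart (\<lambda>i. if i = j then 1 else 0)"
    proof (rule divisor_eqI)
      have o: "1 \<in> K" "(1 :: 'a ratfun) \<noteq> 0" using one by auto
      show "Poly_Mapping.keys (frag_of v) \<subseteq> W" using v by (simp add: keys_frag_of)
      show "Poly_Mapping.keys (pdiv 1 + wpart (\<lambda>i. if i = j then 1 else 0)) \<subseteq> W"
        using keys_add[of "pdiv 1" "wpart (\<lambda>i. if i = j then 1 else 0)"] wpart_keys pdiv_keys[OF o] by blast
      fix u assume u: "u \<in> W"
      have "u 1 = 0" using valued_field.val_1[OF W_field[OF u]] .
      moreover have "Poly_Mapping.lookup (wpart (\<lambda>i. if i = j then 1 else 0)) u = (if u = w j then 1 else 0)"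
        using lookup_wpart w_inj weight(1) by (cases "u \<in> w ` J") force+
      ultimately show "Poly_Mapping.lookup (frag_of v) u = Poly_Mapping.lookup (pdiv 1 + wpart (\<lambda>i. if i = j then 1 else 0)) u"
        using weight u by (simp add: lookup_add lookup_pdiv[OF o])
    qed
    then show ?thesis using one by blast
  qed
qed

text \<open>Modulo principal divisors \<open>D\<close> is supported on the places
  \<open>w j\<close>. If its class is trivial, its coefficients form a relation, hence a combination
  of divisors of the \<open>x i\<close>, which is principal.\<close>

lemma h_eq_one_iff:
  assumes D: "Poly_Mapping.keys D \<subseteq> W"
  shows "h D = \<one>\<^bsub>G\<^esub> \<longleftrightarrow> (\<exists>z\<in>K - {0}. \<forall>v\<in>W. Poly_Mapping.lookup D v = v z)"
proof
  assume "\<exists>z\<in>K - {0}. \<forall>v\<in>W. Poly_Mapping.lookup D v = v z"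
  then obtain z where z: "z \<in> K" "z \<noteq> 0" "\<forall>v\<in>W. Poly_Mapping.lookup D v = v z" by blast
  have "D = pdiv z" using z(3) by (intro divisor_eqI[OF D pdiv_keys[OF z(1,2)]]) (simp add: lookup_pdiv[OF z(1,2)])
  then show "h D = \<one>\<^bsub>G\<^esub>" using h_pdiv[OF z(1,2)] by simp
next
  assume h1: "h D = \<one>\<^bsub>G\<^esub>"
  obtain z c where z: "z \<in> K" "z \<noteq> 0" "D = pdiv z + wpart c" using divisor_decomposition[OF D] by blast
  have "h D = h (pdiv z) \<otimes>\<^bsub>G\<^esub> h (wpart c)" unfolding z(3) by (rule h_add[OF pdiv_keys[OF z(1,2)] wpart_keys])
  then have "G.comb J \<gamma> c = \<one>\<^bsub>G\<^esub>" using h1 h_pdiv[OF z(1,2)] h_wpart G.comb_closed[OF \<gamma>] by simp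
  then obtain l where l: "\<forall>j\<in>J. c j = l (blk j) * int (expo j)" using relations by blast
  \<comment> \<open>The multipliers of the relation become exponents, so that \<open>y\<close> has
    value \<open>c j\<close> at \<open>w j\<close> and value \<open>0\<close> at all other
    places.\<close>
  define y where "y = (\<Prod>i\<in>{1..n}. x i powi l i)"
  have xK: "x i \<in> K" "x i \<noteq> 0" if "i \<in> {1..n}" for i
    using rvar_M[of i] MK that by (auto simp: rvar_nonzero)
  have pK: "x i powi k \<in> K" if "i \<in> {1..n}" for i k
    using xK[OF that] K_inverse is_subring_closed(7)[OF K_subring] by (auto simp: power_int_def)
  have y: "y \<in> K" "y \<noteq> 0"
    unfolding y_def using pK by (auto intro!: is_subring_prod[OF K_subring] simp: rvar_nonzero)
  have vy: "v y = (\<Sum>i\<in>{1..n}. l i * v (x i))" if v: "v \<in> W" for v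
  proof -
    have "v (\<Prod>i\<in>I. x i powi l i) = (\<Sum>i\<in>I. l i * v (x i)) \<and> (\<Prod>i\<in>I. x i powi l i) \<in> K" if "finite I" "I \<subseteq> {1..n}" for I
      using that
    proof (induction I)
      case empty
      then show ?case using valued_field.val_1[OF W_field[OF v]] is_subring_closed(1)[OF K_subring] by simp
    next
      case (insert i I)
      then have i: "i \<in> {1..n}" by auto
      have "v (x i powi l i * (\<Prod>i\<in>I. x i powi l i)) = v (x i powi l i) + v (\<Prod>i\<in>I. x i powi l i)"
        using insert pK[OF i] by (intro valued_field.val_mult[OF W_field[OF v]]) (auto simp: rvar_nonzero)
      moreover have "v (x i powi l i) = l i * v (x i)" by (rule valued_field.val_powi[OF W_field[OF v] xK[OF i]])
      ultimately show ?case using insert is_subring_closed(4)[OF K_subring pK[OF i]] by simp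
    qed
    then show ?thesis unfolding y_def by simp
  qed
  have "pdiv y = wpart (\<lambda>j. w j y)"
  proof (rule pdiv_weights_only[OF y])
    fix p assume p: "prime_on M p" "\<mu> / p \<notin> M"
    then have pW: "pval M p \<in> W" by (auto simp: W_def)
    have "pval M p (x i) = 0" if "i \<in> {1..n}" for i
      using pval_clus[OF p, of i] that clus_simps(1)[OF that] by simp
    then show "pval M p y = 0" unfolding vy[OF pW] by (intro sum.neutral) auto
  qed
  moreover have "w j y = c j" if j: "j \<in> J" for j
  proof -
    have "w j y = (\<Sum>i\<in>{1..n}. if i = blk j then l (blk j) * int (expo j) else 0)"
      unfolding vy[OF w_W[OF j]] using w_x[OF j] by (intro sum.cong) auto
    also have "\<dots> = l (blk j) * int (expo j)" using J_facts(3)[OF j] by simp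
    finally show ?thesis using l j by simp
  qed
  then have "wpart (\<lambda>j. w j y) = wpart c" by (simp add: wpart_def)
  ultimately have "D = pdiv (z * y)" using z(3) pdiv_mult[OF z(1,2) y] by simp
  moreover have zy: "z * y \<in> K" "z * y \<noteq> 0" using z y is_subring_closed(4)[OF K_subring] by auto
  ultimately have "\<forall>v\<in>W. Poly_Mapping.lookup D v = v (z * y)" by (simp add: lookup_pdiv[OF zy])
  then show "\<exists>z\<in>K - {0}. \<forall>v\<in>W. Poly_Mapping.lookup D v = v z" using zy by blast
qed

end

section \<open>Number of primes in each class\<close>

context block_class
begin

text \<open>Apart from the finitely many \<open>w j\<close>, every place comes from an element of
  \<open>M\<close>, and \<open>M\<close> is no larger than the ground field.\<close>

lemma W_lepoll:
  assumes "U \<subseteq> W"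
  shows "U \<lesssim> (UNIV :: 'a set)"
proof -
  have inf: "infinite (UNIV :: 'a set)" by (rule infinite_UNIV_char_0)
  have "pval M ` M \<lesssim> M" by (rule image_lepoll)
  also have "M \<lesssim> (UNIV :: 'a set)" unfolding M_def by (rule mring_lepoll[OF inf])
  finally have 1: "pval M ` M \<lesssim> (UNIV :: 'a set)" .
  have 2: "w ` J \<lesssim> (UNIV :: 'a set)" using finite_J inf by (intro finite_lepoll_infinite) auto
  have "|pval M ` M \<union> w ` J| \<le>o |UNIV :: 'a set|"
    using inf 1 2 unfolding lepoll_def card_of_ordLeq by (rule card_of_Un_ordLeq_infinite)
  then have "pval M ` M \<union> w ` J \<lesssim> (UNIV :: 'a set)" unfolding lepoll_def card_of_ordLeq .
  moreover have "U \<subseteq> pval M ` M \<union> w ` J" using assms prime_onD(1) unfolding W_def by blast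
  ultimately show ?thesis using subset_imp_lepoll lepoll_trans by blast
qed

text \<open>The coefficients will be exponents of a monomial and must not be negative. Adding a
  large multiple of the relation with all multipliers \<open>1\<close> makes them so.\<close>

lemma spanning_nat: "g \<in> carrier G \<Longrightarrow> \<exists>b :: nat \<Rightarrow> nat. G.comb J \<gamma> (\<lambda>j. int (b j)) = g"
proof -
  assume "g \<in> carrier G"
  then obtain c where c: "g = G.comb J \<gamma> c" using spanning by blast
  define N where "N = (\<Sum>j\<in>J. \<bar>c j\<bar>)"
  have N: "\<bar>c j\<bar> \<le> N" if "j \<in> J" for j
    unfolding N_def using that finite_J by (intro member_le_sum) auto
  have rel: "G.comb J \<gamma> (\<lambda>j. N * int (expo j)) = \<one>\<^bsub>G\<^esub>" unfolding relations by (intro exI[of _ "\<lambda>_. N"]) simp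
  have "G.comb J \<gamma> (\<lambda>j. int (nat (c j + N * int (expo j)))) = G.comb J \<gamma> (\<lambda>j. c j + N * int (expo j))"
  proof (rule G.comb_cong[OF _ _ \<gamma>])
    fix j assume j: "j \<in> J"
    have "1 \<le> int (expo j)" "0 \<le> N" using J_facts(4)[OF j] N[OF j] by auto
    then have "N * 1 \<le> N * int (expo j)" by (rule mult_left_mono)
    then show "int (nat (c j + N * int (expo j))) = c j + N * int (expo j)" using N[OF j] by simp
  qed simp
  also have "\<dots> = g" unfolding G.comb_add[OF \<gamma>] rel c[symmetric] using \<open>g \<in> carrier G\<close> by simp
  finally show ?thesis by (rule exI[of _ "\<lambda>j. nat (c j + N * int (expo j))"])
qed

text \<open>
  The prime elements \<open>a + c y\<^sup>E t\<close>, where \<open>a = \<Prod>\<^sub>j X\<^sub>j\<^bsup>b j\<^esup>\<close>, \<open>y = x\<^sub>1 \<cdots> x\<^sub>n\<close> and \<open>E\<close> is large, all have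
  \<open>w j\<close>-value \<open>b j\<close>, hence lie in the same class.
\<close>

lemma many_primes:
  fixes b :: "nat \<Rightarrow> nat"
  shows "\<exists>\<pi> :: 'a \<Rightarrow> 'a ratfun. \<forall>c \<in> - {0}. prime_on M (\<pi> c) \<and> \<mu> / \<pi> c \<notin> M \<and>
    (\<forall>j\<in>J. w j (\<pi> c) = int (b j)) \<and> (\<forall>c' \<in> - {0}. c \<noteq> c' \<longrightarrow> \<pi> c / \<pi> c' \<notin> M)"
proof -
  define N where "N = 3 * n"
  define P where "P = (mring N :: 'a ratfun set)"
  have P: "is_subring P" unfolding P_def by (rule mring_subring)
  have MP: "M = adjoin P (rvar (Suc N))" unfolding M_def P_def mring_Suc[symmetric] by (simp add: N_def)
  have tN: "t = rvar (Suc N)" by (simp add: N_def)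
  note ctx = mring_factorial[of N, where 'a = 'a, folded P_def] var_transcendental[of N, where 'a = 'a, folded P_def]
  have PM: "P \<subseteq> M" unfolding MP by (rule subset_adjoin[OF P])
  have rP: "rvar k \<in> P" if "k \<in> {1..N}" for k using that unfolding P_def by (rule var_in_mring)
  have cP: "const c \<in> P" for c :: 'a unfolding P_def by (rule const_in_mring)
  have JN: "j \<in> {1..N}" if "j \<in> J" for j using J_facts(1,2)[OF that] by (simp add: N_def)
  \<comment> \<open>With \<open>E\<close> above every \<open>b j\<close>, the term with
    \<open>y ^ E\<close> has larger value than \<open>a\<close> at each \<open>w j\<close>, so
    \<open>a\<close> alone decides the value of the sum.\<close>
  define E where "E = Suc (\<Sum>j\<in>J. b j)"
  have E: "b j < E" if "j \<in> J" for j
    unfolding E_def using member_le_sum[OF that _ finite_J, of b] by simp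
  define a where "a = (\<Prod>j\<in>J. rvar j ^ b j :: 'a ratfun)"
  define y where "y = (\<Prod>i\<in>{1..n}. x i)"
  have aP: "a \<in> P" unfolding a_def using rP JN by (intro is_subring_prod[OF P] is_subring_closed(7)[OF P]) auto
  have yP: "y ^ E \<in> P" unfolding y_def using rP by (intro is_subring_closed(7)[OF P] is_subring_prod[OF P]) (auto simp: N_def)
  have a0: "a \<noteq> 0" and y0: "y \<noteq> 0" using finite_J by (auto simp: a_def y_def rvar_nonzero)
  have const0: "const c \<noteq> 0" if "c \<noteq> 0" for c :: 'a
  proof
    assume "const c = 0"
    then have "const (c * inverse c) = 0" by (simp add: const_hom.hom_mult)
    then show False using that by (simp add: const_hom.hom_1)
  qed
  define \<pi> where "\<pi> c = a + (const c * y ^ E) * rvar (Suc N)" for c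
  have cy: "const c * y ^ E \<in> P" for c by (rule is_subring_closed(4)[OF P cP yP])
  have cy0: "const c * y ^ E \<noteq> 0" if "c \<noteq> 0" for c using const0[OF that] y0 by simp
  have prime: "prime_on M (\<pi> c)" if c: "c \<noteq> 0" for c
    unfolding MP \<pi>_def
  proof (rule prime_on_linear[OF ctx aP cy cy0[OF c]])
    \<comment> \<open>\<open>a\<close> involves only variables with index above \<open>n\<close> and
      \<open>y\<close> only those up to \<open>n\<close>, so no prime divides both.\<close>
    fix p assume p: "prime_on P p" "a / p \<in> P" "const c * y ^ E / p \<in> P"
    have "\<exists>j\<in>J. rvar j ^ b j / p \<in> P"
      by (rule prime_on_dvd_prod[OF P p(1) finite_J _ p(2)[unfolded a_def]])
         (intro is_subring_closed(7)[OF P] rP JN)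
    then obtain j where j: "j \<in> J" "rvar j / p \<in> P" using prime_on_dvd_power[OF P p(1) rP[OF JN]] by blast
    have "unit_on P (const c)" using c cP[of c] cP[of "inverse c"] const0[OF c] by (simp add: unit_on_def const_inverse)
    then have "const c / p \<notin> P" by (rule prime_not_dvd_unit[OF P p(1)])
    then have "y ^ E / p \<in> P" using prime_onD(4)[OF p(1) cP yP p(3)] by blast
    then have "y / p \<in> P" by (rule prime_on_dvd_power[OF P p(1), rotated])
        (unfold y_def, intro is_subring_prod[OF P] rP, simp add: N_def)
    then have "\<exists>i\<in>{1..n}. x i / p \<in> P"
      unfolding y_def by (intro prime_on_dvd_prod[OF P p(1)] rP) (auto simp: N_def)
    then obtain i where i: "i \<in> {1..n}" "x i / p \<in> P" by blast
    have "j = i" using prime_dvd_rvar_unique[OF p(1)[unfolded P_def] JN[OF j(1)] _ j(2)[unfolded P_def] i(2)[unfolded P_def]] i(1)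
      by (simp add: N_def)
    then show False using J_facts(1)[OF j(1)] i(1) by simp
  qed
  have ndvd: "z / \<pi> c \<notin> M" "t / \<pi> c \<notin> M" if "c \<noteq> 0" "z \<in> P" "z \<noteq> 0" for c z
    unfolding MP \<pi>_def tN using linear_not_dvd[OF ctx aP cy a0 cy0[OF that(1)] that(2,3)] by auto
  have clusP: "clus k \<in> P" if "k \<in> {1..V}" "k \<noteq> 3 * n + 1" for k
    using that(1)
  proof (cases rule: block_cases)
    case x
    then show ?thesis unfolding clus_simps(1)[OF x] by (intro rP) (auto simp: N_def)
  next
    case (u i)
    then show ?thesis unfolding u(2) clus_simps(2)[OF u(1)]
      by (intro is_subring_closed(3,4)[OF P] cP rP) (auto simp: N_def)
  next
    case (v i)
    then show ?thesis unfolding v(2) clus_simps(3)[OF v(1)]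
      by (intro is_subring_closed(3)[OF P] rP) (auto simp: N_def)
  qed (use that in auto)
  \<comment> \<open>If the prime \<open>\<pi> c\<close> divided \<open>\<mu>\<close>, it would
    divide an initial variable, which is \<open>t\<close> or free of \<open>t\<close>.\<close>
  have mu: "\<mu> / \<pi> c \<notin> M" if c: "c \<noteq> 0" for c
  proof
    assume "\<mu> / \<pi> c \<in> M"
    then obtain k where k: "k \<in> {1..V}" "clus k / \<pi> c \<in> M" using \<mu>_prime_factor[OF prime[OF c]] by blast
    show False
    proof (cases "k = 3 * n + 1")
      case True
      then show False using k(2) ndvd(2)[OF c is_subring_closed(1)[OF P]] clus_simps(4) by simp
    next
      case False
      then show False using k ndvd(1)[OF c clusP[OF k(1) False] clus_nonzero[OF k(1)]] by blast
    qed
  qed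
  have wa: "w j a = int (b j)" if j: "j \<in> J" for j
  proof -
    have "w j a = (\<Sum>i\<in>J. w j (rvar i ^ b i))" unfolding a_def using finite_J by (intro w_prod) (auto simp: rvar_nonzero)
    also have "\<dots> = (\<Sum>i\<in>J. if i = j then int (b j) else 0)"
    proof (rule sum.cong)
      fix i assume i: "i \<in> J"
      show "w j (rvar i ^ b i) = (if i = j then int (b j) else 0)"
        using w_coordinate[OF j J_facts(1)[OF i]] by (simp add: w_power rvar_nonzero)
    qed simp
    finally show ?thesis using j finite_J by simp
  qed
  have weights: "w j (\<pi> c) = int (b j)" if c: "c \<noteq> 0" and j: "j \<in> J" for c j
  proof -
    have "w j y = (\<Sum>i\<in>{1..n}. if i = blk j then int (expo j) else 0)"
      unfolding y_def using w_x[OF j] by (subst w_prod) (auto simp: rvar_nonzero)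
    also have "\<dots> = int (expo j)" using J_facts(3)[OF j] by simp
    finally have "w j (y ^ E) = int E * int (expo j)" by (simp add: w_power y0)
    moreover have "w j (rvar (Suc N)) = 0"
      using w_coordinate[OF j, of "Suc N"] J_facts(2)[OF j] by (simp add: N_def)
    ultimately have "w j (const c * y ^ E * rvar (Suc N)) = int E * int (expo j)"
      using const0[OF c] w_const[OF c] y0 by (simp add: w_mult rvar_nonzero)
    moreover have "int (b j) < int E * int (expo j)"
    proof -
      have "int E * 1 \<le> int E * int (expo j)" using J_facts(4)[OF j] by (intro mult_left_mono) auto
      then show ?thesis using E[OF j] by linarith
    qed
    ultimately have "w j a < w j (const c * y ^ E * rvar (Suc N))" using wa[OF j] by simp
    then have "w j (a + const c * y ^ E * rvar (Suc N)) = w j a"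
      using a0 cy0[OF c] by (intro valued_field.val_add_eq(2)[OF w_field]) (auto simp: rvar_nonzero)
    then show ?thesis using wa[OF j] by (simp add: \<pi>_def)
  qed
  \<comment> \<open>A prime dividing both would divide their difference, which is \<open>t\<close>
    times an element free of \<open>t\<close>.\<close>
  have distinct: "\<pi> c / \<pi> c' \<notin> M" if c: "c \<noteq> 0" "c' \<noteq> 0" "c \<noteq> c'" for c c'
  proof
    assume d: "\<pi> c / \<pi> c' \<in> M"
    note p0 = prime_onD(2)[OF prime[OF c(2)]]
    have z: "const (c - c') * y ^ E \<in> P" "const (c - c') * y ^ E \<noteq> 0" using cy cy0[of "c - c'"] c(3) by auto
    have cc: "const c = const (c - c') + const c'" using const_hom.hom_add[of "c - c'" c'] by simp
    have "\<pi> c - \<pi> c' = (const (c - c') * y ^ E) * t"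
      unfolding \<pi>_def tN cc by (simp add: algebra_simps)
    moreover have "\<pi> c / \<pi> c' - 1 \<in> M" using is_subring_closed(3)[OF M_subring d is_subring_closed(1)[OF M_subring]] .
    moreover have "\<pi> c / \<pi> c' - 1 = (\<pi> c - \<pi> c') / \<pi> c'" using p0 by (simp add: diff_divide_distrib)
    ultimately have "(const (c - c') * y ^ E) * t / \<pi> c' \<in> M" by simp
    moreover have "const (c - c') * y ^ E \<in> M" "t \<in> M" using z(1) PM rvar_M[of "3 * n + 1"] by auto
    ultimately have "const (c - c') * y ^ E / \<pi> c' \<in> M \<or> t / \<pi> c' \<in> M"
      by (intro prime_onD(4)[OF prime[OF c(2)]])
    then show False using ndvd[OF c(2) z] by blast
  qed
  show ?thesis
    by (rule exI[of _ \<pi>]) (use prime mu weights distinct in auto)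
qed

lemma fibre_eqpoll:
  assumes g: "g \<in> carrier G"
  shows "{v \<in> W. h (frag_of v) = g} \<approx> (UNIV :: 'a set)"
proof (rule lepoll_antisym)
  show "{v \<in> W. h (frag_of v) = g} \<lesssim> (UNIV :: 'a set)" by (rule W_lepoll) auto
  \<comment> \<open>The inverse appears because the class of a prime element's place is the negative
    combination of its weights.\<close>
  obtain b where b: "G.comb J \<gamma> (\<lambda>j. int (b j)) = inv\<^bsub>G\<^esub> g" using spanning_nat[of "inv\<^bsub>G\<^esub> g"] g by auto
  obtain \<pi> :: "'a \<Rightarrow> 'a ratfun" where \<pi>: "\<And>c. c \<noteq> 0 \<Longrightarrow> prime_on M (\<pi> c)" "\<And>c. c \<noteq> 0 \<Longrightarrow> \<mu> / \<pi> c \<notin> M"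
    "\<And>c j. c \<noteq> 0 \<Longrightarrow> j \<in> J \<Longrightarrow> w j (\<pi> c) = int (b j)"
    "\<And>c c'. c \<noteq> 0 \<Longrightarrow> c' \<noteq> 0 \<Longrightarrow> c \<noteq> c' \<Longrightarrow> \<pi> c / \<pi> c' \<notin> M"
  proof -
    obtain \<pi> :: "'a \<Rightarrow> 'a ratfun" where \<pi>: "\<forall>c \<in> - {0}. prime_on M (\<pi> c) \<and> \<mu> / \<pi> c \<notin> M \<and>
      (\<forall>j\<in>J. w j (\<pi> c) = int (b j)) \<and> (\<forall>c' \<in> - {0}. c \<noteq> c' \<longrightarrow> \<pi> c / \<pi> c' \<notin> M)"
      using many_primes[of b] by (elim exE)
    note 1 = bspec[OF \<pi>]
    show thesis by (rule that[of \<pi>]) (use 1 in simp_all)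
  qed
  have inf: "infinite (- {0 :: 'a})" using infinite_UNIV_char_0[where 'a = 'a] by simp
  have "(UNIV :: 'a set) = insert 0 (- {0})" by auto
  then have "(UNIV :: 'a set) \<approx> - {0 :: 'a}" using infinite_insert_eqpoll[OF inf, of 0] by simp
  also have "- {0 :: 'a} \<lesssim> {v \<in> W. h (frag_of v) = g}"
    unfolding lepoll_def
  proof (intro exI conjI)
    show "inj_on (\<lambda>c. pval M (\<pi> c)) (- {0})"
    proof (rule inj_onI)
      fix c c' assume c: "c \<in> - {0}" "c' \<in> - {0}" "pval M (\<pi> c) = pval M (\<pi> c')"
      then have "\<pi> c / \<pi> c' \<in> M" by (intro pval_eq_imp_dvd \<pi>(1)) auto
      then show "c = c'" using \<pi>(4)[of c c'] c by auto
    qed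
    show "(\<lambda>c. pval M (\<pi> c)) ` (- {0}) \<subseteq> {v \<in> W. h (frag_of v) = g}"
    proof (rule image_subsetI)
      fix c :: 'a assume "c \<in> - {0}"
      then have c: "c \<noteq> 0" by simp
      have v: "pval M (\<pi> c) \<in> W" unfolding W_def using \<pi>(1,2)[OF c] by (intro UnI1 imageI) simp
      have "h (frag_of (pval M (\<pi> c))) = G.comb J \<gamma> (\<lambda>j. - w j (\<pi> c))"
        unfolding h_frag[OF v] by (rule \<psi>_pval[OF \<pi>(1,2)[OF c]])
      also have "\<dots> = G.comb J \<gamma> (\<lambda>j. - int (b j))"
        using \<pi>(3)[OF c] by (intro G.comb_cong[OF _ _ \<gamma>]) auto
      also have "\<dots> = g" unfolding G.comb_minus[OF finite_J \<gamma>] b using g by simp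
      finally show "pval M (\<pi> c) \<in> {v \<in> W. h (frag_of v) = g}" using v by simp
    qed
  qed
  finally show "(UNIV :: 'a set) \<lesssim> {v \<in> W. h (frag_of v) = g}" .
qed

sublocale krull_class G algebra K W h
proof
  show "is_subring K" "y \<in> K \<Longrightarrow> inverse y \<in> K" for y using K_subring K_inverse by auto
  show "v \<in> W \<Longrightarrow> valuation_on K v" for v using valued_field.val[OF W_field] .
  show "z \<in> K \<Longrightarrow> z \<noteq> 0 \<Longrightarrow> finite {v \<in> W. v z \<noteq> 0}" for z by (rule W_finite)
  show "algebra = {z \<in> K. z = 0 \<or> (\<forall>v\<in>W. 0 \<le> v z)}" by (rule algebra_eq)
  show "h \<in> hom (free_Abelian_group W) G" by (rule h_hom)
  show "Poly_Mapping.keys D \<subseteq> W \<Longrightarrow> h D = \<one>\<^bsub>G\<^esub> \<longleftrightarrow> (\<exists>z\<in>K - {0}. \<forall>v\<in>W. Poly_Mapping.lookup D v = v z)" for D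
    by (rule h_eq_one_iff)
  show "infinite {v \<in> W. h (frag_of v) = g}" if "g \<in> carrier G" for g
    using eqpoll_finite_iff[OF fibre_eqpoll[OF that]] infinite_UNIV_char_0[where 'a = 'a] by simp
qed

theorem realizes:
  "krull_domain algebra" "class_group algebra \<cong> G"
  "c \<in> carrier (class_group algebra) \<Longrightarrow> prime_divisors_in_class algebra c \<approx> (UNIV :: 'a set)"
  using krull_domain_A class_group_iso prime_divisors_in_class_eqpoll[OF _ fibre_eqpoll] by auto

end

subsection \<open>The theorem\<close>

text \<open>\<open>\<phi> * (\<phi> + 1)\<close> is the constant term of the quadratic with roots
  \<open>\<phi>\<close> and \<open>\<phi> + 1\<close>, and the first exchange coefficient has to be
  \<open>1\<close>.\<close>

lemma golden_root: "\<exists>\<phi> :: 'a::alg_closed_field. \<phi> * (\<phi> + 1) = 1"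
proof -
  have "degree [:- 1, 1, 1 :: 'a:] > 0" by simp
  then obtain \<phi> where "poly [:- 1, 1, 1 :: 'a:] \<phi> = 0" using alg_closed_imp_poly_has_root by blast
  then show ?thesis by (intro exI[of _ \<phi>]) (simp add: algebra_simps)
qed

theorem theorem4p14:
  fixes G :: "('g, 'h) monoid_scheme"
  assumes "comm_group G"
    and "\<exists>Y. finite Y \<and> Y \<subseteq> carrier G \<and> generate G Y = carrier G"
  shows "\<exists>(n :: nat) (m :: nat) (d :: nat \<Rightarrow> nat)
            (S :: 'a::{alg_closed_field, field_char_0} gen_seed).
     is_gen_seed n m d S \<and> acyclic_seed n S \<and> coprime_seed n m d S \<and>
     krull_domain (gen_cluster_algebra n m d S) \<and>
     class_group (gen_cluster_algebra n m d S) \<cong> G \<and>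
     (\<forall>c \<in> carrier (class_group (gen_cluster_algebra n m d S)).
        prime_divisors_in_class (gen_cluster_algebra n m d S) c \<approx> (UNIV :: 'a set))"
proof -
  interpret G: comm_group G by fact
  obtain n g m where g: "g \<in> {1..n} \<rightarrow> carrier G" "range (G.comb {1..n} g) = carrier G"
    and rel: "\<And>c. G.comb {1..n} g c = \<one>\<^bsub>G\<^esub> \<longleftrightarrow> (\<forall>i\<in>{1..n::nat}. int (m i) dvd c i)"
    using assms(2) G.finitely_generated_cyclic_decomposition by metis
  obtain \<phi> :: 'a where \<phi>: "\<phi> * (\<phi> + 1) = 1" using golden_root by auto
  \<comment> \<open>An infinite factor needs two simple primes, with roots \<open>\<phi>\<close> and
    \<open>\<phi> + 1\<close>. A finite factor needs one prime of multiplicity \<open>m i\<close>;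
    the root \<open>-1\<close> gives \<open>(X + 1) ^ m i\<close>, whose end coefficients are
    \<open>1\<close>.\<close>
  define e where "e i = (if m i = 0 then 1 else m i)" for i
  define e' where "e' i = (if m i = 0 then 1 else 0 :: nat)" for i
  define \<alpha> where "\<alpha> i = (if m i = 0 then \<phi> else - 1)" for i
  have bs: "block_seed n e e' \<alpha>"
  proof
    show "(- \<alpha> i) ^ e i * (- (\<alpha> i + 1)) ^ e' i = 1" for i
      using \<phi> by (simp add: e_def e'_def \<alpha>_def algebra_simps)
  qed (simp add: e_def)
  interpret block_seed n e e' \<alpha> by (rule bs)
  \<comment> \<open>In a block with two primes the divisor of \<open>x i\<close> is their sum, so
    the prime \<open>r i\<close> must have the class inverse to that of \<open>s i\<close>.\<close>
  define \<gamma> where "\<gamma> j = (if j \<le> 2 * n then g (j - n) else inv\<^bsub>G\<^esub> g (j - 2 * n))" for j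
  have gi: "g i \<in> carrier G" if "i \<in> {1..n}" for i using g(1) that by auto
  have \<gamma>: "\<gamma> \<in> J \<rightarrow> carrier G"
  proof
    fix j assume "j \<in> J"
    then show "\<gamma> j \<in> carrier G" by (cases rule: J_cases) (auto simp: \<gamma>_def gi)
  qed
  \<comment> \<open>The primes \<open>r i\<close> exist only for \<open>m i = 0\<close> and
    contribute with a minus sign; so relations over \<open>J\<close> become relations of the
    independent generators \<open>g\<close>.\<close>
  have comb: "G.comb J \<gamma> c = G.comb {1..n} g (\<lambda>i. c (n + i) + (if m i = 0 then - c (2 * n + i) else 0))" for c
  proof -
    let ?S = "(\<lambda>i. n + i) ` {1..n}" and ?T = "{i \<in> {1..n}. 0 < e' i}"
    let ?R = "(\<lambda>i. 2 * n + i) ` ?T"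
    let ?F = "\<lambda>j. \<gamma> j [^]\<^bsub>G\<^esub> c j"
    have F: "?F \<in> ?S \<rightarrow> carrier G" "?F \<in> ?R \<rightarrow> carrier G" using \<gamma> by (auto simp: J_def)
    have "G.comb J \<gamma> c = finprod G ?F ?S \<otimes>\<^bsub>G\<^esub> finprod G ?F ?R"
      unfolding G.comb_def J_def by (rule G.finprod_Un_disjoint) (use F in auto)
    also have "finprod G ?F ?S = finprod G (\<lambda>i. ?F (n + i)) {1..n}"
      by (rule G.finprod_reindex) (use F in auto)
    also have "\<dots> = G.comb {1..n} g (\<lambda>i. c (n + i))"
      unfolding G.comb_def by (rule G.finprod_cong') (auto simp: \<gamma>_def gi)
    also have "finprod G ?F ?R = finprod G (\<lambda>i. ?F (2 * n + i)) ?T"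
      by (rule G.finprod_reindex) (use F in auto)
    also have "\<dots> = finprod G (\<lambda>i. g i [^]\<^bsub>G\<^esub> (if m i = 0 then - c (2 * n + i) else 0)) {1..n}"
    proof (rule G.finprod_mono_neutral_cong_left)
      show "\<And>i. i \<in> ?T \<Longrightarrow> ?F (2 * n + i) = g i [^]\<^bsub>G\<^esub> (if m i = 0 then - c (2 * n + i) else 0)"
        by (auto simp: \<gamma>_def gi e'_def G.int_pow_neg G.int_pow_inv split: if_splits)
    qed (auto simp: gi e'_def)
    also have "\<dots> = G.comb {1..n} g (\<lambda>i. if m i = 0 then - c (2 * n + i) else 0)" by (simp add: G.comb_def)
    finally show ?thesis unfolding G.comb_add[OF g(1)] .
  qed
  have "block_class n e e' \<alpha> G \<gamma>"
  proof (intro block_class.intro bs assms(1) block_class_axioms.intro \<gamma>)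
    show "G.comb J \<gamma> c = \<one>\<^bsub>G\<^esub> \<longleftrightarrow> (\<exists>l. \<forall>j\<in>J. c j = l (blk j) * int (expo j))" for c
    proof
      assume "G.comb J \<gamma> c = \<one>\<^bsub>G\<^esub>"
      then have dv: "\<And>i. i \<in> {1..n} \<Longrightarrow> int (m i) dvd c (n + i) + (if m i = 0 then - c (2 * n + i) else 0)"
        unfolding comb rel by blast
      \<comment> \<open>The multiplier of a block is read off at \<open>s i\<close>. For an infinite
        factor, divisibility by \<open>0\<close> says that the coefficients at \<open>s i\<close>
        and \<open>r i\<close> agree.\<close>
      have "c j = c (n + blk j) div int (e (blk j)) * int (expo j)" if "j \<in> J" for j
        using that
      proof (cases rule: J_cases)
        case (s i)
        then show ?thesis using dv[of i] by (auto simp: e_def split: if_splits)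
      next
        case (r i)
        then show ?thesis using dv[of i] by (auto simp: e_def e'_def split: if_splits)
      qed
      then show "\<exists>l. \<forall>j\<in>J. c j = l (blk j) * int (expo j)"
        by (intro exI[of _ "\<lambda>i. c (n + i) div int (e i)"]) simp
    next
      assume "\<exists>l. \<forall>j\<in>J. c j = l (blk j) * int (expo j)"
      then obtain l where l: "\<And>j. j \<in> J \<Longrightarrow> c j = l (blk j) * int (expo j)" by blast
      show "G.comb J \<gamma> c = \<one>\<^bsub>G\<^esub>" unfolding comb rel
      proof
        fix i assume i: "i \<in> {1..n}"
        have "n + i \<in> J" "blk (n + i) = i" "expo (n + i) = e i" using i by (auto simp: J_def blk_def expo_def)
        then have 1: "c (n + i) = l i * int (e i)" using l by metis
        show "int (m i) dvd c (n + i) + (if m i = 0 then - c (2 * n + i) else 0)"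
        proof (cases "m i = 0")
          case True
          then have "2 * n + i \<in> J" "blk (2 * n + i) = i" "expo (2 * n + i) = e' i"
            using i by (auto simp: J_def blk_def expo_def e'_def)
          then have "c (2 * n + i) = l i * int (e' i)" using l by metis
          then show ?thesis using 1 True by (simp add: e_def e'_def)
        next
          case False
          then show ?thesis using 1 by (simp add: e_def)
        qed
      qed
    qed
    show "range (G.comb J \<gamma>) = carrier G"
    proof
      show "range (G.comb J \<gamma>) \<subseteq> carrier G" using G.comb_closed[OF \<gamma>] by auto
      show "carrier G \<subseteq> range (G.comb J \<gamma>)"
      proof
        fix y assume "y \<in> carrier G"
        then obtain b where b: "y = G.comb {1..n} g b" using g(2) by blast
        \<comment> \<open>The classes of the \<open>s i\<close> alone generate
          \<open>G\<close>.\<close>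
        have "G.comb J \<gamma> (\<lambda>j. if j \<le> 2 * n then b (j - n) else 0) = y"
          unfolding comb b by (rule G.comb_cong[OF _ _ g(1)]) auto
        then show "y \<in> range (G.comb J \<gamma>)" by blast
      qed
    qed
  qed
  then interpret block_class n e e' \<alpha> G \<gamma> .
  show ?thesis
    using is_gen_seed acyclic_seed coprime_seed realizes unfolding algebra_def by blast
qed

end
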